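(* Let $\mathcal{F}$ be a class of real-valued functions on $\chi$ with $\Phi:=\sup_{f\in\mathcal{F}}\|f\|_\infty<\infty$, and let $f_0\in\mathcal{F}$. Suppose that for some $A>0$ and $\alpha,\beta\ge0$, $$\sup_Q\ \sup_{\mathcal{F}'\subseteq\mathcal{F}-f_0}\log N\big(\zeta\|F'\|_{2,Q},\mathcal{F}',\|\cdot\|_{2,Q}\big)\le\frac{A}{\zeta^\alpha}\log^\beta\Big(\frac1\zeta\Big)\quad\text{for all }\zeta\in(0,1),$$ where $\mathcal{F}-f_0:=\{f-f_0:f\in\mathcal{F}\}$, $F'(x):=\sup_{g\in\mathcal{F}'}|g(x)|$, and the supremum in $Q$ is over all finitely supported discrete measures on $\chi$. Suppose there is $\sigma>0$ with $\mathbb{E}(\epsilon^2\mid X)\le\sigma^2$ almost everywhere $P_X$. Assume that $\sigma$, $\Phi$ and $A$ are constants (do not depend on $n$). Suppose moreover that there exists a constant $C_0>0$ such that $$\|F_\delta\|\le C_0\,\Phi^{1-s}\delta^s\quad\text{for all }\delta>0,$$ for some $s\in[0,1]$. Let $$r_n:=\begin{cases}n^{1/(2(2-s))}&\text{if }\alpha\in[0,2)\text{ and }\beta\ge0,\\ (n^{1/2}/\log n)^{1/(2-s)}&\text{if }\alpha=2\text{ and }\beta=0,\\ n^{1/(\alpha(2-s))}&\text{if }\alpha>2\text{ and }\beta=0.\end{cases}$$ Then there exists a constant $C>0$ depending only on $\sigma$, $\Phi$, $A$ and $\alpha$ such that for any $n\ge1$ and $D>0$, $$\mathbb{P}\big(r_n\|\widehat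 f-f_0\|\ge D\big)\le C\,D^{-4(2-s)/3}.$$
   Context: Setting: $(X_1,Y_1),\dots,(X_n,Y_n)$ are i.i.d. copies of $(X,Y)\in\chi\times\mathbb{R}$, where $\chi$ is a metric space; $P_X$ is the distribution of $X$; $f_0(x):=\mathbb{E}(Y\mid X=x)$; $\epsilon:=Y-f_0(X)$ (so $\mathbb{E}(\epsilon\mid X)=0$; no independence between $\epsilon$ and $X$ is assumed). The least squares estimator is $\widehat f:=\arg\min_{f\in\mathcal{F}}\sum_{i=1}^n(Y_i-f(X_i))^2$. Norms: for $g:\chi\to\mathbb{R}$, $\|g\|^2:=\int_\chi g^2\,dP_X$, $\|g\|_\infty:=\sup_{x\in\chi}|g(x)|$, and for a measure $Q$, $\|g\|_{2,Q}^2:=\int g^2\,dQ$. Covering number: for a class $\mathcal{G}$ and a (semi)norm $\mathcal{D}$, $N(\zeta,\mathcal{G},\mathcal{D})$ is the smallest $m\ge1$ for which there exist functions $g_1,\dots,g_m$ such that for every $g\in\mathcal{G}$ there is $j\le m$ with $\mathcal{D}(g-g_j)\le\zeta$. Local envelope: $F_\delta(x):=\sup\{|f(x)-f_0(x)|:\ f\in\mathcal{F},\ \|f-f_0\|\le\delta\}$.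
   Formalization: C may also depend on C_0 (independence of C_0 is false for s=1); the local classes {f-f_0: ||f-f_0||<=δ} and their squares are assumed P_X-measurable for all δ>0, members of F Borel; C is chosen for fixed carrier types of χ and the sample space. *)

theory Defs
  imports "HOL-Probability.Probability"
begin

text \<open>The square root of the integral of \<open>g\<^sup>2\<close>. All functions to which it is applied have a finite
  integral, so \<^const>\<open>enn2real\<close> loses nothing. The nonnegative integral (rather than the
  Bochner integral) is used because envelopes need only be measurable for the completion of \<open>P\<close>;
  for such functions it agrees with the integral for the completion (\<open>nn_integral_completion\<close>).\<close>

definition l2_norm :: "'a measure \<Rightarrow> ('a \<Rightarrow> real) \<Rightarrow> real" where
  "l2_norm P g = sqrt (enn2real (\<integral>\<^sup>+x. ennreal ((g x)\<^sup>2) \<partial>P))"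

definition sup_norm :: "('a \<Rightarrow> real) \<Rightarrow> ereal" where
  "sup_norm g = (SUP x. ereal \<bar>g x\<bar>)"

definition centered_class :: "('a \<Rightarrow> real) set \<Rightarrow> ('a \<Rightarrow> real) \<Rightarrow> ('a \<Rightarrow> real) set" where
  "centered_class F f0 = (\<lambda>f x. f x - f0 x) ` F"

definition envelope :: "('a \<Rightarrow> real) set \<Rightarrow> 'a \<Rightarrow> real" where
  "envelope G x = (SUP g\<in>G. \<bar>g x\<bar>)"

definition local_class ::
    "'a measure \<Rightarrow> ('a \<Rightarrow> real) set \<Rightarrow> ('a \<Rightarrow> real) \<Rightarrow> real \<Rightarrow> ('a \<Rightarrow> real) set" where
  "local_class P F f0 \<delta> = {g \<in> centered_class F f0. l2_norm P g \<le> \<delta>}"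

definition local_envelope ::
    "'a measure \<Rightarrow> ('a \<Rightarrow> real) set \<Rightarrow> ('a \<Rightarrow> real) \<Rightarrow> real \<Rightarrow> 'a \<Rightarrow> real" where
  "local_envelope P F f0 \<delta> = envelope (local_class P F f0 \<delta>)"

text \<open>The centres need not belong to the class. The value is \<open>\<infinity>\<close> if there is no finite cover.\<close>

definition covering_number :: "real \<Rightarrow> ('a \<Rightarrow> real) set \<Rightarrow> (('a \<Rightarrow> real) \<Rightarrow> real) \<Rightarrow> enat" where
  "covering_number \<zeta> G d =
     Inf (enat ` {m. 1 \<le> m \<and>
       (\<exists>c :: nat \<Rightarrow> 'a \<Rightarrow> real. \<forall>g\<in>G. \<exists>j<m. d (\<lambda>x. g x - c j x) \<le> \<zeta>)})"

definition ln_enat :: "enat \<Rightarrow> ereal" where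
  "ln_enat N = (case N of enat m \<Rightarrow> ereal (ln (real m)) | \<infinity> \<Rightarrow> \<infinity>)"

definition finitely_supported_measures :: "'a measure set" where
  "finitely_supported_measures =
     {density (count_space UNIV) (\<lambda>x. ennreal (w x)) | w :: 'a \<Rightarrow> real.
        (\<forall>x. 0 \<le> w x) \<and> finite {x. w x \<noteq> 0}}"

text \<open>The covering radius is relative to the envelope of the subclass, not to that of \<open>G\<close>.\<close>

definition uniform_entropy :: "real \<Rightarrow> ('a \<Rightarrow> real) set \<Rightarrow> ereal" where
  "uniform_entropy \<zeta> G =
     (SUP Q\<in>finitely_supported_measures. SUP G'\<in>Pow G.
        ln_enat (covering_number (\<zeta> * l2_norm Q (envelope G')) G' (l2_norm Q)))"

text \<open>Measurability of a class of functions in the sense of van der Vaart and Wellner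
  (\<open>P\<close>-measurable class): suprema of finite weighted sums over the class are measurable for the
  completion of the product measure. Taking one summand with weight 1 gives measurability of the
  envelope.\<close>

definition P_measurable_class :: "'a measure \<Rightarrow> ('a \<Rightarrow> real) set \<Rightarrow> bool" where
  "P_measurable_class P G \<longleftrightarrow> G \<subseteq> borel_measurable P \<and>
     (\<forall>(m::nat) (e :: nat \<Rightarrow> real).
        (\<lambda>x. SUP g\<in>G. \<bar>\<Sum>i<m. e i * g (x i)\<bar>)
          \<in> borel_measurable (completion (\<Pi>\<^sub>M i\<in>{..<m}. P)))"

definition generated_algebra ::
    "'w measure \<Rightarrow> ('w \<Rightarrow> 'a::topological_space) \<Rightarrow> 'w measure" where
  "generated_algebra M X = vimage_algebra (space M) X borel"

definition regression_function ::
    "'w measure \<Rightarrow> ('w \<Rightarrow> 'a::topological_space) \<Rightarrow> ('w \<Rightarrow> real) \<Rightarrow> ('a \<Rightarrow> real) \<Rightarrow> bool" where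
  "regression_function M X Y f0 \<longleftrightarrow>
     f0 \<in> borel_measurable borel \<and> integrable M Y \<and>
     (AE \<omega> in M. real_cond_exp M (generated_algebra M X) Y \<omega> = f0 (X \<omega>))"

text \<open>The conditional expectation of \<open>\<epsilon>\<^sup>2\<close> is taken in \<^typ>\<open>ennreal\<close>, since \<^const>\<open>real_cond_exp\<close>
  would send an infinite value to 0.\<close>

definition conditional_variance_bound ::
    "'w measure \<Rightarrow> ('w \<Rightarrow> 'a::topological_space) \<Rightarrow> ('w \<Rightarrow> real) \<Rightarrow> ('a \<Rightarrow> real) \<Rightarrow> real \<Rightarrow> bool" where
  "conditional_variance_bound M X Y f0 \<sigma> \<longleftrightarrow>
     (AE \<omega> in M. nn_cond_exp M (generated_algebra M X)
                     (\<lambda>\<omega>. ennreal ((Y \<omega> - f0 (X \<omega>))\<^sup>2)) \<omega> \<le> ennreal (\<sigma>\<^sup>2))"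

definition iid_copies ::
    "'w measure \<Rightarrow> ('w \<Rightarrow> 'a::topological_space) \<Rightarrow> ('w \<Rightarrow> real)
      \<Rightarrow> nat \<Rightarrow> (nat \<Rightarrow> 'w \<Rightarrow> 'a) \<Rightarrow> (nat \<Rightarrow> 'w \<Rightarrow> real) \<Rightarrow> bool" where
  "iid_copies M X Y n Xs Ys \<longleftrightarrow>
     prob_space.indep_vars M (\<lambda>_. borel \<Otimes>\<^sub>M borel) (\<lambda>i \<omega>. (Xs i \<omega>, Ys i \<omega>)) {..<n} \<and>
     (\<forall>i<n. distr M (borel \<Otimes>\<^sub>M borel) (\<lambda>\<omega>. (Xs i \<omega>, Ys i \<omega>))
            = distr M (borel \<Otimes>\<^sub>M borel) (\<lambda>\<omega>. (X \<omega>, Y \<omega>)))"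

definition least_squares_estimate ::
    "('a \<Rightarrow> real) set \<Rightarrow> nat \<Rightarrow> (nat \<Rightarrow> 'a) \<Rightarrow> (nat \<Rightarrow> real) \<Rightarrow> ('a \<Rightarrow> real) \<Rightarrow> bool" where
  "least_squares_estimate F n x y f \<longleftrightarrow>
     is_arg_min (\<lambda>f. \<Sum>i<n. (y i - f (x i))\<^sup>2) (\<lambda>f. f \<in> F) f"

text \<open>Only used when \<open>\<alpha> < 2\<close> or \<open>\<beta> = 0\<close>. For \<open>\<alpha> = 2\<close> and \<open>n = 1\<close> the rate is 0, by division
  by \<open>ln 1 = 0\<close>.\<close>

definition lse_rate :: "real \<Rightarrow> real \<Rightarrow> nat \<Rightarrow> real" where
  "lse_rate \<alpha> s n =
     (if \<alpha> < 2 then real n powr (1 / (2 * (2 - s)))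
      else if \<alpha> = 2 then (real n powr (1 / 2) / ln (real n)) powr (1 / (2 - s))
      else real n powr (1 / (\<alpha> * (2 - s))))"

end

theory Submission
  imports Defs
begin

text \<open>On the shell \<open>\<delta> / 2 \<le> \<parallel>g\<parallel> \<le> \<delta>\<close>, where \<open>g\<close> is the error of the least squares estimate, the basic
  inequality \<open>\<Sum> g(X\<^sub>i)\<^sup>2 \<le> 2 \<Sum> \<epsilon>\<^sub>i g(X\<^sub>i)\<close> forces the supremum over the local class of either the multiplier
  process or the centred process of squares to be of order \<open>n \<delta>\<^sup>2\<close>. Both suprema have second moment
  at most a constant times \<open>n L\<^sup>2 \<parallel>F\<^sub>\<delta>\<parallel>\<^sup>2\<close>, where \<open>L\<close> is a chaining sum cut off at a scale depending on
  \<open>n\<close>: after symmetrization the increments of the multiplier process are sub-Gaussian for the \<open>L\<^sup>2\<close> norm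
  of the random discrete measure with weights \<open>\<epsilon>\<^sub>i\<^sup>2\<close>, to which the uniform entropy condition applies, so
  no more than a conditional second moment of the errors is needed. Markov's inequality on dyadic
  shells gives the tail \<open>D\<^bsup>-2(2-s)\<^esup>\<close>, which is stronger than claimed for \<open>D \<ge> 1\<close>.\<close>

subsection \<open>Rademacher sums\<close>

text \<open>Two obstacles shape the argument. The constant has to be fixed before \<beta>, s, n and
  the model, so every bound is made uniform in them; \<beta> has no bound by assumption, only one
  implied by the entropy condition. And neither is the class countable nor the estimator measurable,
  so suprema are replaced by measurable majorants and the final event is covered by countably many
  measurable ones. The exponent of D comes from scaling. With an envelope norm of order
  \<open>\<delta> powr s\<close>, the second moment divided by the square of
  \<open>n * \<delta>\<^sup>2\<close> is of order
  \<open>L\<^sup>2 / n * \<delta> powr (2 * s - 4)\<close>. At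
  \<open>\<delta> = 2 ^ Suc j * (D / r)\<close> the inequality
  \<open>r powr (2 * (2 - s)) * L\<^sup>2 \<le> K0 * n\<close> is exactly what removes n, and this
  determines the rate r. The cutoff of the chaining sum is forced by \<alpha> \<ge> 2, where the
  full entropy sum diverges. The squares need no separate theory: they form a multiplier process
  with multiplier 1 over the squared class, and squaring is Lipschitz on a bounded class.\<close>

definition rsign :: "nat set \<Rightarrow> nat \<Rightarrow> real" where
  "rsign R i = (if i \<in> R then - 1 else 1)"

lemma rsign_sq [simp]: "(rsign R i)\<^sup>2 = 1"
  by (simp add: rsign_def)

text \<open>\<open>cosh x\<close> is the moment generating function of a random sign, so this is
  Hoeffding's lemma for it. The difference \<open>x\<^sup>2 / 2 - ln (cosh x)\<close> vanishes at 0
  and has derivative \<open>x - tanh x\<close>, nonnegative for x \<ge> 0 because its own derivative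
  is \<open>(tanh x)\<^sup>2\<close>; evenness does the rest.\<close>

lemma cosh_le_exp_half_square: "cosh (x::real) \<le> exp (x\<^sup>2 / 2)"
proof -
  have *: "ln (cosh x) \<le> x\<^sup>2 / 2" if "x \<ge> 0" for x :: real
  proof -
    have "(\<lambda>x. x\<^sup>2 / 2 - ln (cosh x)) 0 \<le> (\<lambda>x. x\<^sup>2 / 2 - ln (cosh x)) x"
    proof (rule DERIV_nonneg_imp_nondecreasing[OF that], intro exI conjI)
      fix y :: real assume y: "0 \<le> y" "y \<le> x"
      show "((\<lambda>x. x\<^sup>2 / 2 - ln (cosh x)) has_real_derivative (y - tanh y)) (at y)"
        by (auto intro!: derivative_eq_intros simp: tanh_def cosh_real_pos)
      have "(\<lambda>y. y - tanh y) 0 \<le> (\<lambda>y. y - tanh y) y"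
      proof (rule DERIV_nonneg_imp_nondecreasing[OF y(1)], intro exI conjI)
        fix z :: real
        show "((\<lambda>y. y - tanh y) has_real_derivative (tanh z)\<^sup>2) (at z)"
          by (auto intro!: derivative_eq_intros simp: power2_eq_square)
      qed simp
      then show "0 \<le> y - tanh y" by simp
    qed
    then show ?thesis by simp
  qed
  have "ln (cosh \<bar>x\<bar>) \<le> \<bar>x\<bar>\<^sup>2 / 2"
    by (rule *) simp
  then have "ln (cosh x) \<le> x\<^sup>2 / 2" by (simp add: cosh_real_abs)
  then show ?thesis
    by (metis cosh_real_pos exp_le_cancel_iff exp_ln)
qed

text \<open>Sign patterns are coded as subsets, so an average over independent signs is a finite sum
  over \<open>Pow {..<n}\<close> divided by \<open>2 ^ n\<close>. It factorizes because expanding a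
  product of two-term factors runs over exactly these subsets.\<close>

lemma rademacher_exp_sum:
  "(\<Sum>R\<in>Pow {..<n}. exp (\<Sum>i<n. rsign R i * v i)) \<le> 2 ^ n * exp ((\<Sum>i<n. (v i)\<^sup>2) / 2)"
proof -
  have "(\<Sum>R\<in>Pow {..<n}. exp (\<Sum>i<n. rsign R i * v i))
      = (\<Sum>R\<in>Pow {..<n}. (\<Prod>i\<in>R. exp (- v i)) * (\<Prod>i\<in>{..<n} - R. exp (v i)))"
  proof (rule sum.cong[OF refl])
    fix R assume "R \<in> Pow {..<n}"
    then have R: "R \<subseteq> {..<n}" by simp
    have "exp (\<Sum>i<n. rsign R i * v i) = (\<Prod>i<n. exp (rsign R i * v i))"
      by (simp add: exp_sum)
    also have "\<dots> = (\<Prod>i\<in>R. exp (rsign R i * v i)) * (\<Prod>i\<in>{..<n} - R. exp (rsign R i * v i))"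
      using R by (subst prod.subset_diff[OF R]) (auto simp: mult.commute)
    finally show "exp (\<Sum>i<n. rsign R i * v i) = (\<Prod>i\<in>R. exp (- v i)) * (\<Prod>i\<in>{..<n} - R. exp (v i))"
      by (simp add: rsign_def)
  qed
  also have "\<dots> = (\<Prod>i<n. exp (- v i) + exp (v i))"
    by (subst prod_add) auto
  also have "\<dots> = (\<Prod>i<n. 2 * cosh (v i))"
    by (intro prod.cong) (simp_all add: cosh_field_def)
  also have "\<dots> \<le> (\<Prod>i<n. 2 * exp ((v i)\<^sup>2 / 2))"
    by (intro prod_mono conjI mult_left_mono cosh_le_exp_half_square) auto
  also have "\<dots> = 2 ^ n * exp ((\<Sum>i<n. (v i)\<^sup>2) / 2)"
    by (simp add: prod.distrib exp_sum sum_divide_distrib)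
  finally show ?thesis .
qed

lemma square_sum_le: "((x::real) + y)\<^sup>2 \<le> 2 * x\<^sup>2 + 2 * y\<^sup>2"
  using zero_le_power2[of "x - y"] by (simp add: power2_sum power2_diff)

text \<open>Below the threshold L the square is at most \<open>L\<^sup>2\<close>; above it the
  excess is paid for exponentially. The factor \<open>exp (- L)\<close> is what later beats a union
  bound.\<close>

lemma square_le_exp: "(z::real)\<^sup>2 \<le> 2 * L\<^sup>2 + 4 * exp (z - L)" if "z \<ge> 0" "L \<ge> 0"
proof (cases "z \<le> L")
  case True
  then have "z\<^sup>2 \<le> L\<^sup>2" using that by (intro power_mono) auto
  moreover have "0 \<le> L\<^sup>2" by simp
  ultimately show ?thesis using exp_ge_zero[of "z - L"] by linarith
next
  case False
  have "1 + (z - L) + (z - L)\<^sup>2 / 2 \<le> exp (z - L)"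
    by (rule exp_lower_Taylor_quadratic) (use False in auto)
  then have 1: "2 * (z - L)\<^sup>2 \<le> 4 * exp (z - L)" using False by linarith
  have "z\<^sup>2 = (L + (z - L))\<^sup>2" by simp
  also have "\<dots> \<le> 2 * L\<^sup>2 + 2 * (z - L)\<^sup>2" by (rule square_sum_le)
  finally show ?thesis using 1 by linarith
qed

text \<open>A maximum of exponentials is at most their sum, which costs the factor
  \<open>card T\<close>. Passing through \<open>square_le_exp\<close> gives the second moment of the
  maximum directly, without integrating a tail.\<close>

lemma rademacher_max_unit:
  assumes T: "finite T" "T \<noteq> {}" and v: "\<And>t. t \<in> T \<Longrightarrow> (\<Sum>i<n. (v t i)\<^sup>2) \<le> 1"
  shows "(\<Sum>R\<in>Pow {..<n}. Max ((\<lambda>t. (\<Sum>i<n. rsign R i * v t i)\<^sup>2) ` T))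
           \<le> 2 ^ n * (8 * (1 + ln (card T)))"
proof -
  define l where "l = 1 + ln (real (card T))"
  \<comment> \<open>\<open>a\<^sup>2 = 2 * l\<close> makes each averaged exponential at most
    \<open>exp l\<close>. With the threshold \<open>2 * l\<close> the sum over T then contributes a
    multiple of \<open>card T * exp (- l) = exp (-1)\<close>, and division by
    \<open>a\<^sup>2\<close> leaves a bound linear in l.\<close>
  define a where "a = sqrt (2 * l)"
  define Z where "Z R t = (\<Sum>i<n. rsign R i * v t i)" for R t
  have c1: "card T \<ge> 1" using T by (simp add: Suc_le_eq card_gt_0_iff)
  then have l1: "l \<ge> 1" by (simp add: l_def)
  have a2: "a\<^sup>2 = 2 * l" and apos: "a > 0" using l1 by (auto simp: a_def)
  have pt: "a\<^sup>2 * Max ((\<lambda>t. (Z R t)\<^sup>2) ` T) \<le> 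
       8 * l\<^sup>2 + (\<Sum>t\<in>T. 4 * exp (- 2 * l) * (exp (a * Z R t) + exp (- (a * Z R t))))" for R
  proof -
    have "Max ((\<lambda>t. (Z R t)\<^sup>2) ` T) \<in> (\<lambda>t. (Z R t)\<^sup>2) ` T"
      using T by (intro Max_in) auto
    then obtain t where t: "t \<in> T" "Max ((\<lambda>t. (Z R t)\<^sup>2) ` T) = (Z R t)\<^sup>2" by auto
    have "a\<^sup>2 * (Z R t)\<^sup>2 = \<bar>a * Z R t\<bar>\<^sup>2" by (simp add: power_mult_distrib)
    also have "\<dots> \<le> 2 * (2 * l)\<^sup>2 + 4 * exp (\<bar>a * Z R t\<bar> - 2 * l)"
      by (rule square_le_exp) (use l1 in auto)
    also have "exp (\<bar>a * Z R t\<bar> - 2 * l) \<le> exp (- 2 * l) * (exp (a * Z R t) + exp (- (a * Z R t)))"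
      by (auto simp: abs_if exp_diff exp_minus field_simps)
    also have "2 * (2 * l)\<^sup>2 + 4 * (exp (- 2 * l) * (exp (a * Z R t) + exp (- (a * Z R t)))) =
       8 * l\<^sup>2 + 4 * exp (- 2 * l) * (exp (a * Z R t) + exp (- (a * Z R t)))"
      by (simp add: power2_eq_square)
    also have "\<dots> \<le> 8 * l\<^sup>2 + (\<Sum>t\<in>T. 4 * exp (- 2 * l) * (exp (a * Z R t) + exp (- (a * Z R t))))"
      by (intro add_left_mono member_le_sum t T) (auto intro!: mult_nonneg_nonneg add_nonneg_nonneg)
    finally show ?thesis using t by simp
  qed
  have e: "(\<Sum>R\<in>Pow {..<n}. exp (b * Z R t)) \<le> 2 ^ n * exp l" if "t \<in> T" "b\<^sup>2 = 2 * l" for t b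
  proof -
    have "(\<Sum>R\<in>Pow {..<n}. exp (b * Z R t)) = (\<Sum>R\<in>Pow {..<n}. exp (\<Sum>i<n. rsign R i * (b * v t i)))"
      by (simp add: Z_def sum_distrib_left mult_ac)
    also have "\<dots> \<le> 2 ^ n * exp ((\<Sum>i<n. (b * v t i)\<^sup>2) / 2)"
      by (rule rademacher_exp_sum)
    also have "(\<Sum>i<n. (b * v t i)\<^sup>2) = 2 * l * (\<Sum>i<n. (v t i)\<^sup>2)"
      by (simp add: power_mult_distrib that sum_distrib_left)
    also have "2 ^ n * exp (2 * l * (\<Sum>i<n. (v t i)\<^sup>2) / 2) \<le> 2 ^ n * exp l"
      using v[OF that(1)] l1 by (simp add: mult_left_le)
    finally show ?thesis .
  qed
  have "a\<^sup>2 * (\<Sum>R\<in>Pow {..<n}. Max ((\<lambda>t. (Z R t)\<^sup>2) ` T)) \<le>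
     (\<Sum>R\<in>Pow {..<n}. 8 * l\<^sup>2 + (\<Sum>t\<in>T. 4 * exp (- 2 * l) * (exp (a * Z R t) + exp (- (a * Z R t)))))"
    unfolding sum_distrib_left by (intro sum_mono pt)
  also have "\<dots> = 2 ^ n * (8 * l\<^sup>2) + (\<Sum>t\<in>T. 4 * exp (- 2 * l) * 
       ((\<Sum>R\<in>Pow {..<n}. exp (a * Z R t)) + (\<Sum>R\<in>Pow {..<n}. exp ((-a) * Z R t))))"
    by (simp add: sum.distrib card_Pow sum.swap[of _ T] sum_distrib_left[symmetric])
  also have "\<dots> \<le> 2 ^ n * (8 * l\<^sup>2) + (\<Sum>t\<in>T. 4 * exp (- 2 * l) * (2 ^ n * exp l + 2 ^ n * exp l))"
    by (intro add_left_mono sum_mono mult_left_mono add_mono e) (auto simp: a2)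
  also have "\<dots> = 2 ^ n * (8 * l\<^sup>2 + 8 * (card T * exp (- l)))"
    by (simp add: algebra_simps flip: exp_add)
  also have "card T * exp (- l) = exp (-1)"
    using c1 by (simp add: l_def exp_diff exp_minus field_simps)
  also have "2 ^ n * (8 * l\<^sup>2 + 8 * exp (-1)) \<le> 2 ^ n * (a\<^sup>2 * (8 * l))"
  proof -
    have "exp (-1::real) \<le> 1" by simp
    moreover have "1 \<le> l\<^sup>2" using l1 by simp
    ultimately have "8 * l\<^sup>2 + 8 * exp (-1) \<le> a\<^sup>2 * (8 * l)"
      by (simp only: a2 power2_eq_square[of l])
    then show ?thesis by (intro mult_left_mono) auto
  qed
  finally have "a\<^sup>2 * (\<Sum>R\<in>Pow {..<n}. Max ((\<lambda>t. (Z R t)\<^sup>2) ` T)) \<le> a\<^sup>2 * (2 ^ n * (8 * l))"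
    by (simp add: mult_ac)
  then show ?thesis
    using apos by (simp add: Z_def l_def)
qed

lemma rademacher_max:
  assumes T: "finite T" "T \<noteq> {}" and c: "c \<ge> 0"
    and v: "\<And>t. t \<in> T \<Longrightarrow> (\<Sum>i<n. (v t i)\<^sup>2) \<le> c\<^sup>2"
  shows "(\<Sum>R\<in>Pow {..<n}. Max ((\<lambda>t. (\<Sum>i<n. rsign R i * v t i)\<^sup>2) ` T))
           \<le> 2 ^ n * (8 * c\<^sup>2 * (1 + ln (card T)))"
proof (cases "c = 0")
  case True
  have "v t i = 0" if "t \<in> T" "i < n" for t i
    using v[OF that(1)] that True sum_nonneg_eq_0_iff[of "{..<n}" "\<lambda>i. (v t i)\<^sup>2"]
    by (simp add: sum_nonneg order.antisym)
  then have "Max ((\<lambda>t. (\<Sum>i<n. rsign R i * v t i)\<^sup>2) ` T) = 0" for R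
    using T by (subst Max_eq_iff) (auto simp: image_iff)
  then show ?thesis using True by simp
next
  case False
  have *: "(\<lambda>t. (\<Sum>i<n. rsign R i * v t i)\<^sup>2) = (\<lambda>t. c\<^sup>2 * (\<Sum>i<n. rsign R i * (v t i / c))\<^sup>2)" for R
    using False by (auto simp: sum_divide_distrib[symmetric] power_divide)
  have "(\<Sum>R\<in>Pow {..<n}. Max ((\<lambda>t. (\<Sum>i<n. rsign R i * v t i)\<^sup>2) ` T)) =
      c\<^sup>2 * (\<Sum>R\<in>Pow {..<n}. Max ((\<lambda>t. (\<Sum>i<n. rsign R i * (v t i / c))\<^sup>2) ` T))"
    unfolding sum_distrib_left
  proof (rule sum.cong[OF refl])
    fix R
    have "c\<^sup>2 * Max ((\<lambda>t. (\<Sum>i<n. rsign R i * (v t i / c))\<^sup>2) ` T)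
       = Max ((\<lambda>x. c\<^sup>2 * x) ` ((\<lambda>t. (\<Sum>i<n. rsign R i * (v t i / c))\<^sup>2) ` T))"
      using T by (intro mono_Max_commute) (auto intro!: monoI mult_left_mono)
    then show "Max ((\<lambda>t. (\<Sum>i<n. rsign R i * v t i)\<^sup>2) ` T)
       = c\<^sup>2 * Max ((\<lambda>t. (\<Sum>i<n. rsign R i * (v t i / c))\<^sup>2) ` T)"
      unfolding * image_image by simp
  qed
  also have "\<dots> \<le> c\<^sup>2 * (2 ^ n * (8 * (1 + ln (card T))))"
    using v c False
    by (intro mult_left_mono rademacher_max_unit T)
       (auto simp: power_divide sum_divide_distrib[symmetric] divide_le_eq)
  finally show ?thesis by (simp add: algebra_simps)
qed

subsection \<open>Chaining under uniform entropy\<close>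

definition weighted_norm :: "nat \<Rightarrow> (nat \<Rightarrow> real) \<Rightarrow> (nat \<Rightarrow> 'a) \<Rightarrow> ('a \<Rightarrow> real) \<Rightarrow> real" where
  "weighted_norm m c x g = sqrt (\<Sum>i<m. c i * (g (x i))\<^sup>2)"

text \<open>Weights are summed over the fibre of a point because sample points may coincide;
  \<open>weighted_norm\<close> keeps the indices instead.\<close>

definition weighted_measure :: "nat \<Rightarrow> (nat \<Rightarrow> real) \<Rightarrow> (nat \<Rightarrow> 'a) \<Rightarrow> 'a measure" where
  "weighted_measure m c x =
     density (count_space UNIV) (\<lambda>y. ennreal (\<Sum>i | i < m \<and> x i = y. c i))"

lemma weighted_norm_nonneg [simp]: "\<forall>i<m. c i \<ge> 0 \<Longrightarrow> weighted_norm m c x g \<ge> 0"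
  by (auto simp: weighted_norm_def intro!: sum_nonneg)

lemma weighted_norm_sq:
  "\<forall>i<m. c i \<ge> 0 \<Longrightarrow> (weighted_norm m c x g)\<^sup>2 = (\<Sum>i<m. c i * (g (x i))\<^sup>2)"
  by (auto simp: weighted_norm_def intro!: sum_nonneg)

lemma weighted_norm_mono:
  assumes "\<forall>i<m. c i \<ge> 0" "\<And>i. i < m \<Longrightarrow> \<bar>f (x i)\<bar> \<le> \<bar>g (x i)\<bar>"
  shows "weighted_norm m c x f \<le> weighted_norm m c x g"
  using assms unfolding weighted_norm_def
  by (intro real_sqrt_le_mono sum_mono mult_left_mono) (auto simp: abs_le_square_iff)

lemma weighted_norm_eq_L2_set:
  assumes "\<forall>i<m. c i \<ge> 0"
  shows "weighted_norm m c x g = L2_set (\<lambda>i. sqrt (c i) * g (x i)) {..<m}"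
  using assms unfolding weighted_norm_def L2_set_def
  by (auto simp: power_mult_distrib intro!: sum.cong)

lemma weighted_norm_minus_commute:
  "weighted_norm m c x (\<lambda>y. f y - g y) = weighted_norm m c x (\<lambda>y. g y - f y)"
  unfolding weighted_norm_def by (simp add: power2_commute[of "f _" "g _"])

lemma weighted_norm_triangle:
  assumes "\<forall>i<m. c i \<ge> 0"
  shows "weighted_norm m c x (\<lambda>y. f y - h y) \<le>
    weighted_norm m c x (\<lambda>y. f y - g y) + weighted_norm m c x (\<lambda>y. h y - g y)"
proof -
  have "weighted_norm m c x (\<lambda>y. f y - h y) =
     L2_set (\<lambda>i. sqrt (c i) * (f (x i) - g (x i)) + sqrt (c i) * (g (x i) - h (x i))) {..<m}"
    by (simp add: weighted_norm_eq_L2_set assms algebra_simps)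
  also have "\<dots> \<le> L2_set (\<lambda>i. sqrt (c i) * (f (x i) - g (x i))) {..<m} +
      L2_set (\<lambda>i. sqrt (c i) * (g (x i) - h (x i))) {..<m}"
    by (rule L2_set_triangle_ineq)
  also have "L2_set (\<lambda>i. sqrt (c i) * (g (x i) - h (x i))) {..<m} = weighted_norm m c x (\<lambda>y. h y - g y)"
    by (subst weighted_norm_minus_commute) (simp add: weighted_norm_eq_L2_set assms)
  finally show ?thesis by (simp add: weighted_norm_eq_L2_set assms)
qed

lemma weighted_measure_finitely_supported:
  assumes "\<forall>i<m. c i \<ge> 0"
  shows "weighted_measure m c x \<in> finitely_supported_measures"
  unfolding finitely_supported_measures_def weighted_measure_def
proof (rule CollectI, intro exI conjI allI)
  have "(\<Sum>i | i < m \<and> x i = y. c i) = 0" if "y \<notin> x ` {..<m}" for y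
    using that by (intro sum.neutral) auto
  then have "{y. (\<Sum>i | i < m \<and> x i = y. c i) \<noteq> 0} \<subseteq> x ` {..<m}"
    by blast
  then show "finite {y. (\<Sum>i | i < m \<and> x i = y. c i) \<noteq> 0}"
    by (rule finite_subset) auto
qed (use assms in \<open>auto intro!: sum_nonneg\<close>)

lemma l2_norm_weighted_measure:
  assumes "\<forall>i<m. c i \<ge> 0"
  shows "l2_norm (weighted_measure m c x) g = weighted_norm m c x g"
proof -
  have "(\<integral>\<^sup>+y. ennreal ((g y)\<^sup>2) \<partial>weighted_measure m c x)
      = (\<integral>\<^sup>+y. ennreal (\<Sum>i | i < m \<and> x i = y. c i) * ennreal ((g y)\<^sup>2) \<partial>count_space UNIV)"
    unfolding weighted_measure_def by (subst nn_integral_density) auto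
  also have "\<dots> = (\<Sum>y\<in>x ` {..<m}. ennreal (\<Sum>i | i < m \<and> x i = y. c i) * ennreal ((g y)\<^sup>2))"
  proof (rule nn_integral_count_space')
    fix y assume "y \<notin> x ` {..<m}"
    then have "(\<Sum>i | i < m \<and> x i = y. c i) = 0" by (intro sum.neutral) auto
    then show "ennreal (\<Sum>i | i < m \<and> x i = y. c i) * ennreal ((g y)\<^sup>2) = 0" by simp
  qed auto
  also have "\<dots> = (\<Sum>y\<in>x ` {..<m}. ennreal (\<Sum>i | i < m \<and> x i = y. c i * (g (x i))\<^sup>2))"
  proof (rule sum.cong[OF refl])
    fix y
    have "(\<Sum>i | i < m \<and> x i = y. c i * (g (x i))\<^sup>2) = (\<Sum>i | i < m \<and> x i = y. c i) * (g y)\<^sup>2"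
      by (simp add: sum_distrib_right)
    then show "ennreal (\<Sum>i | i < m \<and> x i = y. c i) * ennreal ((g y)\<^sup>2) =
        ennreal (\<Sum>i | i < m \<and> x i = y. c i * (g (x i))\<^sup>2)"
      using assms by (simp add: ennreal_mult'' sum_nonneg)
  qed
  also have "\<dots> = ennreal (\<Sum>y\<in>x ` {..<m}. \<Sum>i | i < m \<and> x i = y. c i * (g (x i))\<^sup>2)"
    using assms by (intro sum_ennreal) (auto intro!: sum_nonneg)
  also have "(\<Sum>y\<in>x ` {..<m}. \<Sum>i | i < m \<and> x i = y. c i * (g (x i))\<^sup>2) = (\<Sum>i<m. c i * (g (x i))\<^sup>2)"
    using sum.image_gen[of "{..<m}" "\<lambda>i. c i * (g (x i))\<^sup>2" x] by simp
  also have "enn2real \<dots> = (\<Sum>i<m. c i * (g (x i))\<^sup>2)"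
    using assms by (intro enn2real_ennreal sum_nonneg) auto
  finally show ?thesis
    by (simp add: l2_norm_def weighted_norm_def)
qed

section \<open>Finite nets from the uniform entropy condition\<close>

lemma covering_number_attained:
  assumes "covering_number \<zeta> G d = enat m"
  shows "m \<ge> 1" "\<exists>c :: nat \<Rightarrow> 'a \<Rightarrow> real. \<forall>g\<in>G. \<exists>j<m. d (\<lambda>x. g x - c j x) \<le> \<zeta>"
proof -
  define S where "S = {m. 1 \<le> m \<and> (\<exists>c :: nat \<Rightarrow> 'a \<Rightarrow> real. \<forall>g\<in>G. \<exists>j<m. d (\<lambda>x. g x - c j x) \<le> \<zeta>)}"
  have "Inf (enat ` S) = enat m" using assms by (simp add: covering_number_def S_def)
  moreover from this have "enat ` S \<noteq> {}" by (auto simp: Inf_enat_def split: if_splits)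
  ultimately have "enat m \<in> enat ` S"
    by (metis wellorder_InfI ex_in_conv)
  then have "m \<in> S" by auto
  then show "m \<ge> 1" "\<exists>c :: nat \<Rightarrow> 'a \<Rightarrow> real. \<forall>g\<in>G. \<exists>j<m. d (\<lambda>x. g x - c j x) \<le> \<zeta>"
    by (auto simp: S_def)
qed

text \<open>Both suprema are instantiated: Q is the discrete measure of the data at hand, with any
  nonnegative weights, and the radius refers to the envelope of the subclass. Random weights and
  local classes thus share one deterministic bound H.\<close>

lemma uniform_entropy_cover:
  assumes H: "uniform_entropy \<zeta> G \<le> ereal H" and sub: "G' \<subseteq> G"
    and c: "\<forall>i<m. c i \<ge> 0"
  shows "\<exists>p ctr. p \<ge> 1 \<and> ln (real p) \<le> H \<and>
    (\<forall>g\<in>G'. \<exists>j<p. weighted_norm m c x (\<lambda>y. g y - ctr j y)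
                       \<le> \<zeta> * weighted_norm m c x (envelope G'))"
proof -
  define Q where "Q = weighted_measure m c x"
  define N where "N = covering_number (\<zeta> * l2_norm Q (envelope G')) G' (l2_norm Q)"
  have "ln_enat N \<le> uniform_entropy \<zeta> G"
    unfolding uniform_entropy_def N_def
    by (rule SUP_upper2[of Q], simp add: Q_def weighted_measure_finitely_supported c,
        rule SUP_upper2[of G']) (use sub in auto)
  then have le: "ln_enat N \<le> ereal H" using H by (rule order_trans)
  then obtain p where p: "N = enat p" by (cases N) (auto simp: ln_enat_def)
  obtain ctr where "p \<ge> 1" "\<forall>g\<in>G'. \<exists>j<p. l2_norm Q (\<lambda>x. g x - ctr j x) \<le> \<zeta> * l2_norm Q (envelope G')"
    using covering_number_attained[OF p[unfolded N_def]] by auto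
  moreover have "ln (real p) \<le> H" using le by (simp add: p ln_enat_def)
  ultimately have "p \<ge> 1 \<and> ln (real p) \<le> H \<and>
    (\<forall>g\<in>G'. \<exists>j<p. weighted_norm m c x (\<lambda>y. g y - ctr j y)
                       \<le> \<zeta> * weighted_norm m c x (envelope G'))"
    unfolding Q_def l2_norm_weighted_measure[OF c] by (intro conjI)
  then show ?thesis by (intro exI)
qed

text \<open>Centres of a cover may lie outside the class, but increments of the process are
  controlled only between members of G'. Each centre whose ball meets G' is exchanged for a member
  in that ball; this doubles the radius and does not add points.\<close>

lemma uniform_entropy_internal_net:
  assumes H: "uniform_entropy \<zeta> G \<le> ereal H" and sub: "G' \<subseteq> G" "G' \<noteq> {}"
    and c: "\<forall>i<m. c i \<ge> 0"
  shows "\<exists>T. finite T \<and> T \<noteq> {} \<and> T \<subseteq> G' \<and> ln (real (card T)) \<le> H \<and>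
    (\<forall>g\<in>G'. \<exists>t\<in>T. weighted_norm m c x (\<lambda>y. g y - t y)
                       \<le> 2 * \<zeta> * weighted_norm m c x (envelope G'))"
proof -
  define r where "r = \<zeta> * weighted_norm m c x (envelope G')"
  obtain p ctr where p: "p \<ge> 1" "ln (real p) \<le> H"
    "\<forall>g\<in>G'. \<exists>j<p. weighted_norm m c x (\<lambda>y. g y - ctr j y) \<le> r"
    using uniform_entropy_cover[where m = m and c = c and x = x, OF H sub(1) c] unfolding r_def by (elim exE conjE)
  define J where "J = {j. j < p \<and> (\<exists>g\<in>G'. weighted_norm m c x (\<lambda>y. g y - ctr j y) \<le> r)}"
  have "\<forall>j\<in>J. \<exists>g. g \<in> G' \<and> weighted_norm m c x (\<lambda>y. g y - ctr j y) \<le> r"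
    unfolding J_def by blast
  from bchoice[OF this] obtain t where
    t: "\<forall>j\<in>J. t j \<in> G' \<and> weighted_norm m c x (\<lambda>y. t j y - ctr j y) \<le> r" ..
  have J: "finite J" "J \<subseteq> {..<p}" by (auto simp: J_def)
  have net: "\<exists>j\<in>J. weighted_norm m c x (\<lambda>y. g y - t j y) \<le> 2 * r" if "g \<in> G'" for g
  proof -
    obtain j where j: "j < p" "weighted_norm m c x (\<lambda>y. g y - ctr j y) \<le> r"
      using bspec[OF p(3) \<open>g \<in> G'\<close>] by blast
    then have "j \<in> J" using that by (auto simp: J_def)
    have "weighted_norm m c x (\<lambda>y. g y - t j y) \<le>
        weighted_norm m c x (\<lambda>y. g y - ctr j y) + weighted_norm m c x (\<lambda>y. t j y - ctr j y)"
      by (rule weighted_norm_triangle[OF c])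
    also have "\<dots> \<le> 2 * r" using j bspec[OF t \<open>j \<in> J\<close>] by simp
    finally show ?thesis using \<open>j \<in> J\<close> by blast
  qed
  show ?thesis
  proof (intro exI[of _ "t ` J"] conjI)
    show "t ` J \<noteq> {}" using net sub(2) by blast
    have "card (t ` J) \<le> p"
      using card_image_le[OF J(1), of t] card_mono[OF _ J(2)] by simp
    moreover have "card (t ` J) > 0" using J \<open>t ` J \<noteq> {}\<close> by (simp add: card_gt_0_iff)
    ultimately have "ln (real (card (t ` J))) \<le> ln (real p)" by simp
    then show "ln (real (card (t ` J))) \<le> H" using p by simp
  qed (use J t net in \<open>auto simp: r_def mult.assoc\<close>)
qed

lemma sum_square_weighted:
  fixes x a :: "nat \<Rightarrow> real"
  assumes "\<And>k. k < K \<Longrightarrow> a k > 0"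
  shows "(\<Sum>k<K. x k)\<^sup>2 \<le> (\<Sum>k<K. a k) * (\<Sum>k<K. (x k)\<^sup>2 / a k)"
proof -
  have "(\<Sum>k<K. x k)\<^sup>2 = (\<Sum>k<K. sqrt (a k) * (x k / sqrt (a k)))\<^sup>2"
    using assms by (intro arg_cong[where f = "\<lambda>x. x\<^sup>2"] sum.cong) (auto simp: less_imp_neq[symmetric])
  also have "\<dots> \<le> (\<Sum>k<K. (sqrt (a k))\<^sup>2) * (\<Sum>k<K. (x k / sqrt (a k))\<^sup>2)"
    by (rule Cauchy_Schwarz_ineq_sum)
  also have "\<dots> = (\<Sum>k<K. a k) * (\<Sum>k<K. (x k)\<^sup>2 / a k)"
    using assms by (intro arg_cong2[where f = "(*)"] sum.cong) (auto simp: power_divide less_imp_le)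
  finally show ?thesis .
qed

text \<open>The increments between successive nets are combined by the Cauchy--Schwarz inequality with
  weights proportional to the bounds on them.\<close>

lemma chaining:
  fixes G G' :: "('a \<Rightarrow> real) set" and u :: "('a \<Rightarrow> real) \<Rightarrow> nat \<Rightarrow> real"
  assumes ent: "\<And>k. k \<ge> 1 \<Longrightarrow> uniform_entropy ((1/2) ^ k) G \<le> ereal (H k)"
    and H0: "\<And>k. H k \<ge> 0" and Hmono: "\<And>k. H k \<le> H (Suc k)"
    and sub: "G' \<subseteq> G" and zero: "(\<lambda>_. 0) \<in> G'"
    and bdd: "\<And>y. bdd_above ((\<lambda>g. \<bar>g y\<bar>) ` G')"
    and c: "\<forall>i<m. c i \<ge> 0"
    and u0: "\<And>i. i < n \<Longrightarrow> u (\<lambda>_. 0) i = 0"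
    and u: "\<And>f g. f \<in> G' \<Longrightarrow> g \<in> G' \<Longrightarrow>
          (\<Sum>i<n. (u f i - u g i)\<^sup>2) \<le> (weighted_norm m c x (\<lambda>y. f y - g y))\<^sup>2"
  shows "\<exists>W. (\<forall>R\<subseteq>{..<n}. \<forall>g\<in>G'. (\<Sum>i<n. rsign R i * u g i)\<^sup>2 \<le> W R) \<and>
     (\<Sum>R\<in>Pow {..<n}. W R) \<le> 2 ^ n * (576 * ((\<Sum>k<K. (1/2) ^ Suc k * sqrt (1 + 2 * H (Suc k)))\<^sup>2
         + n * (1/4) ^ K) * (weighted_norm m c x (envelope G'))\<^sup>2)"
proof -
  define \<rho> where "\<rho> = weighted_norm m c x (envelope G')"
  have \<rho>0: "\<rho> \<ge> 0" by (simp add: \<rho>_def c)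
  let ?d = "\<lambda>f g. weighted_norm m c x (\<lambda>y. f y - g y)"
  have env: "\<bar>g y\<bar> \<le> envelope G' y" if "g \<in> G'" for g y
    unfolding envelope_def using that bdd by (rule cSUP_upper)
  have env0: "0 \<le> envelope G' y" for y
    using env[OF zero, of y] by simp
  have ne: "G' \<noteq> {}" using zero by blast
  have exT: "\<exists>T. finite T \<and> T \<noteq> {} \<and> T \<subseteq> G' \<and> ln (real (card T)) \<le> H k
       \<and> (\<forall>g\<in>G'. \<exists>t\<in>T. ?d g t \<le> 2 * (1/2) ^ k * \<rho>)" if "k \<ge> 1" for k
    using uniform_entropy_internal_net[where m = m and c = c and x = x, OF ent[OF that] sub ne c] unfolding \<rho>_def .
  \<comment> \<open>The chain starts at the zero function, where u vanishes. It is a net of level 0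
    because every member of G' is dominated by the envelope and hence within \<rho> of 0.\<close>
  define T where "T k = (if k = 0 then {\<lambda>_. 0} else
     (SOME T. finite T \<and> T \<noteq> {} \<and> T \<subseteq> G' \<and> ln (real (card T)) \<le> H k
       \<and> (\<forall>g\<in>G'. \<exists>t\<in>T. ?d g t \<le> 2 * (1/2) ^ k * \<rho>)))" for k
  have d0: "?d g (\<lambda>_. 0) \<le> \<rho>" if "g \<in> G'" for g
    unfolding \<rho>_def using env[OF that] env0 by (intro weighted_norm_mono c) auto
  have T: "finite (T k) \<and> T k \<noteq> {} \<and> T k \<subseteq> G' \<and> ln (real (card (T k))) \<le> H k
       \<and> (\<forall>g\<in>G'. \<exists>t\<in>T k. ?d g t \<le> 2 * (1/2) ^ k * \<rho>)" for k
  proof (cases "k = 0")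
    case True
    then have "T k = {\<lambda>_. 0}" by (simp add: T_def)
    then show ?thesis using True zero d0 \<rho>0 H0[of k] by force
  next
    case False
    then show ?thesis unfolding T_def using someI_ex[OF exT[of k]] by simp
  qed
  define pr where "pr k g = (SOME t. t \<in> T k \<and> ?d g t \<le> 2 * (1/2) ^ k * \<rho>)" for k g
  have pr: "pr k g \<in> T k \<and> ?d g (pr k g) \<le> 2 * (1/2) ^ k * \<rho>" if "g \<in> G'" for k g
  proof -
    have "\<exists>t. t \<in> T k \<and> ?d g t \<le> 2 * (1/2) ^ k * \<rho>" using T[of k] that by blast
    then show ?thesis unfolding pr_def by (rule someI_ex)
  qed
  \<comment> \<open>\<open>6 * (1/2) ^ Suc k\<close> is
    \<open>2 * (1/2) ^ Suc k + 2 * (1/2) ^ k\<close>: the triangle inequality through g for its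
    approximations at two consecutive levels.\<close>
  define \<tau> where "\<tau> k = 6 * (1/2) ^ Suc k * \<rho>" for k
  \<comment> \<open>Only close pairs of net points occur as links. There are at most
    \<open>card (T (Suc k)) * card (T k)\<close> of them, whence the \<open>2 * H (Suc k)\<close> in
    the chaining sum.\<close>
  define PT where "PT k = {p \<in> T (Suc k) \<times> T k. ?d (fst p) (snd p) \<le> \<tau> k}" for k
  define Z where "Z R g = (\<Sum>i<n. rsign R i * u g i)" for R g
  define Zd where "Zd R p = (\<Sum>i<n. rsign R i * (u (fst p) i - u (snd p) i))" for R p
  have Zd: "Zd R p = Z R (fst p) - Z R (snd p)" for R p
    by (simp add: Zd_def Z_def sum_subtractf right_diff_distrib)
  define Mx where "Mx k R = Max ((\<lambda>p. (Zd R p)\<^sup>2) ` PT k)" for k R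
  define a where "a k = (1/2) ^ Suc k * sqrt (1 + 2 * H (Suc k))" for k
  have a0: "a k > 0" for k using H0[of "Suc k"] by (simp add: a_def)
  have prPT: "(pr (Suc k) g, pr k g) \<in> PT k" if "g \<in> G'" for k g
  proof -
    have "?d (pr (Suc k) g) (pr k g) \<le> ?d (pr (Suc k) g) g + ?d (pr k g) g"
      by (rule weighted_norm_triangle[OF c])
    also have "\<dots> = ?d g (pr (Suc k) g) + ?d g (pr k g)"
      by (simp add: weighted_norm_minus_commute[of _ _ _ _ g])
    also have "\<dots> \<le> 2 * (1/2) ^ Suc k * \<rho> + 2 * (1/2) ^ k * \<rho>"
      using pr[OF that, of k] pr[OF that, of "Suc k"] by linarith
    also have "\<dots> = \<tau> k" by (simp add: \<tau>_def)
    finally show ?thesis using pr[OF that] by (simp add: PT_def)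
  qed
  have finPT: "finite (PT k)" for k
    unfolding PT_def using T by auto
  have nePT: "PT k \<noteq> {}" for k using prPT[OF zero] by blast
  \<comment> \<open>The last term is the price of stopping at level K: the link from the net point
    to g is not averaged over signs but bounded by the Cauchy-Schwarz inequality, where the n signs
    contribute the factor n.\<close>
  define W where "W R = 2 * ((\<Sum>k<K. a k) * (\<Sum>k<K. Mx k R / a k)) + 8 * n * (1/4) ^ K * \<rho>\<^sup>2" for R
  have bound: "(Z R g)\<^sup>2 \<le> W R" if "g \<in> G'" for R g
  proof -
    have t0: "pr 0 g = (\<lambda>_. 0)" using pr[OF that, of 0] by (simp add: T_def)
    have "Z R (pr 0 g) = 0" by (simp add: t0 Z_def u0)
    then have tel: "Z R (pr K g) = (\<Sum>k<K. Zd R (pr (Suc k) g, pr k g))"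
      unfolding Zd using sum_lessThan_telescope[of "\<lambda>k. Z R (pr k g)" K] by simp
    have "(Z R g)\<^sup>2 = (Z R (pr K g) + Zd R (g, pr K g))\<^sup>2" by (simp add: Zd)
    also have "\<dots> \<le> 2 * (Z R (pr K g))\<^sup>2 + 2 * (Zd R (g, pr K g))\<^sup>2"
      by (rule square_sum_le)
    also have "(Z R (pr K g))\<^sup>2 \<le> (\<Sum>k<K. a k) * (\<Sum>k<K. (Zd R (pr (Suc k) g, pr k g))\<^sup>2 / a k)"
      unfolding tel by (rule sum_square_weighted[OF a0])
    also have "\<dots> \<le> (\<Sum>k<K. a k) * (\<Sum>k<K. Mx k R / a k)"
      unfolding Mx_def using a0 that finPT prPT
      by (intro mult_left_mono sum_mono divide_right_mono Max_ge)
         (auto intro!: sum_nonneg simp: less_imp_le)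
    also have "(Zd R (g, pr K g))\<^sup>2 \<le> (\<Sum>i<n. (rsign R i)\<^sup>2) * (\<Sum>i<n. (u g i - u (pr K g) i)\<^sup>2)"
      unfolding Zd_def fst_conv snd_conv by (rule Cauchy_Schwarz_ineq_sum)
    also have "\<dots> \<le> n * (2 * (1/2) ^ K * \<rho>)\<^sup>2"
    proof -
      have "(\<Sum>i<n. (u g i - u (pr K g) i)\<^sup>2) \<le> (?d g (pr K g))\<^sup>2"
        using that pr[OF that, of K] T by (intro u) auto
      also have "\<dots> \<le> (2 * (1/2) ^ K * \<rho>)\<^sup>2"
        using pr[OF that, of K] by (intro power_mono weighted_norm_nonneg c) auto
      finally show ?thesis by (simp add: mult_left_mono)
    qed
    also have "(2 * (1/2) ^ K * \<rho>)\<^sup>2 = 4 * (1/4) ^ K * \<rho>\<^sup>2"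
      by (simp add: power_mult_distrib power_divide flip: power_mult)
         (simp add: power_mult mult.commute[of K])
    finally show ?thesis by (simp add: W_def)
  qed
  \<comment> \<open>\<open>288 = 8 * 6\<^sup>2\<close>, with the 8 of the maximal inequality and the
    6 of \<tau>.\<close>
  have Mxs: "(\<Sum>R\<in>Pow {..<n}. Mx k R) \<le> 2 ^ n * (288 * \<rho>\<^sup>2 * (a k)\<^sup>2)" for k
  proof -
    have "(\<Sum>R\<in>Pow {..<n}. Mx k R) \<le> 2 ^ n * (8 * (\<tau> k)\<^sup>2 * (1 + ln (card (PT k))))"
      unfolding Mx_def Zd_def
    proof (rule rademacher_max[OF finPT nePT])
      show "\<tau> k \<ge> 0" using \<rho>0 by (simp add: \<tau>_def)
      fix p assume p: "p \<in> PT k"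
      then have "(\<Sum>i<n. (u (fst p) i - u (snd p) i)\<^sup>2) \<le> (?d (fst p) (snd p))\<^sup>2"
        using T[of k] T[of "Suc k"] by (intro u) (auto simp: PT_def)
      also have "\<dots> \<le> (\<tau> k)\<^sup>2"
        using p by (intro power_mono weighted_norm_nonneg c) (auto simp: PT_def)
      finally show "(\<Sum>i<n. (u (fst p) i - u (snd p) i)\<^sup>2) \<le> (\<tau> k)\<^sup>2" .
    qed
    also have "\<dots> \<le> 2 ^ n * (8 * (\<tau> k)\<^sup>2 * (1 + 2 * H (Suc k)))"
    proof -
      have cT: "card (T k) > 0" for k using T by (simp add: card_gt_0_iff)
      have "card (PT k) \<le> card (T (Suc k) \<times> T k)"
        using T by (intro card_mono) (auto simp: PT_def)
      moreover have "card (PT k) > 0" using finPT nePT by (simp add: card_gt_0_iff)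
      ultimately have "ln (card (PT k)) \<le> ln (card (T (Suc k) \<times> T k))" by simp
      also have "\<dots> = ln (card (T (Suc k))) + ln (card (T k))"
        using cT by (simp add: card_cartesian_product ln_mult)
      also have "\<dots> \<le> H (Suc k) + H (Suc k)"
        using T[of k] T[of "Suc k"] Hmono[of k] by linarith
      finally show ?thesis by (intro mult_left_mono) auto
    qed
    also have "8 * (\<tau> k)\<^sup>2 * (1 + 2 * H (Suc k)) = 288 * \<rho>\<^sup>2 * (a k)\<^sup>2"
      using H0[of "Suc k"] by (simp add: \<tau>_def a_def power_mult_distrib power_divide)
    finally show ?thesis .
  qed
  have "(\<Sum>R\<in>Pow {..<n}. W R) =
      2 * ((\<Sum>k<K. a k) * (\<Sum>k<K. (\<Sum>R\<in>Pow {..<n}. Mx k R) / a k)) + 2 ^ n * (8 * n * (1/4) ^ K * \<rho>\<^sup>2)"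
    unfolding W_def
    by (simp add: sum.distrib card_Pow sum_divide_distrib sum.swap[of _ "{..<K}"] flip: sum_distrib_left)
  also have "\<dots> \<le> 2 * ((\<Sum>k<K. a k) * (\<Sum>k<K. 2 ^ n * (288 * \<rho>\<^sup>2 * (a k)\<^sup>2) / a k)) + 2 ^ n * (8 * n * (1/4) ^ K * \<rho>\<^sup>2)"
    using a0 by (intro add_right_mono mult_left_mono sum_mono divide_right_mono Mxs)
      (auto intro!: sum_nonneg simp: less_imp_le)
  also have "(\<Sum>k<K. 2 ^ n * (288 * \<rho>\<^sup>2 * (a k)\<^sup>2) / a k) = 2 ^ n * (288 * \<rho>\<^sup>2 * (\<Sum>k<K. a k))"
    unfolding sum_distrib_left using a0
    by (intro sum.cong) (auto simp: power2_eq_square less_imp_neq[symmetric])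
  also have "2 * ((\<Sum>k<K. a k) * (2 ^ n * (288 * \<rho>\<^sup>2 * (\<Sum>k<K. a k)))) + 2 ^ n * (8 * n * (1/4) ^ K * \<rho>\<^sup>2)
      = 2 ^ n * ((576 * (\<Sum>k<K. a k)\<^sup>2 + 8 * (n * (1/4) ^ K)) * \<rho>\<^sup>2)"
    by (simp add: power2_eq_square algebra_simps)
  also have "\<dots> \<le> 2 ^ n * (576 * ((\<Sum>k<K. a k)\<^sup>2 + n * (1/4) ^ K) * \<rho>\<^sup>2)"
    by (intro mult_left_mono mult_right_mono) (auto simp: algebra_simps)
  finally have "(\<Sum>R\<in>Pow {..<n}. W R) \<le> 2 ^ n * (576 * ((\<Sum>k<K. a k)\<^sup>2 + n * (1/4) ^ K) * \<rho>\<^sup>2)" .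
  then show ?thesis using bound unfolding Z_def a_def \<rho>_def by blast
qed

subsection \<open>Symmetrization\<close>

text \<open>For i in R an observation trades places with its ghost copy n + i. Indices from 2 n on
  stay fixed, so this is an involution of all naturals.\<close>

definition swap_idx :: "nat \<Rightarrow> nat set \<Rightarrow> nat \<Rightarrow> nat" where
  "swap_idx n R i = (if i < n \<and> i \<in> R then n + i else if n \<le> i \<and> i - n \<in> R \<and> i < 2 * n then i - n else i)"

lemma swap_idx_swap_idx: "swap_idx n R (swap_idx n R i) = i"
  by (auto simp: swap_idx_def)

lemma swap_idx_less: "i < 2 * n \<Longrightarrow> swap_idx n R i < 2 * n"
  by (auto simp: swap_idx_def)

lemma inj_swap_idx: "inj_on (swap_idx n R) A"
  by (metis inj_onI swap_idx_swap_idx)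

text \<open>Jensen's inequality for the square, from the nonnegativity of the variance; if the right
  side is infinite there is nothing to prove.\<close>

lemma (in prob_space) square_integral_le:
  fixes g :: "'a \<Rightarrow> real"
  assumes "integrable M g"
  shows "ennreal ((\<integral>x. g x \<partial>M)\<^sup>2) \<le> (\<integral>\<^sup>+x. ennreal ((g x)\<^sup>2) \<partial>M)"
proof (cases "(\<integral>\<^sup>+x. ennreal ((g x)\<^sup>2) \<partial>M) = \<infinity>")
  case False
  have [measurable]: "g \<in> borel_measurable M" using assms by simp
  have sq: "integrable M (\<lambda>x. (g x)\<^sup>2)"
    using False by (intro integrableI_bounded) (auto simp: top.not_eq_extremum)
  have "0 \<le> variance g" by simp
  also have "\<dots> = (\<integral>x. (g x)\<^sup>2 \<partial>M) - (\<integral>x. g x \<partial>M)\<^sup>2"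
    by (rule variance_eq[OF assms sq])
  finally have "ennreal ((\<integral>x. g x \<partial>M)\<^sup>2) \<le> ennreal (\<integral>x. (g x)\<^sup>2 \<partial>M)"
    by (intro ennreal_leI) simp
  then show ?thesis using sq by (simp add: nn_integral_eq_integral)
qed simp

text \<open>The class is not assumed countable, so the supremum over it enters through a measurable
  majorant \<open>\<Psi>\<close> that is almost everywhere equal to it. The swaps preserve the product measure,
  which makes the random signs appear.\<close>

lemma symmetrization:
  fixes N :: "'z measure" and HH :: "('z \<Rightarrow> real) set" and \<Psi> B :: "(nat \<Rightarrow> 'z) \<Rightarrow> ennreal"
  assumes N: "prob_space N" and ne: "HH \<noteq> {}"
    and int: "\<And>h. h \<in> HH \<Longrightarrow> integrable N h"
    and \<Psi>[measurable]: "\<Psi> \<in> borel_measurable (PiM {..<2 * n} (\<lambda>_. N))"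
    and maj: "\<And>z h. z \<in> space (PiM {..<2 * n} (\<lambda>_. N)) \<Longrightarrow> h \<in> HH \<Longrightarrow>
        ennreal ((\<Sum>i<n. h (z i) - h (z (n + i)))\<^sup>2) \<le> \<Psi> z"
    and tight: "AE z in PiM {..<2 * n} (\<lambda>_. N). \<forall>w.
        (\<forall>h\<in>HH. (\<Sum>i<n. h (z i) - h (z (n + i)))\<^sup>2 \<le> w) \<longrightarrow> \<Psi> z \<le> ennreal w"
    and B[measurable]: "B \<in> borel_measurable (PiM {..<2 * n} (\<lambda>_. N))"
    and bound: "AE z in PiM {..<2 * n} (\<lambda>_. N). \<exists>W.
        (\<forall>R\<subseteq>{..<n}. \<forall>h\<in>HH. (\<Sum>i<n. rsign R i * (h (z i) - h (z (n + i))))\<^sup>2 \<le> W R) \<and>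
        ennreal (\<Sum>R\<in>Pow {..<n}. W R) \<le> 2 ^ n * B z"
  shows "\<exists>\<psi>\<in>borel_measurable (PiM {..<n} (\<lambda>_. N)).
     (\<forall>x\<in>space (PiM {..<n} (\<lambda>_. N)). \<forall>h\<in>HH.
        ennreal ((\<Sum>i<n. h (x i) - (\<integral>z. h z \<partial>N))\<^sup>2) \<le> \<psi> x) \<and>
     (\<integral>\<^sup>+x. \<psi> x \<partial>PiM {..<n} (\<lambda>_. N)) \<le> (\<integral>\<^sup>+z. B z \<partial>PiM {..<2 * n} (\<lambda>_. N))"
proof -
  interpret N: prob_space N by (rule N)
  interpret product_sigma_finite "\<lambda>_. N" ..
  let ?P = "PiM {..<2 * n} (\<lambda>_. N)"
  define T where "T R z = (\<lambda>i\<in>{..<2 * n}. z (swap_idx n R i))" for R and z :: "nat \<Rightarrow> 'z"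
  have T_distr: "distr ?P ?P (T R) = ?P" for R
    unfolding T_def
    by (rule distr_PiM_reindex[of "{..<2 * n}" "\<lambda>_. N" "swap_idx n R" "{..<2 * n}"])
       (auto intro: N inj_swap_idx simp: swap_idx_less)
  have T_meas[measurable]: "T R \<in> ?P \<rightarrow>\<^sub>M ?P" for R
    unfolding T_def by (intro measurable_restrict measurable_component_singleton)
      (auto simp: swap_idx_less)
  have T_sum: "(\<Sum>i<n. h (T R z i) - h (T R z (n + i))) = (\<Sum>i<n. rsign R i * (h (z i) - h (z (n + i))))"
    for h :: "'z \<Rightarrow> real" and R z
    by (intro sum.cong) (auto simp: T_def swap_idx_def rsign_def)
  \<comment> \<open>Tightness of \<Psi> holds off a null set. Each of the finitely many swaps
    preserves the product measure, so it holds at all swapped samples simultaneously.\<close>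
  have "AE z in ?P. \<forall>R\<in>Pow {..<n}. \<forall>w.
        (\<forall>h\<in>HH. (\<Sum>i<n. h (T R z i) - h (T R z (n + i)))\<^sup>2 \<le> w) \<longrightarrow> \<Psi> (T R z) \<le> ennreal w"
  proof (rule AE_finite_allI)
    fix R
    show "AE z in ?P. \<forall>w.
        (\<forall>h\<in>HH. (\<Sum>i<n. h (T R z i) - h (T R z (n + i)))\<^sup>2 \<le> w) \<longrightarrow> \<Psi> (T R z) \<le> ennreal w"
      by (rule AE_distrD[OF T_meas]) (subst T_distr, rule tight)
  qed simp
  then have key: "AE z in ?P. (\<Sum>R\<in>Pow {..<n}. \<Psi> (T R z)) \<le> 2 ^ n * B z"
    using bound
  proof eventually_elim
    case (elim z)
    then obtain W where W: "\<And>R h. R \<subseteq> {..<n} \<Longrightarrow> h \<in> HH \<Longrightarrow>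
          (\<Sum>i<n. rsign R i * (h (z i) - h (z (n + i))))\<^sup>2 \<le> W R"
      "ennreal (\<Sum>R\<in>Pow {..<n}. W R) \<le> 2 ^ n * B z"
      by blast
    obtain h0 where "h0 \<in> HH" using ne by blast
    then have W0: "W R \<ge> 0" if "R \<subseteq> {..<n}" for R
      using W(1)[OF that] order_trans[OF zero_le_power2] by blast
    have "(\<Sum>R\<in>Pow {..<n}. \<Psi> (T R z)) \<le> (\<Sum>R\<in>Pow {..<n}. ennreal (W R))"
      using elim(1) W(1) by (intro sum_mono) (simp add: T_sum)
    also have "\<dots> = ennreal (\<Sum>R\<in>Pow {..<n}. W R)"
      using W0 by (intro sum_ennreal) auto
    finally show ?case using W(2) by (rule order_trans)
  qed
  \<comment> \<open>No swap changes the integral of \<Psi>, so \<open>2 ^ n\<close> copies of it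
    become the integral of a sum over sign patterns at a fixed sample, which B bounds
    pointwise.\<close>
  have "2 ^ n * (\<integral>\<^sup>+z. \<Psi> z \<partial>?P) = (\<Sum>R\<in>Pow {..<n}. (\<integral>\<^sup>+z. \<Psi> z \<partial>?P))"
    by (simp add: card_Pow)
  also have "\<dots> = (\<Sum>R\<in>Pow {..<n}. (\<integral>\<^sup>+z. \<Psi> (T R z) \<partial>?P))"
  proof (rule sum.cong[OF refl])
    fix R
    have "(\<integral>\<^sup>+z. \<Psi> z \<partial>?P) = (\<integral>\<^sup>+z. \<Psi> z \<partial>distr ?P ?P (T R))" by (simp add: T_distr)
    also have "\<dots> = (\<integral>\<^sup>+z. \<Psi> (T R z) \<partial>?P)" by (rule nn_integral_distr) auto
    finally show "(\<integral>\<^sup>+z. \<Psi> z \<partial>?P) = (\<integral>\<^sup>+z. \<Psi> (T R z) \<partial>?P)" .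
  qed
  also have "\<dots> = (\<integral>\<^sup>+z. (\<Sum>R\<in>Pow {..<n}. \<Psi> (T R z)) \<partial>?P)"
    by (rule nn_integral_sum[symmetric]) measurable
  also have "\<dots> \<le> (\<integral>\<^sup>+z. 2 ^ n * B z \<partial>?P)"
    by (rule nn_integral_mono_AE[OF key])
  also have "\<dots> = 2 ^ n * (\<integral>\<^sup>+z. B z \<partial>?P)"
    by (rule nn_integral_cmult) measurable
  finally have int\<Psi>: "(\<integral>\<^sup>+z. \<Psi> z \<partial>?P) \<le> (\<integral>\<^sup>+z. B z \<partial>?P)"
    by (subst (asm) ennreal_mult_le_mult_iff) (auto simp: power_eq_top_ennreal)
  let ?I = "{..<n}" and ?J = "{n..<2 * n}"
  have IJ: "?I \<inter> ?J = {}" "?I \<union> ?J = {..<2 * n}" by auto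
  let ?PI = "PiM ?I (\<lambda>_. N)" and ?PJ = "PiM ?J (\<lambda>_. N)"
  interpret J: prob_space ?PJ by (intro prob_space_PiM N)
  have mm[measurable]: "merge ?I ?J \<in> ?PI \<Otimes>\<^sub>M ?PJ \<rightarrow>\<^sub>M ?P"
    using measurable_merge[of ?I ?J "\<lambda>_. N"] by (simp add: IJ)
  \<comment> \<open>The ghost half of the sample is integrated out. By Jensen's inequality the ghost
    sum turns into its expectation, which supplies the centring.\<close>
  define \<psi> where "\<psi> x = (\<integral>\<^sup>+y. \<Psi> (merge ?I ?J (x, y)) \<partial>?PJ)" for x
  have "sigma_finite_measure ?PJ" ..
  then have \<psi>_meas: "\<psi> \<in> borel_measurable ?PI"
    unfolding \<psi>_def by (intro sigma_finite_measure.borel_measurable_nn_integral) measurable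
  have "(\<integral>\<^sup>+z. \<Psi> z \<partial>?P) = (\<integral>\<^sup>+x. \<psi> x \<partial>?PI)"
    unfolding \<psi>_def using product_nn_integral_fold[OF IJ(1), of \<Psi>] by (simp add: IJ(2))
  then have int\<psi>: "(\<integral>\<^sup>+x. \<psi> x \<partial>?PI) \<le> (\<integral>\<^sup>+z. B z \<partial>?P)" using int\<Psi> by simp
  have "ennreal ((\<Sum>i<n. h (x i) - (\<integral>z. h z \<partial>N))\<^sup>2) \<le> \<psi> x" if x: "x \<in> space ?PI" and h: "h \<in> HH" for x h
  proof -
    have [measurable]: "h \<in> borel_measurable N" using int[OF h] by simp
    have comp: "integrable ?PJ (\<lambda>y. h (y (n + i)))" "(\<integral>y. h (y (n + i)) \<partial>?PJ) = (\<integral>z. h z \<partial>N)"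
      if "i < n" for i
    proof -
      have d: "distr ?PJ N (\<lambda>y. y (n + i)) = N"
        by (rule distr_PiM_component) (use that N in auto)
      have [measurable]: "(\<lambda>y. y (n + i)) \<in> ?PJ \<rightarrow>\<^sub>M N"
        by (rule measurable_component_singleton) (use that in auto)
      show "integrable ?PJ (\<lambda>y. h (y (n + i)))"
        by (rule integrable_distr[where M' = N]) (auto simp: d int[OF h])
      show "(\<integral>y. h (y (n + i)) \<partial>?PJ) = (\<integral>z. h z \<partial>N)"
        by (subst d[symmetric], subst integral_distr) auto
    qed
    have "(\<Sum>i<n. h (x i) - (\<integral>z. h z \<partial>N)) = (\<Sum>i<n. (\<integral>y. h (x i) - h (y (n + i)) \<partial>?PJ))"
      using comp by (intro sum.cong) (auto simp: J.prob_space)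
    also have "\<dots> = (\<integral>y. (\<Sum>i<n. h (x i) - h (y (n + i))) \<partial>?PJ)"
      using comp by (intro Bochner_Integration.integral_sum[symmetric]) auto
    finally have "ennreal ((\<Sum>i<n. h (x i) - (\<integral>z. h z \<partial>N))\<^sup>2) =
        ennreal ((\<integral>y. (\<Sum>i<n. h (x i) - h (y (n + i))) \<partial>?PJ)\<^sup>2)" by simp
    also have "\<dots> \<le> (\<integral>\<^sup>+y. ennreal ((\<Sum>i<n. h (x i) - h (y (n + i)))\<^sup>2) \<partial>?PJ)"
      using comp by (intro J.square_integral_le Bochner_Integration.integrable_sum) auto
    also have "\<dots> \<le> \<psi> x"
      unfolding \<psi>_def
    proof (rule nn_integral_mono)
      fix y assume y: "y \<in> space ?PJ"
      have "merge ?I ?J (x, y) \<in> space ?P"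
        using measurable_space[OF mm, of "(x, y)"] x y by (simp add: space_pair_measure)
      from maj[OF this h] show "ennreal ((\<Sum>i<n. h (x i) - h (y (n + i)))\<^sup>2) \<le> \<Psi> (merge ?I ?J (x, y))"
        by (simp add: merge_def)
    qed
    finally show ?thesis .
  qed
  then show ?thesis using \<psi>_meas int\<psi> by blast
qed

subsection \<open>Rates\<close>

text \<open>Under a point mass at y the functions 0 and g are at distance |g y|, which is also the
  envelope norm. One ball of radius \<zeta> |g y| with \<zeta> < 1/2 cannot contain both, so a cover
  has at least two members.\<close>

lemma two_point_entropy:
  assumes ent: "uniform_entropy \<zeta> G \<le> ereal H" and \<zeta>: "0 \<le> \<zeta>" "\<zeta> < 1 / 2"
    and G: "(\<lambda>_. 0) \<in> G" "g \<in> G" "g y \<noteq> 0"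
  shows "ln 2 \<le> H"
proof -
  define G' where "G' = {(\<lambda>_. 0), g}"
  have sub: "G' \<subseteq> G" using G by (simp add: G'_def)
  have env: "envelope G' y = \<bar>g y\<bar>" by (simp add: envelope_def G'_def cSup_eq_Max)
  have wn: "weighted_norm 1 (\<lambda>_. 1) (\<lambda>_. y) f = \<bar>f y\<bar>" for f
    by (simp add: weighted_norm_def)
  have c: "\<forall>i<1. (1::real) \<ge> 0" by simp
  have "\<exists>p ctr. p \<ge> 1 \<and> ln (real p) \<le> H \<and> (\<forall>h\<in>G'. \<exists>j<p. \<bar>h y - ctr j y\<bar> \<le> \<zeta> * \<bar>g y\<bar>)"
    using uniform_entropy_cover[where m = 1 and c = "\<lambda>_. 1" and x = "\<lambda>_. y", OF ent sub c]
    unfolding wn env abs_abs .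
  then obtain p ctr where p: "p \<ge> 1" "ln (real p) \<le> H"
    and cov: "\<forall>h\<in>G'. \<exists>j<p. \<bar>h y - ctr j y\<bar> \<le> \<zeta> * \<bar>g y\<bar>"
    by (elim exE conjE)
  have "p \<noteq> 1"
  proof
    assume "p = 1"
    with cov have "\<bar>0 - ctr 0 y\<bar> \<le> \<zeta> * \<bar>g y\<bar>" "\<bar>g y - ctr 0 y\<bar> \<le> \<zeta> * \<bar>g y\<bar>"
      by (auto simp: G'_def)
    then have "\<bar>g y\<bar> \<le> 2 * (\<zeta> * \<bar>g y\<bar>)" by linarith
    also have "\<dots> < \<bar>g y\<bar>" using \<zeta> G by simp
    finally show False by simp
  qed
  then have "2 \<le> p" using p by simp
  then have "ln 2 \<le> ln (real p)" by simp
  then show ?thesis using p by linarith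
qed

text \<open>Testing the entropy condition on a two-point class at a radius just below 1/2, where
  \<open>ln (1/\<zeta>) < 1\<close>, bounds \<open>\<beta>\<close> in terms of \<open>A\<close> and \<open>\<alpha>\<close>.\<close>

lemma entropy_exponent_bounded:
  assumes "A > 0"
  obtains B :: real where "B \<ge> 0" "\<And>(G :: ('a \<Rightarrow> real) set) \<beta> g y. (\<lambda>_. 0) \<in> G \<Longrightarrow> g \<in> G \<Longrightarrow> g y \<noteq> 0 \<Longrightarrow>
     (\<forall>\<zeta>\<in>{0<..<1}. uniform_entropy \<zeta> G \<le> ereal (A / \<zeta> powr \<alpha> * ln (1 / \<zeta>) powr \<beta>)) \<Longrightarrow> \<beta> \<le> B"
proof
  \<comment> \<open>Any exponent strictly between ln 2 and 1 would serve; 3/4 is large enough for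
    the quadratic Taylor bound, since 1 + 3/4 + 9/32 > 2.\<close>
  define \<zeta> :: real where "\<zeta> = exp (- (3/4))"
  define E where "E = A / \<zeta> powr \<alpha>"
  have "1 + (3/4) + (3/4)\<^sup>2 / 2 \<le> exp (3/4 :: real)"
    by (rule exp_lower_Taylor_quadratic) simp
  then have "2 < exp (3/4 :: real)" by (simp add: power2_eq_square)
  then have \<zeta>: "0 < \<zeta>" "\<zeta> < 1 / 2" by (auto simp: \<zeta>_def exp_minus field_simps)
  have ln\<zeta>: "ln (1 / \<zeta>) = 3/4" by (simp add: \<zeta>_def ln_div)
  have E: "E > 0" using assms \<zeta> by (simp add: E_def)
  define B where "B = max 0 ((ln E - ln (ln 2)) / ln (4/3))"
  show "B \<ge> 0" by (simp add: B_def)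
  fix G :: "('a \<Rightarrow> real) set" and \<beta> g y
  assume G: "(\<lambda>_. 0) \<in> G" "g \<in> G" "g y \<noteq> 0"
    and ent: "\<forall>\<zeta>\<in>{0<..<1}. uniform_entropy \<zeta> G \<le> ereal (A / \<zeta> powr \<alpha> * ln (1 / \<zeta>) powr \<beta>)"
  have "uniform_entropy \<zeta> G \<le> ereal (E * (3/4) powr \<beta>)"
    using bspec[OF ent, of \<zeta>] \<zeta> by (simp add: E_def ln\<zeta>)
  then have "ln 2 \<le> E * (3/4) powr \<beta>"
    using G \<zeta> by (intro two_point_entropy[of \<zeta> G _ g y]) auto
  then have "ln (ln 2) \<le> ln (E * (3/4) powr \<beta>)" by (intro ln_mono) auto
  also have "\<dots> = ln E + \<beta> * ln (3/4)" using E by (simp add: ln_mult ln_powr)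
  also have "ln (3/4) = - ln (4/3::real)" by (simp add: ln_div)
  finally have "\<beta> * ln (4/3) \<le> ln E - ln (ln 2)" by simp
  then have "\<beta> \<le> (ln E - ln (ln 2)) / ln (4/3)" by (simp add: le_divide_eq)
  then show "\<beta> \<le> B" by (simp add: B_def)
qed

text \<open>A polynomial exponent that also swallows the logarithm. For \<alpha> < 2 it is the
  midpoint of \<alpha> and 2, hence still below the critical value 2; otherwise \<beta> = 0 and
  there is no logarithm to absorb.\<close>

definition entropy_index :: "real \<Rightarrow> real" where
  "entropy_index \<alpha> = (if \<alpha> < 2 then 1 + \<alpha> / 2 else \<alpha>)"

text \<open>A logarithm is below a constant times any positive power:
  \<open>ln t \<le> t powr \<eta> / \<eta>\<close>. The point is that A' depends on the bound B, not
  on \<beta>.\<close>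

lemma log_factor_absorbed:
  fixes A \<alpha> B :: real
  assumes "A > 0" "0 \<le> \<alpha>" "B \<ge> 0"
  obtains A' where "A' \<ge> 0" "\<And>\<beta> \<zeta>. 0 \<le> \<beta> \<Longrightarrow> \<beta> \<le> B \<Longrightarrow> \<alpha> < 2 \<or> \<beta> = 0 \<Longrightarrow> 0 < \<zeta> \<Longrightarrow> \<zeta> < 1 \<Longrightarrow>
     A / \<zeta> powr \<alpha> * ln (1 / \<zeta>) powr \<beta> \<le> A' * (1 / \<zeta>) powr entropy_index \<alpha>"
proof (cases "\<alpha> < 2")
  case True
  \<comment> \<open>Chosen so that \<open>\<eta> * B\<close> stays within the gap
    \<open>1 - \<alpha> / 2\<close>; the \<open>+ 1\<close> admits B = 0. Since M \<ge> 1, the base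
    \<open>M * t powr \<eta>\<close> is at least 1 and its exponent may be raised from \<beta> to
    B.\<close>
  define \<eta> where "\<eta> = (1 - \<alpha> / 2) / (B + 1)"
  define M where "M = max 1 (1 / \<eta>)"
  have \<eta>: "\<eta> > 0" using True assms by (simp add: \<eta>_def)
  have "\<eta> * B \<le> \<eta> * (B + 1)" using \<eta> by (intro mult_left_mono) auto
  then have \<eta>B: "\<eta> * B \<le> 1 - \<alpha> / 2" using assms by (simp add: \<eta>_def)
  show ?thesis
  proof (rule that)
    show "A * M powr B \<ge> 0" using assms by simp
    fix \<beta> \<zeta> :: real assume *: "0 \<le> \<beta>" "\<beta> \<le> B" "0 < \<zeta>" "\<zeta> < 1"
    define t where "t = 1 / \<zeta>"
    have t: "t > 1" using * by (simp add: t_def)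
    have "ln t \<le> t powr \<eta> / \<eta>" using t \<eta> by (intro ln_powr_bound) auto
    also have "\<dots> \<le> M * t powr \<eta>" by (simp add: M_def max_def divide_simps)
    finally have "ln t powr \<beta> \<le> (M * t powr \<eta>) powr \<beta>"
      using t * by (intro powr_mono2) auto
    also have "\<dots> \<le> (M * t powr \<eta>) powr B"
    proof (rule powr_mono)
      have "1 \<le> t powr \<eta>" using t \<eta> by (simp add: ge_one_powr_ge_zero)
      then show "1 \<le> M * t powr \<eta>"
        using mult_mono[of 1 M 1 "t powr \<eta>"] by (simp add: M_def)
    qed (use * in auto)
    also have "\<dots> = M powr B * t powr (\<eta> * B)"
      by (simp add: powr_mult powr_powr M_def)
    also have "\<dots> \<le> M powr B * t powr (1 - \<alpha> / 2)"
      using t \<eta>B by (intro mult_left_mono powr_mono) auto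
    finally have "A * t powr \<alpha> * ln t powr \<beta> \<le> A * t powr \<alpha> * (M powr B * t powr (1 - \<alpha> / 2))"
      using assms by (intro mult_left_mono) auto
    also have "\<dots> = A * M powr B * (t powr \<alpha> * t powr (1 - \<alpha> / 2))" by simp
    also have "t powr \<alpha> * t powr (1 - \<alpha> / 2) = t powr (1 + \<alpha> / 2)"
      by (simp add: add.commute flip: powr_add)
    finally show "A / \<zeta> powr \<alpha> * ln (1 / \<zeta>) powr \<beta> \<le> A * M powr B * (1 / \<zeta>) powr entropy_index \<alpha>"
      using True * by (simp add: t_def entropy_index_def powr_divide)
  qed
next
  case False
  show ?thesis
    by (rule that[of A]) (use assms False in \<open>auto simp: entropy_index_def powr_divide\<close>)
qed

section \<open>Truncated entropy sums in the three rate regimes\<close>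

definition chaining_sum :: "(nat \<Rightarrow> real) \<Rightarrow> nat \<Rightarrow> real" where
  "chaining_sum H K = (\<Sum>k<K. (1/2) ^ Suc k * sqrt (1 + 2 * H (Suc k)))"

text \<open>The sum is a dyadic entropy integral stopped at radius \<open>(1/2) ^ K\<close>. For
  polynomial entropy its terms are dominated by a geometric sequence of ratio
  \<open>2 powr (\<gamma> / 2 - 1)\<close>, which is below, equal to or above 1 according as
  \<gamma> is below, equal to or above 2: the source of the three rates.\<close>

lemma chaining_sum_le_geometric:
  assumes "A' \<ge> 0" "\<gamma> \<ge> 0"
  shows "chaining_sum (\<lambda>k. A' * (2 ^ k) powr \<gamma>) K \<le> sqrt (1 + 2 * A') * (\<Sum>k<K. (2 powr (\<gamma> / 2 - 1)) ^ Suc k)"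
  unfolding chaining_sum_def sum_distrib_left
proof (rule sum_mono)
  fix k
  have p: "(2 ^ k :: real) powr \<gamma> = ((2 powr (\<gamma> / 2)) ^ k)\<^sup>2" for k
  proof -
    have "(2 ^ k :: real) powr \<gamma> = 2 powr (k * \<gamma>)" by (simp add: powr_realpow[symmetric] powr_powr)
    also have "\<dots> = (2 powr (\<gamma> / 2 * k))\<^sup>2" by (simp add: power2_eq_square mult.commute flip: powr_add)
    also have "2 powr (\<gamma> / 2 * k) = (2 powr (\<gamma> / 2)) ^ k" by (simp add: powr_realpow[symmetric] powr_powr)
    finally show ?thesis .
  qed
  have "1 \<le> (2 ^ Suc k :: real) powr \<gamma>"
    using assms by (intro ge_one_powr_ge_zero one_le_power) auto
  then have "1 + 2 * (A' * (2 ^ Suc k) powr \<gamma>) \<le> (1 + 2 * A') * (2 ^ Suc k) powr \<gamma>"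
    using assms by (simp add: algebra_simps)
  then have "sqrt (1 + 2 * (A' * (2 ^ Suc k) powr \<gamma>)) \<le> sqrt ((1 + 2 * A') * (2 ^ Suc k) powr \<gamma>)"
    by (rule real_sqrt_le_mono)
  also have "\<dots> = sqrt (1 + 2 * A') * (2 powr (\<gamma> / 2)) ^ Suc k"
    unfolding p by (simp add: real_sqrt_mult del: power_Suc)
  finally have "(1/2) ^ Suc k * sqrt (1 + 2 * (A' * (2 ^ Suc k) powr \<gamma>)) \<le>
     (1/2) ^ Suc k * (sqrt (1 + 2 * A') * (2 powr (\<gamma> / 2)) ^ Suc k)"
    by (intro mult_left_mono) auto
  also have "\<dots> = sqrt (1 + 2 * A') * ((1/2) * 2 powr (\<gamma> / 2)) ^ Suc k"
    by (simp only: power_mult_distrib) simp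
  also have "(1/2) * 2 powr (\<gamma> / 2) = 2 powr (\<gamma> / 2 - 1)" by (simp add: powr_diff)
  finally show "(1/2) ^ Suc k * sqrt (1 + 2 * (A' * (2 ^ Suc k) powr \<gamma>)) \<le>
     sqrt (1 + 2 * A') * (2 powr (\<gamma> / 2 - 1)) ^ Suc k" .
qed

lemma chaining_sum_nonneg: "(\<And>k. H k \<ge> 0) \<Longrightarrow> chaining_sum H K \<ge> 0"
  unfolding chaining_sum_def by (intro sum_nonneg) auto

text \<open>The geometric series converges, so any K that keeps \<open>n * (1/4) ^ K\<close> bounded
  will do; K = n is the simplest. The power of the rate is just n.\<close>

lemma rate_small_index:
  assumes "A' \<ge> 0" "0 \<le> \<alpha>" "\<alpha> < 2"
  shows "\<exists>K0\<ge>0. \<forall>s n. s \<le> 1 \<longrightarrow> n \<ge> 1 \<longrightarrow> (\<exists>K. lse_rate \<alpha> s n powr (2 * (2 - s)) *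
     ((chaining_sum (\<lambda>k. A' * (2 ^ k) powr entropy_index \<alpha>) K)\<^sup>2 + n * (1/4) ^ K) \<le> K0 * n)"
proof -
  define q :: real where "q = 2 powr (entropy_index \<alpha> / 2 - 1)"
  have ei: "entropy_index \<alpha> = 1 + \<alpha> / 2" using assms by (simp add: entropy_index_def)
  have q: "0 < q" "q < 1" using assms by (auto simp: q_def ei intro: powr_less_one)
  define K0 where "K0 = (sqrt (1 + 2 * A') * (q / (1 - q)))\<^sup>2 + 1"
  have "\<exists>K. lse_rate \<alpha> s n powr (2 * (2 - s)) *
     ((chaining_sum (\<lambda>k. A' * (2 ^ k) powr entropy_index \<alpha>) K)\<^sup>2 + n * (1/4) ^ K) \<le> K0 * n"
    if "s \<le> 1" "n \<ge> 1" for s :: real and n :: nat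
  proof
    let ?S = "chaining_sum (\<lambda>k. A' * (2 ^ k) powr entropy_index \<alpha>) n"
    have "(\<Sum>k<n. q ^ Suc k) = q * (1 - q ^ n) / (1 - q)"
      using q by (simp add: sum_distrib_left[symmetric] sum_gp_strict)
    also have "\<dots> \<le> q / (1 - q)" using q by (intro divide_right_mono) (auto simp: mult_left_le)
    finally have "sqrt (1 + 2 * A') * (\<Sum>k<n. q ^ Suc k) \<le> sqrt (1 + 2 * A') * (q / (1 - q))"
      using assms by (intro mult_left_mono) auto
    moreover have "?S \<le> sqrt (1 + 2 * A') * (\<Sum>k<n. q ^ Suc k)"
      unfolding q_def using assms by (intro chaining_sum_le_geometric) (auto simp: ei)
    ultimately have "?S \<le> sqrt (1 + 2 * A') * (q / (1 - q))" by linarith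
    moreover have "0 \<le> ?S" using assms by (intro chaining_sum_nonneg) auto
    ultimately have "?S\<^sup>2 \<le> (sqrt (1 + 2 * A') * (q / (1 - q)))\<^sup>2" by (intro power_mono)
    moreover have "n * (1/4) ^ n \<le> (1::real)"
    proof -
      have "real n \<le> 2 ^ n" by (rule of_nat_less_two_power[THEN less_imp_le])
      also have "\<dots> \<le> 4 ^ n" by (intro power_mono) auto
      finally show ?thesis by (simp add: power_divide)
    qed
    ultimately have b: "?S\<^sup>2 + n * (1/4) ^ n \<le> K0" unfolding K0_def by linarith
    have rt: "lse_rate \<alpha> s n powr (2 * (2 - s)) = n"
      using that assms by (simp add: lse_rate_def powr_powr)
    show "lse_rate \<alpha> s n powr (2 * (2 - s)) * (?S\<^sup>2 + n * (1/4) ^ n) \<le> K0 * n"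
      unfolding rt using mult_right_mono[OF b, of n] by (simp only: mult.commute[of "real n"] of_nat_0_le_iff)
  qed
  moreover have "K0 \<ge> 0" by (simp add: K0_def)
  ultimately show ?thesis by blast
qed

text \<open>With ratio 1 the bound on the sum grows like K, and K of order log n makes the remainder
  bounded. The resulting squared logarithm is the one that the rate divides out.\<close>

lemma rate_critical_index:
  assumes "A' \<ge> 0"
  shows "\<exists>K0\<ge>0. \<forall>s n. s \<le> 1 \<longrightarrow> n \<ge> 1 \<longrightarrow> (\<exists>K. lse_rate 2 s n powr (2 * (2 - s)) *
     ((chaining_sum (\<lambda>k. A' * (2 ^ k) powr entropy_index 2) K)\<^sup>2 + n * (1/4) ^ K) \<le> K0 * n)"
proof -
  define K0 where "K0 = 9 * (1 + 2 * A') + 9"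
  have K0: "K0 \<ge> 0" using assms by (simp add: K0_def)
  have "\<exists>K. lse_rate 2 s n powr (2 * (2 - s)) *
     ((chaining_sum (\<lambda>k. A' * (2 ^ k) powr entropy_index 2) K)\<^sup>2 + n * (1/4) ^ K) \<le> K0 * n"
    if sn: "s \<le> 1" "n \<ge> 1" for s :: real and n :: nat
  proof (cases "n = 1")
    \<comment> \<open>At n = 1 the rate is 0 by convention, so the left side vanishes.\<close>
    case True
    then show ?thesis using K0 by (simp add: lse_rate_def)
  next
    case False
    then have n: "n \<ge> 2" using sn by simp
    have l2: "ln 2 \<le> ln (real n)" using n by simp
    have ln2: "ln 2 \<ge> (2/3 :: real)" by (rule ln2_ge_two_thirds)
    have lpos: "ln (real n) > 0" using n by simp
    define K where "K = nat \<lceil>log 2 n\<rceil>"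
    have lg: "log 2 n \<ge> 1" using n by (simp add: le_log_iff)
    have K1: "log 2 n \<le> K" "K \<le> log 2 n + 1"
      unfolding K_def using lg by linarith+
    \<comment> \<open>\<open>ln 2 \<ge> 2/3\<close> bounds both \<open>log 2 n\<close> and the 1
      lost in rounding up by \<open>3/2 * ln n\<close>; hence the 3, and the 9 in K0.\<close>
    have "log 2 n \<le> ln (real n) / (2/3)"
      unfolding log_def using ln2 lpos by (intro divide_left_mono) auto
    then have K3: "K \<le> 3 * ln (real n)" using K1 l2 ln2 by simp
    let ?S = "chaining_sum (\<lambda>k. A' * (2 ^ k) powr entropy_index 2) K"
    have "?S \<le> sqrt (1 + 2 * A') * K"
      using chaining_sum_le_geometric[of A' "entropy_index 2" K] assms by (simp add: entropy_index_def)
    also have "\<dots> \<le> sqrt (1 + 2 * A') * (3 * ln (real n))"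
      using K3 assms by (intro mult_left_mono) auto
    finally have "?S\<^sup>2 \<le> (sqrt (1 + 2 * A') * (3 * ln (real n)))\<^sup>2"
      using assms by (intro power_mono chaining_sum_nonneg) auto
    also have "\<dots> = 9 * (1 + 2 * A') * (ln (real n))\<^sup>2"
      using assms by (simp add: power_mult_distrib)
    finally have S: "?S\<^sup>2 \<le> 9 * (1 + 2 * A') * (ln (real n))\<^sup>2" .
    have "real n = 2 powr (log 2 n)" using n by simp
    also have "\<dots> \<le> 2 powr K" using K1 by (intro powr_mono) auto
    also have "\<dots> = 2 ^ K" by (simp add: powr_realpow)
    also have "\<dots> \<le> 4 ^ K" by (intro power_mono) auto
    finally have "n * (1/4) ^ K \<le> (1::real)" by (simp add: power_divide)
    also have "1 \<le> (3 * ln (real n))\<^sup>2"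
      using l2 ln2 by (intro one_le_power) auto
    finally have "?S\<^sup>2 + n * (1/4) ^ K \<le> K0 * (ln (real n))\<^sup>2"
      using S by (simp add: K0_def algebra_simps)
    moreover have "lse_rate 2 s n powr (2 * (2 - s)) = n / (ln (real n))\<^sup>2"
    proof -
      have e: "1 / (2 - s) * (2 * (2 - s)) = 2" using sn by (simp add: field_simps)
      have "lse_rate 2 s n powr (2 * (2 - s)) =
          ((real n powr (1/2) / ln (real n)) powr (1 / (2 - s))) powr (2 * (2 - s))"
        by (simp add: lse_rate_def)
      also have "\<dots> = (real n powr (1/2) / ln (real n)) powr 2"
        by (simp only: powr_powr e)
      also have "\<dots> = (sqrt n / ln (real n))\<^sup>2"
        using lpos by (simp add: powr_half_sqrt flip: powr_numeral)
      finally show ?thesis by (simp add: power_divide)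
    qed
    ultimately have "lse_rate 2 s n powr (2 * (2 - s)) * (?S\<^sup>2 + n * (1/4) ^ K)
        \<le> n / (ln (real n))\<^sup>2 * (K0 * (ln (real n))\<^sup>2)"
      by (metis mult_left_mono of_nat_0_le_iff zero_le_divide_iff zero_le_power2)
    also have "\<dots> = K0 * n" using lpos by simp
    finally show ?thesis ..
  qed
  with K0 show ?thesis by blast
qed

text \<open>With ratio above 1 the geometric sum is of the order of its last term
  \<open>q ^ K\<close>. Taking K near \<open>log 2 n / \<alpha>\<close> balances its square against
  the remainder \<open>n * (1/4) ^ K\<close>: both are of order
  \<open>n powr (1 - 2 / \<alpha>)\<close>.\<close>

lemma rate_large_index:
  assumes "A' \<ge> 0" "\<alpha> > 2"
  shows "\<exists>K0\<ge>0. \<forall>s n. s \<le> 1 \<longrightarrow> n \<ge> 1 \<longrightarrow> (\<exists>K. lse_rate \<alpha> s n powr (2 * (2 - s)) *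
     ((chaining_sum (\<lambda>k. A' * (2 ^ k) powr entropy_index \<alpha>) K)\<^sup>2 + n * (1/4) ^ K) \<le> K0 * n)"
proof -
  define q :: real where "q = 2 powr (\<alpha> / 2 - 1)"
  have ei: "entropy_index \<alpha> = \<alpha>" using assms by (simp add: entropy_index_def)
  have q: "q > 1" using assms by (auto simp: q_def)
  define c where "c = sqrt (1 + 2 * A') * (q / (q - 1))"
  have c: "c \<ge> 0" using assms q by (simp add: c_def)
  \<comment> \<open>The factor q pays for rounding K up.\<close>
  define K0 where "K0 = (c * q)\<^sup>2 + 1"
  have "\<exists>K. lse_rate \<alpha> s n powr (2 * (2 - s)) *
     ((chaining_sum (\<lambda>k. A' * (2 ^ k) powr entropy_index \<alpha>) K)\<^sup>2 + n * (1/4) ^ K) \<le> K0 * n"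
    if sn: "s \<le> 1" "n \<ge> 1" for s :: real and n :: nat
  proof
    define K where "K = nat \<lceil>log 2 n / \<alpha>\<rceil>"
    have lg: "log 2 n \<ge> 0" using sn by simp
    have K1: "log 2 n / \<alpha> \<le> K" "K \<le> log 2 n / \<alpha> + 1"
      unfolding K_def using lg assms zero_le_divide_iff[of "log 2 n" \<alpha>] by linarith+
    have n2: "2 powr (log 2 n * x) = n powr x" for x
      using sn by (simp flip: powr_powr)
    let ?S = "chaining_sum (\<lambda>k. A' * (2 ^ k) powr entropy_index \<alpha>) K"
    have "(\<Sum>k<K. q ^ Suc k) = q * (q ^ K - 1) / (q - 1)"
      using q by (simp add: sum_distrib_left[symmetric] geometric_sum)
    also have "\<dots> \<le> q / (q - 1) * q ^ K"
      using q by (simp add: divide_simps)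
    finally have "sqrt (1 + 2 * A') * (\<Sum>k<K. q ^ Suc k) \<le> sqrt (1 + 2 * A') * (q / (q - 1) * q ^ K)"
      using assms by (intro mult_left_mono) auto
    moreover have "?S \<le> sqrt (1 + 2 * A') * (\<Sum>k<K. q ^ Suc k)"
      unfolding q_def using assms chaining_sum_le_geometric[of A' "entropy_index \<alpha>" K] by (simp add: ei)
    ultimately have "?S \<le> sqrt (1 + 2 * A') * (q / (q - 1) * q ^ K)" by linarith
    also have "\<dots> = c * q ^ K" by (simp add: c_def)
    also have "q ^ K = 2 powr (K * (\<alpha> / 2 - 1))"
      using q by (simp add: q_def powr_powr powr_realpow[symmetric] mult.commute)
    also have "\<dots> \<le> 2 powr ((log 2 n / \<alpha> + 1) * (\<alpha> / 2 - 1))"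
      using K1 assms by (intro powr_mono mult_right_mono) auto
    also have "(log 2 n / \<alpha> + 1) * (\<alpha> / 2 - 1) = (\<alpha> / 2 - 1) + log 2 n * (1 / 2 - 1 / \<alpha>)"
      using assms by (simp add: field_simps)
    also have "2 powr \<dots> = q * n powr (1 / 2 - 1 / \<alpha>)"
      by (simp only: powr_add n2) (simp add: q_def)
    finally have "?S \<le> c * (q * n powr (1 / 2 - 1 / \<alpha>))"
      using c by (simp add: mult_left_mono)
    moreover have "0 \<le> ?S" using assms by (intro chaining_sum_nonneg) auto
    ultimately have "?S\<^sup>2 \<le> (c * (q * n powr (1 / 2 - 1 / \<alpha>)))\<^sup>2" by (intro power_mono)
    also have "\<dots> = (c * q)\<^sup>2 * (n powr (1 / 2 - 1 / \<alpha>))\<^sup>2" by (simp add: power_mult_distrib)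
    also have "(n powr (1 / 2 - 1 / \<alpha>))\<^sup>2 = n powr (1 - 2 / \<alpha>)"
      by (simp add: power2_eq_square flip: powr_add)
    finally have S: "?S\<^sup>2 \<le> (c * q)\<^sup>2 * n powr (1 - 2 / \<alpha>)" .
    have "n powr (2 / \<alpha>) = 2 powr (log 2 n / \<alpha> * 2)" by (simp add: n2[symmetric])
    also have "\<dots> \<le> 2 powr (K * 2)" using mult_right_mono[OF K1(1), of 2] by (intro powr_mono) auto
    also have "\<dots> = 2 powr real (2 * K)" by (simp add: mult.commute)
    also have "\<dots> = 2 ^ (2 * K)" by (rule powr_realpow) simp
    also have "\<dots> = 4 ^ K" by (simp add: power_mult)
    finally have "n powr (2 / \<alpha>) \<le> 4 ^ K" .
    then have "n * (1/4) ^ K \<le> n / n powr (2 / \<alpha>)"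
      using sn by (simp add: power_divide frac_le)
    also have "\<dots> = n powr (1 - 2 / \<alpha>)" using sn by (simp add: powr_diff)
    finally have "?S\<^sup>2 + n * (1/4) ^ K \<le> K0 * n powr (1 - 2 / \<alpha>)"
      using S by (simp add: K0_def algebra_simps)
    moreover have "lse_rate \<alpha> s n powr (2 * (2 - s)) = n powr (2 / \<alpha>)"
    proof -
      have "1 / (\<alpha> * (2 - s)) * (2 * (2 - s)) = 2 / \<alpha>" using sn assms by (simp add: field_simps)
      then show ?thesis using assms by (simp add: lse_rate_def powr_powr)
    qed
    ultimately have "lse_rate \<alpha> s n powr (2 * (2 - s)) * (?S\<^sup>2 + n * (1/4) ^ K) \<le>
       n powr (2 / \<alpha>) * (K0 * n powr (1 - 2 / \<alpha>))"
      by (simp add: mult_left_mono)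
    also have "\<dots> = K0 * (n powr (2 / \<alpha>) * n powr (1 - 2 / \<alpha>))" by simp
    also have "n powr (2 / \<alpha>) * n powr (1 - 2 / \<alpha>) = n" using sn by (simp flip: powr_add)
    finally show "lse_rate \<alpha> s n powr (2 * (2 - s)) * (?S\<^sup>2 + n * (1/4) ^ K) \<le> K0 * n" .
  qed
  moreover have "K0 \<ge> 0" by (simp add: K0_def)
  ultimately show ?thesis by blast
qed

lemma rate_chaining_bound:
  assumes "A' \<ge> 0" "0 \<le> \<alpha>"
  shows "\<exists>K0\<ge>0. \<forall>s n. s \<le> 1 \<longrightarrow> n \<ge> 1 \<longrightarrow> (\<exists>K. lse_rate \<alpha> s n powr (2 * (2 - s)) *
     ((chaining_sum (\<lambda>k. A' * (2 ^ k) powr entropy_index \<alpha>) K)\<^sup>2 + n * (1/4) ^ K) \<le> K0 * n)"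
  using assms rate_small_index rate_critical_index rate_large_index
  by (cases "\<alpha> < 2"; cases "\<alpha> = 2") auto

subsection \<open>Second moments of multiplier processes\<close>

text \<open>A function measurable for the completion agrees with a measurable one off a null set;
  the value \<open>top\<close> on that set makes the latter a majorant everywhere.\<close>

lemma completion_measurable_majorant:
  fixes S :: "'z \<Rightarrow> real"
  assumes "S \<in> borel_measurable (completion M)"
  shows "\<exists>\<Psi>\<in>borel_measurable M. (\<forall>x. ennreal (S x) \<le> \<Psi> x) \<and> (AE x in M. \<Psi> x = ennreal (S x))"
proof -
  obtain g where g: "g \<in> borel_measurable M" "AE x in M. S x = g x"
    using completion_ex_borel_measurable_real[OF assms] by blast
  from AE_E3[OF g(2)] obtain Z where Z: "\<And>x. x \<in> space M - Z \<Longrightarrow> S x = g x" "Z \<in> null_sets M"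
    by blast
  define \<Psi> where "\<Psi> x = (if x \<in> space M - Z then ennreal (g x) else top)" for x
  have "\<Psi> \<in> borel_measurable M"
    unfolding \<Psi>_def using g(1) Z(2) by (intro measurable_If_set) auto
  moreover have "ennreal (S x) \<le> \<Psi> x" for x
    using Z(1)[of x] by (auto simp: \<Psi>_def)
  moreover have "AE x in M. \<Psi> x = ennreal (S x)"
    using AE_not_in[OF Z(2)] AE_space by eventually_elim (simp add: \<Psi>_def Z(1))
  ultimately show ?thesis by blast
qed

lemma rational_approximation_L1:
  fixes a :: "nat \<Rightarrow> real"
  assumes "\<epsilon> > 0"
  obtains q where "q \<in> PiE {..<m} (\<lambda>_. \<rat>)" "(\<Sum>i<m. \<bar>a i - q i\<bar>) \<le> \<epsilon>"
proof -
  have "\<exists>r\<in>\<rat>. \<bar>a i - r\<bar> \<le> \<epsilon> / (m + 1)" for i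
  proof -
    obtain r where "r \<in> \<rat>" "a i < r" "r < a i + \<epsilon> / (m + 1)"
      using Rats_dense_in_real[of "a i" "a i + \<epsilon> / (m + 1)"] assms by auto
    then show ?thesis by (intro bexI[of _ r]) auto
  qed
  then obtain r where r: "\<And>i. r i \<in> \<rat>" "\<And>i. \<bar>a i - r i\<bar> \<le> \<epsilon> / (m + 1)" by metis
  define q where "q = restrict r {..<m}"
  have "(\<Sum>i<m. \<bar>a i - q i\<bar>) \<le> (\<Sum>i<m. \<epsilon> / (m + 1))"
    using r by (intro sum_mono) (auto simp: q_def)
  also have "\<dots> \<le> \<epsilon>" using assms by (simp add: field_simps)
  finally show ?thesis using r by (intro that[of q]) (auto simp: q_def)
qed

text \<open>Measurability of the class gives only suprema of sums with constant weights. The supremum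
  with random weights is the infimum, over rational weights, of such suprema plus an error that is
  linear in the distance of the weights.\<close>

lemma multiplier_supremum_majorant:
  fixes P :: "'a measure" and N :: "'z measure" and pr :: "'z \<Rightarrow> 'a" and w :: "nat \<Rightarrow> real"
  assumes P: "prob_space P" and N: "prob_space N"
    and pr[measurable]: "pr \<in> N \<rightarrow>\<^sub>M P" and prP: "distr N P pr = P"
    and e[measurable]: "e \<in> borel_measurable N"
    and meas: "\<And>q :: nat \<Rightarrow> real. (\<lambda>x. SUP f\<in>FF. \<bar>\<Sum>i<m. q i * f (x i)\<bar>)
          \<in> borel_measurable (completion (PiM {..<m} (\<lambda>_. P)))"
    and b: "\<And>f x. f \<in> FF \<Longrightarrow> \<bar>f x\<bar> \<le> b" and ne: "FF \<noteq> {}"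
  shows "\<exists>\<Psi>\<in>borel_measurable (PiM {..<m} (\<lambda>_. N)).
    (\<forall>z. \<forall>f\<in>FF. ennreal \<bar>\<Sum>i<m. w i * (e (z i) * f (pr (z i)))\<bar> \<le> \<Psi> z) \<and>
    (AE z in PiM {..<m} (\<lambda>_. N). \<forall>v. (\<forall>f\<in>FF. \<bar>\<Sum>i<m. w i * (e (z i) * f (pr (z i)))\<bar> \<le> v)
        \<longrightarrow> \<Psi> z \<le> ennreal v)"
proof -
  let ?PN = "PiM {..<m} (\<lambda>_. N)" and ?PP = "PiM {..<m} (\<lambda>_. P)"
  define T where "T q x = (SUP f\<in>FF. \<bar>\<Sum>i<m. q i * f (x i)\<bar>)" for q :: "nat \<Rightarrow> real" and x :: "nat \<Rightarrow> 'a"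
  have b0: "b \<ge> 0" using ne b by (meson abs_ge_zero all_not_in_conv order_trans)
  \<comment> \<open>Boundedness of the class makes the sums Lipschitz in the weights, uniformly over
    FF.\<close>
  have lin: "\<bar>(\<Sum>i<m. p i * f (x i)) - (\<Sum>i<m. q i * f (x i))\<bar> \<le> b * (\<Sum>i<m. \<bar>p i - q i\<bar>)"
    if "f \<in> FF" for f x and p q :: "nat \<Rightarrow> real"
  proof -
    have "\<bar>(\<Sum>i<m. p i * f (x i)) - (\<Sum>i<m. q i * f (x i))\<bar> = \<bar>\<Sum>i<m. (p i - q i) * f (x i)\<bar>"
      by (simp add: sum_subtractf left_diff_distrib)
    also have "\<dots> \<le> (\<Sum>i<m. \<bar>(p i - q i) * f (x i)\<bar>)" by (rule sum_abs)
    also have "\<dots> \<le> (\<Sum>i<m. b * \<bar>p i - q i\<bar>)"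
      using b[OF that] by (intro sum_mono) (simp add: abs_mult mult.commute mult_right_mono)
    finally show ?thesis by (simp add: sum_distrib_left)
  qed
  have T_ge: "\<bar>\<Sum>i<m. q i * f (x i)\<bar> \<le> T q x" if "f \<in> FF" for f q x
    unfolding T_def
  proof (rule cSUP_upper[OF that])
    show "bdd_above ((\<lambda>f. \<bar>\<Sum>i<m. q i * f (x i)\<bar>) ` FF)"
      using lin[of _ q x "\<lambda>_. 0"] by (intro bdd_aboveI2[of _ _ "b * (\<Sum>i<m. \<bar>q i\<bar>)"]) simp
  qed
  define res where "res z = (\<lambda>i\<in>{..<m}. pr (z i))" for z :: "nat \<Rightarrow> 'z"
  have res[measurable]: "res \<in> ?PN \<rightarrow>\<^sub>M ?PP"
    unfolding res_def by measurable
  have res_distr: "distr ?PN ?PP res = ?PP"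
  proof -
    have "compose {..<m} pr = res" by (auto simp: compose_def res_def)
    then show ?thesis
      using distr_PiM_finite_prob_space'[of "{..<m}" "\<lambda>_. N" "\<lambda>_. P" pr] N P prP by simp
  qed
  have "\<forall>q. \<exists>\<Psi>. \<Psi> \<in> borel_measurable ?PP \<and> (\<forall>x. ennreal (T q x) \<le> \<Psi> x) \<and>
      (AE x in ?PP. \<Psi> x = ennreal (T q x))"
    using completion_measurable_majorant[OF meas] unfolding T_def by blast
  from choice[OF this] obtain \<Theta> where \<Theta>: "\<And>q. \<Theta> q \<in> borel_measurable ?PP"
      "\<And>q x. ennreal (T q x) \<le> \<Theta> q x" "\<And>q. AE x in ?PP. \<Theta> q x = ennreal (T q x)"
    by blast
  \<comment> \<open>Restricting weights to the first m indices makes the rational ones countable, so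
    \<Psi> is a countable infimum and hence measurable.\<close>
  define Qs where "Qs = PiE {..<m} (\<lambda>_. \<rat> :: real set)"
  have cQ: "countable Qs" unfolding Qs_def by (intro countable_PiE countable_rat) auto
  define err where "err q z = b * (\<Sum>i<m. \<bar>w i * e (z i) - q i\<bar>)" for q z
  have err0: "err q z \<ge> 0" for q z using b0 by (auto simp: err_def intro!: mult_nonneg_nonneg sum_nonneg)
  define \<Psi> where "\<Psi> z = (INF q\<in>Qs. \<Theta> q (res z) + ennreal (err q z))" for z
  have sum_res: "(\<Sum>i<m. q i * f (res z i)) = (\<Sum>i<m. q i * f (pr (z i)))" for q :: "nat \<Rightarrow> real" and f z
    by (intro sum.cong) (auto simp: res_def)
  have \<Theta>m: "(\<lambda>z. \<Theta> q (res z)) \<in> borel_measurable ?PN" for q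
    by (rule measurable_compose[OF res \<Theta>(1)])
  have errm: "(\<lambda>z. ennreal (err q z)) \<in> borel_measurable ?PN" for q
    unfolding err_def by measurable
  have "\<Psi> \<in> borel_measurable ?PN"
    unfolding \<Psi>_def using cQ \<Theta>m errm by (intro borel_measurable_INF borel_measurable_add)
  moreover have "ennreal \<bar>\<Sum>i<m. w i * (e (z i) * f (pr (z i)))\<bar> \<le> \<Psi> z" if f: "f \<in> FF" for z f
    unfolding \<Psi>_def
  proof (rule INF_greatest)
    fix q
    have "\<bar>\<Sum>i<m. w i * (e (z i) * f (pr (z i)))\<bar> \<le> \<bar>\<Sum>i<m. q i * f (res z i)\<bar> + err q z"
      using lin[OF f, of "\<lambda>i. w i * e (z i)" "\<lambda>i. pr (z i)" q] unfolding sum_res err_def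
      by (simp add: mult.assoc)
    also have "\<dots> \<le> T q (res z) + err q z" using T_ge[OF f] by simp
    finally have "ennreal \<bar>\<Sum>i<m. w i * (e (z i) * f (pr (z i)))\<bar> \<le> ennreal (T q (res z) + err q z)"
      by (rule ennreal_leI)
    also have "\<dots> \<le> ennreal (T q (res z)) + ennreal (err q z)"
      using err0 order_trans[OF abs_ge_zero T_ge[OF f]] by (simp add: ennreal_plus)
    also have "\<dots> \<le> \<Theta> q (res z) + ennreal (err q z)" using \<Theta>(2) by (intro add_right_mono)
    finally show "ennreal \<bar>\<Sum>i<m. w i * (e (z i) * f (pr (z i)))\<bar> \<le> \<Theta> q (res z) + ennreal (err q z)" .
  qed
  moreover have "AE z in ?PN. \<forall>v. (\<forall>f\<in>FF. \<bar>\<Sum>i<m. w i * (e (z i) * f (pr (z i)))\<bar> \<le> v)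
        \<longrightarrow> \<Psi> z \<le> ennreal v"
  proof -
    have "AE z in ?PN. \<Theta> q (res z) = ennreal (T q (res z))" for q
      by (rule AE_distrD[OF res]) (subst res_distr, rule \<Theta>(3))
    then have "AE z in ?PN. \<forall>q\<in>Qs. \<Theta> q (res z) = ennreal (T q (res z))"
      using cQ by (simp add: AE_ball_countable)
    then show ?thesis
    proof eventually_elim
      case (elim z)
      show ?case
      proof (intro allI impI)
        fix v assume v: "\<forall>f\<in>FF. \<bar>\<Sum>i<m. w i * (e (z i) * f (pr (z i)))\<bar> \<le> v"
        show "\<Psi> z \<le> ennreal v"
        proof (rule ennreal_le_epsilon)
          fix \<epsilon> :: real assume "\<epsilon> > 0"
          \<comment> \<open>The error enters twice, as a term of \<Psi> and in exchanging the random
            weights for q inside T, so \<open>2 * b\<close> has to fit; the \<open>+ 1\<close>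
            covers b = 0.\<close>
          then obtain q where q: "q \<in> Qs" "(\<Sum>i<m. \<bar>w i * e (z i) - q i\<bar>) \<le> \<epsilon> / (2 * b + 1)"
            using rational_approximation_L1[of "\<epsilon> / (2 * b + 1)" m "\<lambda>i. w i * e (z i)"] b0
            unfolding Qs_def by auto
          have "err q z \<le> b * (\<epsilon> / (2 * b + 1))"
            unfolding err_def using q(2) b0 by (rule mult_left_mono)
          then have "2 * err q z \<le> 2 * b * \<epsilon> / (2 * b + 1)" by simp
          also have "\<dots> \<le> \<epsilon>" using b0 \<open>\<epsilon> > 0\<close> by (simp add: field_simps)
          finally have err: "2 * err q z \<le> \<epsilon>" .
          have "T q (res z) \<le> v + err q z"
            unfolding T_def
          proof (rule cSUP_least[OF ne])
            fix f assume f: "f \<in> FF"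
            show "\<bar>\<Sum>i<m. q i * f (res z i)\<bar> \<le> v + err q z"
              using lin[OF f, of "\<lambda>i. w i * e (z i)" "\<lambda>i. pr (z i)" q] bspec[OF v f]
              unfolding sum_res err_def by (simp add: mult.assoc)
          qed
          then have le: "T q (res z) + err q z \<le> v + \<epsilon>" using err by linarith
          obtain f where f: "f \<in> FF" using ne by blast
          have v0: "v \<ge> 0" using bspec[OF v f] by linarith
          have "\<Psi> z \<le> \<Theta> q (res z) + ennreal (err q z)"
            unfolding \<Psi>_def by (rule INF_lower[OF q(1)])
          also have "\<dots> = ennreal (T q (res z) + err q z)"
            using bspec[OF elim q(1)] err0 order_trans[OF abs_ge_zero T_ge[OF f]]
            by (simp add: ennreal_plus)
          also have "\<dots> \<le> ennreal (v + \<epsilon>)" using le by (rule ennreal_leI)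
          also have "\<dots> = ennreal v + ennreal \<epsilon>" using v0 \<open>\<epsilon> > 0\<close> by (simp add: ennreal_plus)
          finally show "\<Psi> z \<le> ennreal v + ennreal \<epsilon>" .
        qed
      qed
    qed
  qed
  ultimately show ?thesis by blast
qed

section \<open>The common moment bound for multipliers and squares\<close>

lemma sum_lessThan_double:
  fixes f :: "nat \<Rightarrow> 'b::comm_monoid_add"
  shows "(\<Sum>i<2 * n. f i) = (\<Sum>i<n. f i + f (n + i))"
proof -
  have "(\<Sum>i<2 * n. f i) = (\<Sum>i<n. f i) + (\<Sum>i=n..<2 * n. f i)"
    by (simp add: lessThan_atLeast0 sum.atLeastLessThan_concat)
  also have "(\<Sum>i=n..<2 * n. f i) = (\<Sum>i<n. f (n + i))"
    using sum.shift_bounds_nat_ivl[of f 0 n n] by (simp add: lessThan_atLeast0 mult_2 add.commute)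
  finally show ?thesis by (simp add: sum.distrib)
qed

text \<open>Serves twice: with the regression errors as e and \<phi> the identity, and with e = 1
  and \<phi> squaring. As \<phi> is Lipschitz, the entropy of G' controls the process indexed by the
  functions \<phi> g. Given the 2 n points, the chaining bound involves the data only through e and
  the envelope there, so integrating it over the sample leaves the moment V.\<close>

lemma multiplier_second_moment:
  fixes P :: "'a measure" and N :: "'z measure" and pr :: "'z \<Rightarrow> 'a"
    and G G' :: "('a \<Rightarrow> real) set" and \<phi> :: "('a \<Rightarrow> real) \<Rightarrow> 'a \<Rightarrow> real" and n :: nat
  assumes P: "prob_space P" and N: "prob_space N"
    and pr[measurable]: "pr \<in> N \<rightarrow>\<^sub>M P" and prP: "distr N P pr = P"
    and e[measurable]: "e \<in> borel_measurable N"
    and ent: "\<And>k. k \<ge> 1 \<Longrightarrow> uniform_entropy ((1/2) ^ k) G \<le> ereal (H k)"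
    and H0: "\<And>k. H k \<ge> 0" and Hmono: "\<And>k. H k \<le> H (Suc k)"
    and sub: "G' \<subseteq> G" and zero: "(\<lambda>_. 0) \<in> G'"
    and bdd: "\<And>y. bdd_above ((\<lambda>g. \<bar>g y\<bar>) ` G')"
    and meas: "\<And>m (q :: nat \<Rightarrow> real). (\<lambda>x. SUP f\<in>\<phi> ` G'. \<bar>\<Sum>i<m. q i * f (x i)\<bar>)
          \<in> borel_measurable (completion (PiM {..<m} (\<lambda>_. P)))"
    and \<phi>b: "\<And>g x. g \<in> G' \<Longrightarrow> \<bar>\<phi> g x\<bar> \<le> b" and \<phi>0: "\<And>x. \<phi> (\<lambda>_. 0) x = 0"
    and \<phi>l: "\<And>f g x. f \<in> G' \<Longrightarrow> g \<in> G' \<Longrightarrow> \<bar>\<phi> f x - \<phi> g x\<bar> \<le> l * \<bar>f x - g x\<bar>"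
    and int: "\<And>g. g \<in> G' \<Longrightarrow> integrable N (\<lambda>z. e z * \<phi> g (pr z))"
    and E[measurable]: "E \<in> borel_measurable P" and E0: "\<And>x. E x \<ge> 0"
    and envE: "AE x in P. (envelope G' x)\<^sup>2 \<le> E x"
    and mom: "(\<integral>\<^sup>+z. ennreal ((e z)\<^sup>2 * E (pr z)) \<partial>N) \<le> ennreal V" and V: "V \<ge> 0"
  shows "\<exists>\<psi>\<in>borel_measurable (PiM {..<n} (\<lambda>_. N)).
     (\<forall>z\<in>space (PiM {..<n} (\<lambda>_. N)). \<forall>g\<in>G'. ennreal ((\<Sum>i<n. e (z i) * \<phi> g (pr (z i))
          - (\<integral>z. e z * \<phi> g (pr z) \<partial>N))\<^sup>2) \<le> \<psi> z) \<and>
     (\<integral>\<^sup>+z. \<psi> z \<partial>PiM {..<n} (\<lambda>_. N))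
        \<le> ennreal (2304 * l\<^sup>2 * ((chaining_sum H K)\<^sup>2 + n * (1/4) ^ K) * n * V)"
proof -
  interpret N: prob_space N by (rule N)
  let ?PN = "PiM {..<2 * n} (\<lambda>_. N)"
  define L2 where "L2 = (chaining_sum H K)\<^sup>2 + n * (1/4) ^ K"
  have L2: "L2 \<ge> 0" by (simp add: L2_def)
  define HH where "HH = (\<lambda>g z. e z * \<phi> g (pr z)) ` G'"
  \<comment> \<open>Weight 1 on the sample and -1 on its ghost copy turn the symmetrized difference
    into one weighted sum over 2 n points.\<close>
  define w where "w i = (if i < n then 1 else -1 :: real)" for i
  have FFne: "\<phi> ` G' \<noteq> {}" using zero by blast
  have "\<exists>\<Psi>\<in>borel_measurable ?PN.
    (\<forall>z. \<forall>f\<in>\<phi> ` G'. ennreal \<bar>\<Sum>i<2 * n. w i * (e (z i) * f (pr (z i)))\<bar> \<le> \<Psi> z) \<and>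
    (AE z in ?PN. \<forall>v. (\<forall>f\<in>\<phi> ` G'. \<bar>\<Sum>i<2 * n. w i * (e (z i) * f (pr (z i)))\<bar> \<le> v)
        \<longrightarrow> \<Psi> z \<le> ennreal v)"
    by (rule multiplier_supremum_majorant[OF P N pr prP e meas _ FFne]) (use \<phi>b in blast)
  then obtain \<Psi> where \<Psi>[measurable]: "\<Psi> \<in> borel_measurable ?PN"
    and \<Psi>_ge: "\<forall>z. \<forall>f\<in>\<phi> ` G'. ennreal \<bar>\<Sum>i<2 * n. w i * (e (z i) * f (pr (z i)))\<bar> \<le> \<Psi> z"
    and \<Psi>_le: "AE z in ?PN. \<forall>v. (\<forall>f\<in>\<phi> ` G'. \<bar>\<Sum>i<2 * n. w i * (e (z i) * f (pr (z i)))\<bar> \<le> v)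
        \<longrightarrow> \<Psi> z \<le> ennreal v"
    by (elim bexE conjE)
  have wsum: "(\<Sum>i<2 * n. w i * (e (z i) * f (pr (z i)))) =
      (\<Sum>i<n. e (z i) * f (pr (z i)) - e (z (n + i)) * f (pr (z (n + i))))" for z f
    unfolding sum_lessThan_double by (intro sum.cong) (auto simp: w_def)
  \<comment> \<open>1152 is the 576 of the chaining bound times the 2 in the weights c below;
    summation over 2 n points gives the final 2304 n.\<close>
  define B where "B z = (\<Sum>i<2 * n. ennreal (1152 * l\<^sup>2 * L2 * ((e (z i))\<^sup>2 * E (pr (z i)))))" for z
  have B[measurable]: "B \<in> borel_measurable ?PN"
    unfolding B_def by measurable
  have "\<exists>\<psi>\<in>borel_measurable (PiM {..<n} (\<lambda>_. N)).
     (\<forall>x\<in>space (PiM {..<n} (\<lambda>_. N)). \<forall>h\<in>HH.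
        ennreal ((\<Sum>i<n. h (x i) - (\<integral>z. h z \<partial>N))\<^sup>2) \<le> \<psi> x) \<and>
     (\<integral>\<^sup>+x. \<psi> x \<partial>PiM {..<n} (\<lambda>_. N)) \<le> (\<integral>\<^sup>+z. B z \<partial>?PN)"
  proof (rule symmetrization[where \<Psi> = "\<lambda>z. (\<Psi> z)\<^sup>2"])
    show "HH \<noteq> {}" using zero by (auto simp: HH_def)
    show "integrable N h" if "h \<in> HH" for h using that int by (auto simp: HH_def)
    show "ennreal ((\<Sum>i<n. h (z i) - h (z (n + i)))\<^sup>2) \<le> (\<Psi> z)\<^sup>2" if h: "h \<in> HH" for z h
    proof -
      obtain g where g: "g \<in> G'" "h = (\<lambda>z. e z * \<phi> g (pr z))" using h by (auto simp: HH_def)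
      have "ennreal \<bar>\<Sum>i<n. h (z i) - h (z (n + i))\<bar> \<le> \<Psi> z"
        using \<Psi>_ge[rule_format, of "\<phi> g" z] g by (simp add: wsum)
      then have "(ennreal \<bar>\<Sum>i<n. h (z i) - h (z (n + i))\<bar>)\<^sup>2 \<le> (\<Psi> z)\<^sup>2" by (rule power_mono) simp
      then show ?thesis by (simp add: ennreal_power)
    qed
    show "AE z in ?PN. \<forall>v. (\<forall>h\<in>HH. (\<Sum>i<n. h (z i) - h (z (n + i)))\<^sup>2 \<le> v) \<longrightarrow> (\<Psi> z)\<^sup>2 \<le> ennreal v"
      using \<Psi>_le
    proof eventually_elim
      case (elim z)
      show ?case
      proof (intro allI impI)
        fix v assume v: "\<forall>h\<in>HH. (\<Sum>i<n. h (z i) - h (z (n + i)))\<^sup>2 \<le> v"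
        have v0: "v \<ge> 0"
        proof -
          have "(\<lambda>z. e z * \<phi> (\<lambda>_. 0) (pr z)) \<in> HH" using zero by (auto simp: HH_def)
          from bspec[OF v this] show ?thesis using order_trans[OF zero_le_power2] by blast
        qed
        have "\<forall>f\<in>\<phi> ` G'. \<bar>\<Sum>i<2 * n. w i * (e (z i) * f (pr (z i)))\<bar> \<le> sqrt v"
          unfolding wsum using v by (auto simp: HH_def intro!: real_le_rsqrt)
        then have "\<Psi> z \<le> ennreal (sqrt v)" using elim by blast
        then have "(\<Psi> z)\<^sup>2 \<le> (ennreal (sqrt v))\<^sup>2" by (rule power_mono) simp
        also have "\<dots> = ennreal v" using v0 by (simp add: ennreal_power)
        finally show "(\<Psi> z)\<^sup>2 \<le> ennreal v" .
      qed
    qed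
    have "AE z in N. (envelope G' (pr z))\<^sup>2 \<le> E (pr z)"
      by (rule AE_distrD[OF pr]) (subst prP, rule envE)
    then have "AE z in ?PN. (envelope G' (pr (z i)))\<^sup>2 \<le> E (pr (z i))" if "i < 2 * n" for i
      using that N by (intro AE_PiM_component) auto
    then have "AE z in ?PN. \<forall>i\<in>{..<2 * n}. (envelope G' (pr (z i)))\<^sup>2 \<le> E (pr (z i))"
      by (intro AE_finite_allI) auto
    then show "AE z in ?PN. \<exists>W. (\<forall>R\<subseteq>{..<n}. \<forall>h\<in>HH. (\<Sum>i<n. rsign R i * (h (z i) - h (z (n + i))))\<^sup>2 \<le> W R) \<and>
        ennreal (\<Sum>R\<in>Pow {..<n}. W R) \<le> 2 ^ n * B z"
    proof eventually_elim
      case (elim z)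
      define u where "u g i = e (z i) * \<phi> g (pr (z i)) - e (z (n + i)) * \<phi> g (pr (z (n + i)))" for g i
      \<comment> \<open>Weights of the random discrete measure on the doubled sample. The 2 comes
        from \<open>square_sum_le\<close>, which separates an observation from its ghost.\<close>
      define c where "c i = 2 * l\<^sup>2 * (e (z i))\<^sup>2" for i
      define x where "x i = pr (z i)" for i
      have c: "\<forall>i<2 * n. c i \<ge> 0" by (simp add: c_def)
      have lip: "(\<Sum>i<n. (u f i - u g i)\<^sup>2) \<le> (weighted_norm (2 * n) c x (\<lambda>y. f y - g y))\<^sup>2"
        if fg: "f \<in> G'" "g \<in> G'" for f g
      proof -
        have l1: "(e y * \<phi> f (pr y) - e y * \<phi> g (pr y))\<^sup>2 \<le> l\<^sup>2 * (e y)\<^sup>2 * (f (pr y) - g (pr y))\<^sup>2" for y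
        proof -
          have "(\<phi> f (pr y) - \<phi> g (pr y))\<^sup>2 \<le> (l * \<bar>f (pr y) - g (pr y)\<bar>)\<^sup>2"
            using power_mono[OF \<phi>l[OF fg, of "pr y"] abs_ge_zero, of 2] by simp
          then have "(e y)\<^sup>2 * (\<phi> f (pr y) - \<phi> g (pr y))\<^sup>2 \<le> (e y)\<^sup>2 * (l * \<bar>f (pr y) - g (pr y)\<bar>)\<^sup>2"
            by (rule mult_left_mono) simp
          then show ?thesis by (simp add: power_mult_distrib mult_ac flip: right_diff_distrib)
        qed
        have "(u f i - u g i)\<^sup>2 \<le> c i * (f (x i) - g (x i))\<^sup>2 + c (n + i) * (f (x (n + i)) - g (x (n + i)))\<^sup>2" for i
        proof -
          have "(u f i - u g i)\<^sup>2 = ((e (z i) * \<phi> f (pr (z i)) - e (z i) * \<phi> g (pr (z i)))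
             + - (e (z (n + i)) * \<phi> f (pr (z (n + i))) - e (z (n + i)) * \<phi> g (pr (z (n + i)))))\<^sup>2"
            by (simp add: u_def algebra_simps)
          also have "\<dots> \<le> 2 * (e (z i) * \<phi> f (pr (z i)) - e (z i) * \<phi> g (pr (z i)))\<^sup>2 +
             2 * (e (z (n + i)) * \<phi> f (pr (z (n + i))) - e (z (n + i)) * \<phi> g (pr (z (n + i))))\<^sup>2"
            using square_sum_le by (metis power2_minus)
          also have "\<dots> \<le> 2 * (l\<^sup>2 * (e (z i))\<^sup>2 * (f (pr (z i)) - g (pr (z i)))\<^sup>2) +
             2 * (l\<^sup>2 * (e (z (n + i)))\<^sup>2 * (f (pr (z (n + i))) - g (pr (z (n + i))))\<^sup>2)"
            by (intro add_mono mult_left_mono l1) auto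
          finally show ?thesis by (simp add: c_def x_def mult.assoc)
        qed
        then have "(\<Sum>i<n. (u f i - u g i)\<^sup>2) \<le> (\<Sum>i<2 * n. c i * (f (x i) - g (x i))\<^sup>2)"
          unfolding sum_lessThan_double by (intro sum_mono)
        then show ?thesis by (simp add: weighted_norm_sq[OF c])
      qed
      have "\<exists>W. (\<forall>R\<subseteq>{..<n}. \<forall>g\<in>G'. (\<Sum>i<n. rsign R i * u g i)\<^sup>2 \<le> W R) \<and>
         (\<Sum>R\<in>Pow {..<n}. W R) \<le> 2 ^ n * (576 * ((\<Sum>k<K. (1/2) ^ Suc k * sqrt (1 + 2 * H (Suc k)))\<^sup>2
         + n * (1/4) ^ K) * (weighted_norm (2 * n) c x (envelope G'))\<^sup>2)"
        by (rule chaining[OF ent H0 Hmono sub zero bdd c _ lip]) (auto simp: u_def \<phi>0)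
      then obtain W where W: "\<forall>R\<subseteq>{..<n}. \<forall>g\<in>G'. (\<Sum>i<n. rsign R i * u g i)\<^sup>2 \<le> W R"
         "(\<Sum>R\<in>Pow {..<n}. W R) \<le> 2 ^ n * (576 * L2 * (weighted_norm (2 * n) c x (envelope G'))\<^sup>2)"
        unfolding L2_def chaining_sum_def by blast
      note W(2)
      also have "2 ^ n * (576 * L2 * (weighted_norm (2 * n) c x (envelope G'))\<^sup>2) \<le>
         2 ^ n * (576 * L2 * (\<Sum>i<2 * n. c i * E (x i)))"
        unfolding weighted_norm_sq[OF c] using L2 c elim
        by (intro mult_left_mono sum_mono) (auto simp: x_def)
      also have "576 * L2 * (\<Sum>i<2 * n. c i * E (x i)) =
          (\<Sum>i<2 * n. 1152 * l\<^sup>2 * L2 * ((e (z i))\<^sup>2 * E (pr (z i))))"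
        by (simp add: sum_distrib_left c_def x_def mult_ac)
      finally have "ennreal (\<Sum>R\<in>Pow {..<n}. W R) \<le>
          ennreal (2 ^ n * (\<Sum>i<2 * n. 1152 * l\<^sup>2 * L2 * ((e (z i))\<^sup>2 * E (pr (z i)))))"
        by (rule ennreal_leI)
      also have "\<dots> = 2 ^ n * B z"
        unfolding B_def using L2 E0
        by (subst sum_ennreal) (auto simp: ennreal_mult' simp flip: ennreal_power intro!: sum_nonneg)
      finally have "ennreal (\<Sum>R\<in>Pow {..<n}. W R) \<le> 2 ^ n * B z" .
      moreover have "\<forall>R\<subseteq>{..<n}. \<forall>h\<in>HH. (\<Sum>i<n. rsign R i * (h (z i) - h (z (n + i))))\<^sup>2 \<le> W R"
        using W(1) by (auto simp: HH_def u_def)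
      ultimately show ?case by blast
    qed
  qed (use N in auto)
  then obtain \<psi> where \<psi>: "\<psi> \<in> borel_measurable (PiM {..<n} (\<lambda>_. N))"
     "\<forall>x\<in>space (PiM {..<n} (\<lambda>_. N)). \<forall>h\<in>HH. ennreal ((\<Sum>i<n. h (x i) - (\<integral>z. h z \<partial>N))\<^sup>2) \<le> \<psi> x"
     "(\<integral>\<^sup>+x. \<psi> x \<partial>PiM {..<n} (\<lambda>_. N)) \<le> (\<integral>\<^sup>+z. B z \<partial>?PN)"
    by blast
  note \<psi>(3)
  also have "(\<integral>\<^sup>+z. B z \<partial>?PN) =
     (\<Sum>i<2 * n. (\<integral>\<^sup>+z. ennreal (1152 * l\<^sup>2 * L2 * ((e (z i))\<^sup>2 * E (pr (z i)))) \<partial>?PN))"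
    unfolding B_def by (rule nn_integral_sum) measurable
  also have "\<dots> \<le> (\<Sum>i<2 * n. ennreal (1152 * l\<^sup>2 * L2 * V))"
  proof (rule sum_mono)
    fix i assume i: "i \<in> {..<2 * n}"
    have mi[measurable]: "(\<lambda>z. z i) \<in> ?PN \<rightarrow>\<^sub>M N" using i by (rule measurable_component_singleton)
    have d: "distr ?PN N (\<lambda>z. z i) = N" using i N by (intro distr_PiM_component)
    have "(\<integral>\<^sup>+z. ennreal (1152 * l\<^sup>2 * L2 * ((e (z i))\<^sup>2 * E (pr (z i)))) \<partial>?PN) =
       (\<integral>\<^sup>+y. ennreal (1152 * l\<^sup>2 * L2 * ((e y)\<^sup>2 * E (pr y))) \<partial>distr ?PN N (\<lambda>z. z i))"
      using i by (subst nn_integral_distr) auto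
    also have "\<dots> = (\<integral>\<^sup>+y. ennreal (1152 * l\<^sup>2 * L2) * ennreal ((e y)\<^sup>2 * E (pr y)) \<partial>N)"
      unfolding d using L2 by (simp add: ennreal_mult')
    also have "\<dots> = ennreal (1152 * l\<^sup>2 * L2) * (\<integral>\<^sup>+y. ennreal ((e y)\<^sup>2 * E (pr y)) \<partial>N)"
      by (rule nn_integral_cmult) measurable
    also have "\<dots> \<le> ennreal (1152 * l\<^sup>2 * L2) * ennreal V"
      by (intro mult_left_mono mom) auto
    also have "\<dots> = ennreal (1152 * l\<^sup>2 * L2 * V)" using L2 V by (simp add: ennreal_mult')
    finally show "(\<integral>\<^sup>+z. ennreal (1152 * l\<^sup>2 * L2 * ((e (z i))\<^sup>2 * E (pr (z i)))) \<partial>?PN)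
        \<le> ennreal (1152 * l\<^sup>2 * L2 * V)" .
  qed
  also have "\<dots> = ennreal (\<Sum>i<2 * n. 1152 * l\<^sup>2 * L2 * V)"
    using L2 V by (intro sum_ennreal) auto
  also have "(\<Sum>i<2 * n. 1152 * l\<^sup>2 * L2 * V) = 2304 * l\<^sup>2 * L2 * n * V" by simp
  finally show ?thesis
    using \<psi>(1,2) unfolding HH_def L2_def by (intro bexI[of _ \<psi>] conjI) simp_all
qed

subsection \<open>The regression model\<close>

lemma generated_algebra_subalgebra:
  "X \<in> borel_measurable M \<Longrightarrow> subalgebra M (generated_algebra M X)"
  by (auto simp: subalgebra_def generated_algebra_def sets_vimage_algebra2 dest: measurable_sets)

lemma measurable_generated_algebra:
  "g \<in> borel_measurable borel \<Longrightarrow> (\<lambda>\<omega>. g (X \<omega>)) \<in> borel_measurable (generated_algebra M X)"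
  unfolding generated_algebra_def
  by (rule measurable_compose[OF measurable_vimage_algebra1]) auto

text \<open>\<open>g (X \<omega>)\<close> is measurable for the conditioning algebra and moves
  through the conditional expectation, where Y becomes \<open>f0 (X \<omega>)\<close>. Boundedness
  of g makes the products integrable.\<close>

lemma regression_error_orthogonal:
  assumes M: "prob_space M" and X[measurable]: "X \<in> borel_measurable M" and Y[measurable]: "Y \<in> borel_measurable M"
    and reg: "regression_function M X Y f0" and f0: "\<And>x. \<bar>f0 x\<bar> \<le> b"
    and g[measurable]: "g \<in> borel_measurable borel" and gb: "\<And>x. \<bar>g x\<bar> \<le> c"
  shows "integrable M (\<lambda>\<omega>. (Y \<omega> - f0 (X \<omega>)) * g (X \<omega>))" "(\<integral>\<omega>. (Y \<omega> - f0 (X \<omega>)) * g (X \<omega>) \<partial>M) = 0"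
proof -
  interpret prob_space M by (rule M)
  interpret finite_measure_subalgebra M "generated_algebra M X"
    by unfold_locales (rule generated_algebra_subalgebra[OF X])
  have [measurable]: "f0 \<in> borel_measurable borel" and Yi: "integrable M Y"
    and ce: "AE \<omega> in M. real_cond_exp M (generated_algebra M X) Y \<omega> = f0 (X \<omega>)"
    using reg by (auto simp: regression_function_def)
  have Yg: "integrable M (\<lambda>\<omega>. g (X \<omega>) * Y \<omega>)"
  proof (rule Bochner_Integration.integrable_bound)
    show "integrable M (\<lambda>\<omega>. c * Y \<omega>)" using Yi by simp
    show "AE \<omega> in M. norm (g (X \<omega>) * Y \<omega>) \<le> norm (c * Y \<omega>)"
      using gb order_trans[OF gb abs_ge_self]
      by (intro AE_I2) (simp add: abs_mult mult_right_mono)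
  qed measurable
  have fg: "integrable M (\<lambda>\<omega>. g (X \<omega>) * f0 (X \<omega>))"
  proof (rule integrable_const_bound[where B = "c * b"])
    show "AE \<omega> in M. norm (g (X \<omega>) * f0 (X \<omega>)) \<le> c * b"
      using gb f0 order_trans[OF abs_ge_zero gb]
      by (intro AE_I2) (auto simp: abs_mult intro!: mult_mono)
  qed measurable
  have "(\<integral>\<omega>. g (X \<omega>) * Y \<omega> \<partial>M) = (\<integral>\<omega>. g (X \<omega>) * real_cond_exp M (generated_algebra M X) Y \<omega> \<partial>M)"
    by (rule real_cond_exp_intg(2)[OF Yg measurable_generated_algebra[OF g] Y, symmetric])
  also have "\<dots> = (\<integral>\<omega>. g (X \<omega>) * f0 (X \<omega>) \<partial>M)"
    using ce by (intro integral_cong_AE) (auto intro!: borel_measurable_times)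
  finally have eq: "(\<integral>\<omega>. g (X \<omega>) * Y \<omega> \<partial>M) = (\<integral>\<omega>. g (X \<omega>) * f0 (X \<omega>) \<partial>M)" .
  have r: "(\<lambda>\<omega>. (Y \<omega> - f0 (X \<omega>)) * g (X \<omega>)) = (\<lambda>\<omega>. g (X \<omega>) * Y \<omega> - g (X \<omega>) * f0 (X \<omega>))"
    by (auto simp: algebra_simps)
  show "integrable M (\<lambda>\<omega>. (Y \<omega> - f0 (X \<omega>)) * g (X \<omega>))" unfolding r using Yg fg by simp
  show "(\<integral>\<omega>. (Y \<omega> - f0 (X \<omega>)) * g (X \<omega>) \<partial>M) = 0" unfolding r using Yg fg eq by simp
qed

text \<open>\<open>E (X \<omega>)\<close> depends on the design only, so the conditional second
  moment of the error can be inserted under the integral. With E a version of the squared envelope,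
  this is the moment that the multiplier bound asks for.\<close>

lemma conditional_variance_nn_integral:
  assumes M: "prob_space M" and X[measurable]: "X \<in> borel_measurable M" and Y[measurable]: "Y \<in> borel_measurable M"
    and [measurable]: "f0 \<in> borel_measurable borel"
    and cv: "conditional_variance_bound M X Y f0 \<sigma>"
    and E[measurable]: "E \<in> borel_measurable borel" and E0: "\<And>x. E x \<ge> (0::real)"
  shows "(\<integral>\<^sup>+\<omega>. ennreal ((Y \<omega> - f0 (X \<omega>))\<^sup>2 * E (X \<omega>)) \<partial>M) \<le> ennreal (\<sigma>\<^sup>2) * (\<integral>\<^sup>+\<omega>. ennreal (E (X \<omega>)) \<partial>M)"
proof -
  interpret prob_space M by (rule M)
  interpret finite_measure_subalgebra M "generated_algebra M X"
    by unfold_locales (rule generated_algebra_subalgebra[OF X])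
  let ?c = "nn_cond_exp M (generated_algebra M X) (\<lambda>\<omega>. ennreal ((Y \<omega> - f0 (X \<omega>))\<^sup>2))"
  have Em: "(\<lambda>\<omega>. ennreal (E (X \<omega>))) \<in> borel_measurable (generated_algebra M X)"
    using measurable_generated_algebra[OF E] by (rule measurable_compose) simp
  have "(\<integral>\<^sup>+\<omega>. ennreal ((Y \<omega> - f0 (X \<omega>))\<^sup>2 * E (X \<omega>)) \<partial>M) =
      (\<integral>\<^sup>+\<omega>. ennreal (E (X \<omega>)) * ennreal ((Y \<omega> - f0 (X \<omega>))\<^sup>2) \<partial>M)"
    using E0 by (simp add: ennreal_mult mult.commute)
  also have "\<dots> = (\<integral>\<^sup>+\<omega>. ennreal (E (X \<omega>)) * ?c \<omega> \<partial>M)"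
    by (rule nn_cond_exp_intg[OF Em, symmetric]) measurable
  also have "\<dots> \<le> (\<integral>\<^sup>+\<omega>. ennreal (\<sigma>\<^sup>2) * ennreal (E (X \<omega>)) \<partial>M)"
    using cv unfolding conditional_variance_bound_def
    by (intro nn_integral_mono_AE) (auto elim!: eventually_mono simp: mult.commute intro!: mult_left_mono)
  also have "\<dots> = ennreal (\<sigma>\<^sup>2) * (\<integral>\<^sup>+\<omega>. ennreal (E (X \<omega>)) \<partial>M)"
    by (rule nn_integral_cmult) measurable
  finally show ?thesis .
qed

lemma l2_norm_sq_eq_integral:
  assumes P: "prob_space P" and g[measurable]: "g \<in> borel_measurable P" and gb: "\<And>x. \<bar>g x\<bar> \<le> b"
  shows "(l2_norm P g)\<^sup>2 = (\<integral>x. (g x)\<^sup>2 \<partial>P)"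
proof -
  interpret prob_space P by (rule P)
  have "integrable P (\<lambda>x. (g x)\<^sup>2)"
  proof (rule integrable_const_bound[where B = "b\<^sup>2"])
    show "AE x in P. norm ((g x)\<^sup>2) \<le> b\<^sup>2"
      using gb by (intro AE_I2) (simp add: abs_le_square_iff[symmetric] order_trans[OF gb abs_ge_self])
  qed measurable
  then show ?thesis by (simp add: l2_norm_def nn_integral_eq_integral)
qed

text \<open>Applied with one summand of weight 1, measurability of the class gives an honestly measurable
  version of the squared envelope.\<close>

lemma envelope_measurable_version:
  fixes P :: "'a measure"
  assumes P: "prob_space P" and pm: "P_measurable_class P G"
    and b: "\<And>g x. g \<in> G \<Longrightarrow> \<bar>g x\<bar> \<le> b" and ne: "G \<noteq> {}"
    and V: "l2_norm P (envelope G) \<le> V"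
  shows "\<exists>E\<in>borel_measurable P. (\<forall>x. 0 \<le> E x) \<and> (AE x in P. (envelope G x)\<^sup>2 \<le> E x) \<and>
      (\<integral>\<^sup>+x. ennreal (E x) \<partial>P) \<le> ennreal (V\<^sup>2)"
proof -
  interpret P: prob_space P by (rule P)
  interpret product_sigma_finite "\<lambda>_::nat. P" ..
  have env: "0 \<le> envelope G x" "envelope G x \<le> b" for x
  proof -
    have bdd: "bdd_above ((\<lambda>g. \<bar>g x\<bar>) ` G)" using b by (intro bdd_aboveI2) auto
    obtain g where "g \<in> G" using ne by blast
    then have "\<bar>g x\<bar> \<le> envelope G x"
      unfolding envelope_def using bdd by (rule cSUP_upper)
    then show "0 \<le> envelope G x" by linarith
    show "envelope G x \<le> b" unfolding envelope_def using ne b by (intro cSUP_least)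
  qed
  let ?P1 = "PiM {..<1::nat} (\<lambda>_. P)"
  have "(\<lambda>x. SUP g\<in>G. \<bar>\<Sum>i<(1::nat). 1 * g (x i)\<bar>) \<in> borel_measurable (completion ?P1)"
    using pm unfolding P_measurable_class_def by (elim conjE allE[of _ "1::nat"] allE[of _ "\<lambda>_. 1::real"]) simp
  then have "(\<lambda>x. envelope G (x 0)) \<in> borel_measurable (completion ?P1)"
    by (simp add: envelope_def)
  then obtain T where T: "T \<in> borel_measurable ?P1" "AE x in ?P1. envelope G (x 0) = T x"
    using completion_ex_borel_measurable_real by blast
  \<comment> \<open>Measurability is known on the one-fold product; \<iota> identifies P with
    it.\<close>
  define \<iota> where "\<iota> y = (\<lambda>i\<in>{..<1::nat}. y)" for y :: 'a
  have \<iota>[measurable]: "\<iota> \<in> P \<rightarrow>\<^sub>M ?P1" unfolding \<iota>_def by measurable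
  have "distr P ?P1 \<iota> = ?P1"
  proof -
    have s: "{..<1::nat} = {0}" by auto
    have "distr P ?P1 \<iota> = distr (distr ?P1 P (\<lambda>x. x 0)) ?P1 \<iota>"
      unfolding s distr_singleton ..
    also have "\<dots> = distr ?P1 ?P1 (\<lambda>x. \<iota> (x 0))"
    proof -
      have "(\<lambda>x. x 0) \<in> ?P1 \<rightarrow>\<^sub>M P" by (rule measurable_component_singleton) simp
      from distr_distr[OF \<iota> this] show ?thesis by (simp only: comp_def)
    qed
    also have "\<dots> = distr ?P1 ?P1 (\<lambda>x. x)"
    proof (rule distr_cong[OF refl refl])
      fix x assume "x \<in> space ?P1"
      then show "\<iota> (x 0) = x" by (auto simp: \<iota>_def space_PiM PiE_def extensional_def fun_eq_iff)
    qed
    finally show ?thesis by (simp add: distr_id2)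
  qed
  then have "AE x in distr P ?P1 \<iota>. envelope G (x 0) = T x" by (simp only: T(2))
  from AE_distrD[OF \<iota> this] have ae: "AE y in P. envelope G y = T (\<iota> y)"
    by (simp add: \<iota>_def)
  define E where "E y = (T (\<iota> y))\<^sup>2" for y
  have Em: "E \<in> borel_measurable P"
    unfolding E_def using measurable_compose[OF \<iota> T(1)] by measurable
  have "(\<integral>\<^sup>+x. ennreal (E x) \<partial>P) = (\<integral>\<^sup>+x. ennreal ((envelope G x)\<^sup>2) \<partial>P)"
    using ae by (intro nn_integral_cong_AE) (auto simp: E_def elim: eventually_mono)
  \<comment> \<open>Finiteness has to be established here: \<open>enn2real\<close> sends an infinite
    integral to 0, and a bound on \<open>l2_norm\<close> would then say nothing.\<close>
  also have "\<dots> \<le> ennreal (V\<^sup>2)"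
  proof -
    have "(\<integral>\<^sup>+x. ennreal ((envelope G x)\<^sup>2) \<partial>P) \<le> (\<integral>\<^sup>+x. ennreal (b\<^sup>2) \<partial>P)"
      using env by (intro nn_integral_mono ennreal_leI power_mono)
    also have "\<dots> < \<infinity>" by (simp add: P.emeasure_space_1)
    finally have fin: "(\<integral>\<^sup>+x. ennreal ((envelope G x)\<^sup>2) \<partial>P) < \<infinity>" .
    then have "(\<integral>\<^sup>+x. ennreal ((envelope G x)\<^sup>2) \<partial>P) = ennreal (enn2real (\<integral>\<^sup>+x. ennreal ((envelope G x)\<^sup>2) \<partial>P))"
      by simp
    also have "enn2real (\<integral>\<^sup>+x. ennreal ((envelope G x)\<^sup>2) \<partial>P) = (l2_norm P (envelope G))\<^sup>2"
      by (simp add: l2_norm_def)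
    also have "ennreal \<dots> \<le> ennreal (V\<^sup>2)"
      using V by (intro ennreal_leI power_mono) (simp_all add: l2_norm_def)
    finally show ?thesis .
  qed
  finally have "(\<integral>\<^sup>+x. ennreal (E x) \<partial>P) \<le> ennreal (V\<^sup>2)" .
  moreover have "AE x in P. (envelope G x)\<^sup>2 \<le> E x"
    using ae by (auto simp: E_def elim: eventually_mono)
  moreover have "\<forall>x. 0 \<le> E x" by (simp add: E_def)
  ultimately show ?thesis using Em by blast
qed

lemma sample_distribution:
  fixes X :: "'w \<Rightarrow> 'c::topological_space"
  assumes M: "prob_space M" and iid: "iid_copies M X Y n Xs Ys" and n: "n \<ge> 1"
  defines "N \<equiv> distr M (borel \<Otimes>\<^sub>M borel) (\<lambda>\<omega>. (X \<omega>, Y \<omega>))"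
  defines "Z \<equiv> (\<lambda>\<omega>. \<lambda>i\<in>{..<n}. (Xs i \<omega>, Ys i \<omega>))"
  shows "Z \<in> M \<rightarrow>\<^sub>M PiM {..<n} (\<lambda>_. N)" "distr M (PiM {..<n} (\<lambda>_. N)) Z = PiM {..<n} (\<lambda>_. N)"
proof -
  interpret prob_space M by (rule M)
  let ?B = "borel \<Otimes>\<^sub>M borel :: ('c \<times> real) measure"
  \<comment> \<open>Independence speaks only of indices below n. Beyond them a constant stands in,
    so that every index carries a random variable.\<close>
  let ?W = "\<lambda>i \<omega>. if i < n then (Xs i \<omega>, Ys i \<omega>) else undefined"
  have ind: "indep_vars (\<lambda>_. ?B) (\<lambda>i \<omega>. (Xs i \<omega>, Ys i \<omega>)) {..<n}"
    and id: "\<And>i. i < n \<Longrightarrow> distr M ?B (\<lambda>\<omega>. (Xs i \<omega>, Ys i \<omega>)) = N"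
    using iid by (auto simp: iid_copies_def N_def)
  have rv: "(\<lambda>\<omega>. (Xs i \<omega>, Ys i \<omega>)) \<in> M \<rightarrow>\<^sub>M ?B" if "i < n" for i
    using ind that by (auto simp: indep_vars_def)
  have rvW: "?W i \<in> M \<rightarrow>\<^sub>M ?B" for i
  proof (cases "i < n")
    case True
    then show ?thesis using rv[OF True] by simp
  next
    case False
    then show ?thesis by (simp add: space_pair_measure)
  qed
  have indW: "indep_vars (\<lambda>_. ?B) ?W {..<n}"
    using ind by (subst indep_vars_cong[where Y = "\<lambda>i \<omega>. (Xs i \<omega>, Ys i \<omega>)"]) auto
  have Zeq: "Z = (\<lambda>\<omega>. \<lambda>i\<in>{..<n}. ?W i \<omega>)" by (auto simp: Z_def fun_eq_iff)
  have sN: "sets N = sets ?B" by (simp add: N_def)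
  have sP: "sets (PiM {..<n} (\<lambda>_. N)) = sets (PiM {..<n} (\<lambda>_. ?B))"
    using sN by (intro sets_PiM_cong) auto
  have Zm: "Z \<in> M \<rightarrow>\<^sub>M PiM {..<n} (\<lambda>_. ?B)"
    unfolding Zeq by (intro measurable_restrict rvW)
  then show "Z \<in> M \<rightarrow>\<^sub>M PiM {..<n} (\<lambda>_. N)"
    using sP by (simp cong: measurable_cong_sets)
  have "distr M (PiM {..<n} (\<lambda>_. N)) Z = distr M (PiM {..<n} (\<lambda>_. ?B)) Z"
    by (rule distr_cong[OF refl sP]) simp
  also have "\<dots> = PiM {..<n} (\<lambda>i. distr M ?B (?W i))"
    unfolding Zeq using n by (intro iffD1[OF indep_vars_iff_distr_eq_PiM indW] rvW) (auto simp: lessThan_empty_iff)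
  also have "\<dots> = PiM {..<n} (\<lambda>_. N)"
    using id by (intro PiM_cong) auto
  finally show "distr M (PiM {..<n} (\<lambda>_. N)) Z = PiM {..<n} (\<lambda>_. N)" .
qed

text \<open>f0 competes with f in the minimization; the squares are expanded with
  \<open>y - f = (y - f0) - (f - f0)\<close>.\<close>

lemma least_squares_basic_inequality:
  assumes "least_squares_estimate F n x y f" "f0 \<in> F"
  shows "(\<Sum>i<n. (f (x i) - f0 (x i))\<^sup>2) \<le> 2 * (\<Sum>i<n. (y i - f0 (x i)) * (f (x i) - f0 (x i)))"
proof -
  have "(\<Sum>i<n. (y i - f (x i))\<^sup>2) \<le> (\<Sum>i<n. (y i - f0 (x i))\<^sup>2)"
    using assms by (auto simp: least_squares_estimate_def is_arg_min_def not_less)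
  moreover have "(\<Sum>i<n. (y i - f (x i))\<^sup>2) = (\<Sum>i<n. (y i - f0 (x i))\<^sup>2 -
      2 * ((y i - f0 (x i)) * (f (x i) - f0 (x i))) + (f (x i) - f0 (x i))\<^sup>2)"
    by (intro sum.cong) (auto simp: power2_eq_square algebra_simps)
  ultimately show ?thesis
    by (simp add: sum.distrib sum_subtractf sum_distrib_left)
qed

text \<open>The factor \<open>36864 * (8 * \<sigma>\<^sup>2 + 32 * \<Phi>\<^sup>2)\<close> is \<open>16 * 2304 * (8 * \<sigma>\<^sup>2 + 2 * (4 * \<Phi>)\<^sup>2)\<close>: twice the
  multiplier sum minus the centred sum of squares is at least \<open>n * \<delta>\<^sup>2 / 4\<close> on the shell, and
  Markov's inequality is applied to its square.\<close>

lemma shell_probability: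
  fixes M :: "'w measure" and X :: "'w \<Rightarrow> 'a::metric_space" and n :: nat and \<delta> :: real
  defines "P \<equiv> distr M borel X"
  assumes M: "prob_space M" and X[measurable]: "X \<in> borel_measurable M" and Y[measurable]: "Y \<in> borel_measurable M"
    and iid: "iid_copies M X Y n Xs Ys" and F: "F \<subseteq> borel_measurable borel"
    and \<Phi>: "\<And>f x. f \<in> F \<Longrightarrow> \<bar>f x\<bar> \<le> \<Phi>" and f0F: "f0 \<in> F"
    and reg: "regression_function M X Y f0" and cv: "conditional_variance_bound M X Y f0 \<sigma>"
    and pm: "P_measurable_class P (local_class P F f0 \<delta>)"
      "P_measurable_class P ((\<lambda>g x. (g x)\<^sup>2) ` local_class P F f0 \<delta>)"
    and ent: "\<And>k. k \<ge> 1 \<Longrightarrow> uniform_entropy ((1/2) ^ k) (centered_class F f0) \<le> ereal (H k)"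
    and H0: "\<And>k. H k \<ge> 0" and Hmono: "\<And>k. H k \<le> H (Suc k)"
    and env: "l2_norm P (local_envelope P F f0 \<delta>) \<le> V"
    and n: "n \<ge> 1" and \<delta>: "\<delta> > 0"
  shows "\<exists>Ev\<in>sets M.
    emeasure M Ev \<le> ennreal (36864 * (8 * \<sigma>\<^sup>2 + 32 * \<Phi>\<^sup>2) *
        ((chaining_sum H K)\<^sup>2 + n * (1/4) ^ K) * V\<^sup>2 / (n * \<delta> ^ 4)) \<and>
    (\<forall>\<omega>\<in>space M. \<forall>f. least_squares_estimate F n (\<lambda>i. Xs i \<omega>) (\<lambda>i. Ys i \<omega>) f \<longrightarrow>
        \<delta> / 2 \<le> l2_norm P (\<lambda>x. f x - f0 x) \<longrightarrow> l2_norm P (\<lambda>x. f x - f0 x) \<le> \<delta> \<longrightarrow> \<omega> \<in> Ev)"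
proof -
  interpret prob_space M by (rule M)
  have P: "prob_space P" unfolding P_def by (rule prob_space_distr[OF X])
  define N where "N = distr M (borel \<Otimes>\<^sub>M borel) (\<lambda>\<omega>. (X \<omega>, Y \<omega>))"
  have XY[measurable]: "(\<lambda>\<omega>. (X \<omega>, Y \<omega>)) \<in> M \<rightarrow>\<^sub>M borel \<Otimes>\<^sub>M borel" by measurable
  have N: "prob_space N" unfolding N_def by (rule prob_space_distr[OF XY])
  have sN[measurable_cong]: "sets N = sets (borel \<Otimes>\<^sub>M borel)" by (simp add: N_def)
  have sP[measurable_cong]: "sets P = sets borel" by (simp add: P_def)
  have fstm[measurable]: "fst \<in> N \<rightarrow>\<^sub>M P" by measurable
  have prP: "distr N P fst = P"
  proof -
    have "distr N P fst = distr N borel fst" by (rule distr_cong[OF refl sP]) simp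
    also have "\<dots> = P" unfolding N_def P_def by (subst distr_distr) (auto simp: comp_def)
    finally show ?thesis .
  qed
  have f0m[measurable]: "f0 \<in> borel_measurable borel" using f0F F by blast
  define G where "G = local_class P F f0 \<delta>"
  have Gc: "G \<subseteq> centered_class F f0" by (auto simp: G_def local_class_def)
  have zero: "(\<lambda>_. 0) \<in> G"
    using f0F \<delta> by (auto simp: G_def local_class_def centered_class_def l2_norm_def image_iff
        intro!: bexI[of _ f0])
  have Gb: "\<bar>g x\<bar> \<le> 2 * \<Phi>" if g: "g \<in> G" for g x
  proof -
    obtain f where "f \<in> F" "g = (\<lambda>x. f x - f0 x)"
      using g Gc by (auto simp: centered_class_def)
    then show ?thesis using \<Phi>[of f x] \<Phi>[OF f0F, of x] by auto
  qed
  have Gm: "g \<in> borel_measurable borel" if g: "g \<in> G" for g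
  proof -
    obtain f where "f \<in> F" "g = (\<lambda>x. f x - f0 x)"
      using g Gc by (auto simp: centered_class_def)
    then show ?thesis using F by auto
  qed
  have bdd: "bdd_above ((\<lambda>g. \<bar>g y\<bar>) ` G)" for y
    using Gb by (intro bdd_aboveI2)
  obtain E where E[measurable]: "E \<in> borel_measurable P" and E0: "\<And>x. E x \<ge> 0"
    and envE: "AE x in P. (envelope G x)\<^sup>2 \<le> E x" and intE: "(\<integral>\<^sup>+x. ennreal (E x) \<partial>P) \<le> ennreal (V\<^sup>2)"
  proof -
    have "\<exists>E\<in>borel_measurable P. (\<forall>x. 0 \<le> E x) \<and> (AE x in P. (envelope G x)\<^sup>2 \<le> E x) \<and>
      (\<integral>\<^sup>+x. ennreal (E x) \<partial>P) \<le> ennreal (V\<^sup>2)"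
    proof (rule envelope_measurable_version[where G = G and b = "2 * \<Phi>", OF P])
      show "P_measurable_class P G" using pm(1) by (simp add: G_def)
      show "\<bar>g x\<bar> \<le> 2 * \<Phi>" if "g \<in> G" for g x using Gb[OF that] .
      show "G \<noteq> {}" using zero by blast
      show "l2_norm P (envelope G) \<le> V" using env by (simp add: G_def local_envelope_def)
    qed
    then show ?thesis using that by blast
  qed
  have Eb[measurable]: "E \<in> borel_measurable borel" using E by measurable
  have EX: "(\<integral>\<^sup>+\<omega>. ennreal (E (X \<omega>)) \<partial>M) \<le> ennreal (V\<^sup>2)"
    using intE unfolding P_def by (subst (asm) nn_integral_distr) auto
  define L2 where "L2 = (chaining_sum H K)\<^sup>2 + n * (1/4) ^ K"
  have L2: "L2 \<ge> 0" by (simp add: L2_def)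
  let ?PN = "PiM {..<n} (\<lambda>_. N)"
  let ?e = "\<lambda>z. snd z - f0 (fst z)"
  \<comment> \<open>The means subtracted by the moment bound are known exactly: they vanish for the
    multiplier process, and for the squares they are \<open>(l2_norm P g)\<^sup>2\<close>.\<close>
  have orth: "integrable N (\<lambda>z. ?e z * g (fst z))" "(\<integral>z. ?e z * g (fst z) \<partial>N) = 0" if g: "g \<in> G" for g
  proof -
    have gm[measurable]: "g \<in> borel_measurable borel" using Gm[OF g] .
    have "integrable M (\<lambda>\<omega>. (Y \<omega> - f0 (X \<omega>)) * g (X \<omega>))" "(\<integral>\<omega>. (Y \<omega> - f0 (X \<omega>)) * g (X \<omega>) \<partial>M) = 0"
      using regression_error_orthogonal[OF M X Y reg \<Phi>[OF f0F] gm Gb[OF g]] by auto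
    then show "integrable N (\<lambda>z. ?e z * g (fst z))" "(\<integral>z. ?e z * g (fst z) \<partial>N) = 0"
      unfolding N_def by (auto simp: integrable_distr_eq integral_distr)
  qed
  have "\<exists>\<psi>\<in>borel_measurable ?PN.
     (\<forall>z\<in>space ?PN. \<forall>g\<in>G. ennreal ((\<Sum>i<n. ?e (z i) * g (fst (z i))
          - (\<integral>z. ?e z * g (fst z) \<partial>N))\<^sup>2) \<le> \<psi> z) \<and>
     (\<integral>\<^sup>+z. \<psi> z \<partial>?PN) \<le> ennreal (2304 * 1\<^sup>2 * ((chaining_sum H K)\<^sup>2 + n * (1/4) ^ K) * n * (\<sigma>\<^sup>2 * V\<^sup>2))"
  proof (rule multiplier_second_moment[where G' = G and \<phi> = "\<lambda>g. g", OF P N fstm prP _ ent H0 Hmono Gc zero bdd])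
    show "(\<lambda>x. SUP f\<in>(\<lambda>g. g) ` G. \<bar>\<Sum>i<m. q i * f (x i)\<bar>) \<in> borel_measurable (completion (PiM {..<m} (\<lambda>_. P)))"
      for m and q :: "nat \<Rightarrow> real"
      using pm(1) by (simp add: P_measurable_class_def G_def)
    have "(\<integral>\<^sup>+z. ennreal ((?e z)\<^sup>2 * E (fst z)) \<partial>N) = (\<integral>\<^sup>+\<omega>. ennreal ((Y \<omega> - f0 (X \<omega>))\<^sup>2 * E (X \<omega>)) \<partial>M)"
      unfolding N_def by (subst nn_integral_distr) auto
    also have "\<dots> \<le> ennreal (\<sigma>\<^sup>2) * (\<integral>\<^sup>+\<omega>. ennreal (E (X \<omega>)) \<partial>M)"
      by (rule conditional_variance_nn_integral[OF M X Y f0m cv Eb E0])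
    also have "\<dots> \<le> ennreal (\<sigma>\<^sup>2) * ennreal (V\<^sup>2)" by (intro mult_left_mono EX) auto
    finally show "(\<integral>\<^sup>+z. ennreal ((?e z)\<^sup>2 * E (fst z)) \<partial>N) \<le> ennreal (\<sigma>\<^sup>2 * V\<^sup>2)"
      by (simp add: ennreal_mult)
  qed (use Gb orth E0 envE in auto)
  then obtain \<psi>1 where \<psi>1[measurable]: "\<psi>1 \<in> borel_measurable ?PN"
    and \<psi>1_ge: "\<And>z g. z \<in> space ?PN \<Longrightarrow> g \<in> G \<Longrightarrow> ennreal ((\<Sum>i<n. ?e (z i) * g (fst (z i)))\<^sup>2) \<le> \<psi>1 z"
    and \<psi>1_int: "(\<integral>\<^sup>+z. \<psi>1 z \<partial>?PN) \<le> ennreal (2304 * L2 * n * (\<sigma>\<^sup>2 * V\<^sup>2))"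
    unfolding L2_def using orth(2) by auto
  have sq_int: "integrable N (\<lambda>z. 1 * (g (fst z))\<^sup>2)" "(\<integral>z. 1 * (g (fst z))\<^sup>2 \<partial>N) = (l2_norm P g)\<^sup>2"
    if g: "g \<in> G" for g
  proof -
    have gm[measurable]: "g \<in> borel_measurable borel" using Gm[OF g] .
    interpret N: prob_space N by (rule N)
    have "norm (1 * (g (fst z))\<^sup>2) \<le> (2 * \<Phi>)\<^sup>2" for z :: "'a \<times> real"
      using Gb[OF g, of "fst z"] power_mono[OF Gb[OF g, of "fst z"], of 2] by simp
    then show "integrable N (\<lambda>z. 1 * (g (fst z))\<^sup>2)"
      by (intro N.integrable_const_bound[where B = "(2 * \<Phi>)\<^sup>2"]) auto
    have "(\<integral>z. 1 * (g (fst z))\<^sup>2 \<partial>N) = (\<integral>x. (g x)\<^sup>2 \<partial>distr N P fst)"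
      by (subst integral_distr) auto
    also have "\<dots> = (l2_norm P g)\<^sup>2"
      unfolding prP using Gb[OF g] by (intro l2_norm_sq_eq_integral[OF P, symmetric]) auto
    finally show "(\<integral>z. 1 * (g (fst z))\<^sup>2 \<partial>N) = (l2_norm P g)\<^sup>2" .
  qed
  \<comment> \<open>The second use, with multiplier 1. Squaring has Lipschitz constant
    \<open>4 * \<Phi>\<close> because members of G are bounded by \<open>2 * \<Phi>\<close>.\<close>
  have "\<exists>\<psi>\<in>borel_measurable ?PN.
     (\<forall>z\<in>space ?PN. \<forall>g\<in>G. ennreal ((\<Sum>i<n. 1 * (g (fst (z i)))\<^sup>2
          - (\<integral>z. 1 * (g (fst z))\<^sup>2 \<partial>N))\<^sup>2) \<le> \<psi> z) \<and>
     (\<integral>\<^sup>+z. \<psi> z \<partial>?PN) \<le> ennreal (2304 * (4 * \<Phi>)\<^sup>2 * ((chaining_sum H K)\<^sup>2 + n * (1/4) ^ K) * n * V\<^sup>2)"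
  proof (rule multiplier_second_moment[where G' = G and \<phi> = "\<lambda>g x. (g x)\<^sup>2" and e = "\<lambda>_. 1" and b = "(2 * \<Phi>)\<^sup>2",
        OF P N fstm prP _ ent H0 Hmono Gc zero bdd])
    show "(\<lambda>x. SUP f\<in>(\<lambda>g x. (g x)\<^sup>2) ` G. \<bar>\<Sum>i<m. q i * f (x i)\<bar>) \<in> borel_measurable (completion (PiM {..<m} (\<lambda>_. P)))"
      for m and q :: "nat \<Rightarrow> real"
      using pm(2) unfolding P_measurable_class_def G_def by blast
    show "\<bar>(g x)\<^sup>2\<bar> \<le> (2 * \<Phi>)\<^sup>2" if "g \<in> G" for g x
      using power_mono[OF Gb[OF that, of x], of 2] by simp
    show "\<bar>(f x)\<^sup>2 - (g x)\<^sup>2\<bar> \<le> 4 * \<Phi> * \<bar>f x - g x\<bar>" if "f \<in> G" "g \<in> G" for f g x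
    proof -
      have "\<bar>(f x)\<^sup>2 - (g x)\<^sup>2\<bar> = \<bar>f x + g x\<bar> * \<bar>f x - g x\<bar>"
        by (simp add: power2_eq_square square_diff_square_factored abs_mult)
      also have "\<dots> \<le> (4 * \<Phi>) * \<bar>f x - g x\<bar>"
        using Gb[OF that(1), of x] Gb[OF that(2), of x] by (intro mult_right_mono) auto
      finally show ?thesis .
    qed
    have "(\<integral>\<^sup>+z. ennreal (1\<^sup>2 * E (fst z)) \<partial>N) = (\<integral>\<^sup>+\<omega>. ennreal (E (X \<omega>)) \<partial>M)"
      unfolding N_def by (subst nn_integral_distr) auto
    then show "(\<integral>\<^sup>+z. ennreal (1\<^sup>2 * E (fst z)) \<partial>N) \<le> ennreal (V\<^sup>2)" using EX by simp
  qed (use sq_int E0 envE in auto)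
  then obtain \<psi>2 where \<psi>2[measurable]: "\<psi>2 \<in> borel_measurable ?PN"
    and \<psi>2_ge: "\<And>z g. z \<in> space ?PN \<Longrightarrow> g \<in> G \<Longrightarrow>
        ennreal ((\<Sum>i<n. (g (fst (z i)))\<^sup>2 - (l2_norm P g)\<^sup>2)\<^sup>2) \<le> \<psi>2 z"
    and \<psi>2_int: "(\<integral>\<^sup>+z. \<psi>2 z \<partial>?PN) \<le> ennreal (2304 * (4 * \<Phi>)\<^sup>2 * L2 * n * V\<^sup>2)"
    unfolding L2_def using sq_int(2) by auto
  define Z where "Z = (\<lambda>\<omega>. \<lambda>i\<in>{..<n}. (Xs i \<omega>, Ys i \<omega>))"
  have Z[measurable]: "Z \<in> M \<rightarrow>\<^sub>M ?PN" and dZ: "distr M ?PN Z = ?PN"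
    using sample_distribution[OF M iid n] by (simp_all add: Z_def N_def)
  have lin: "8 * ennreal x + 2 * ennreal y = ennreal (8 * x + 2 * y)" if "x \<ge> 0" "y \<ge> 0" for x y
    using that by (simp add: ennreal_plus ennreal_mult)
  define t where "t = (n * \<delta>\<^sup>2 / 4)\<^sup>2"
  have t: "t > 0" using n \<delta> by (simp add: t_def)
  \<comment> \<open>Defined through the majorants rather than the estimate, hence measurable and
    valid for every least squares solution in the shell at once.\<close>
  define Ev where "Ev = {\<omega> \<in> space M. 1 \<le> ennreal (1 / t) * (8 * \<psi>1 (Z \<omega>) + 2 * \<psi>2 (Z \<omega>))}"
  have Ev: "Ev \<in> sets M" unfolding Ev_def by measurable
  have "emeasure M Ev \<le> ennreal (1 / t) * (\<integral>\<^sup>+\<omega>. 8 * \<psi>1 (Z \<omega>) + 2 * \<psi>2 (Z \<omega>) \<partial>M)"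
    using nn_integral_Markov_inequality[of "\<lambda>\<omega>. 8 * \<psi>1 (Z \<omega>) + 2 * \<psi>2 (Z \<omega>)" "space M" M "ennreal (1 / t)"]
    by (simp add: Ev_def)
  also have "(\<integral>\<^sup>+\<omega>. 8 * \<psi>1 (Z \<omega>) + 2 * \<psi>2 (Z \<omega>) \<partial>M) = (\<integral>\<^sup>+z. 8 * \<psi>1 z + 2 * \<psi>2 z \<partial>distr M ?PN Z)"
    by (subst nn_integral_distr) auto
  also have "\<dots> = 8 * (\<integral>\<^sup>+z. \<psi>1 z \<partial>?PN) + 2 * (\<integral>\<^sup>+z. \<psi>2 z \<partial>?PN)"
    unfolding dZ by (simp add: nn_integral_add nn_integral_cmult)
  also have "\<dots> \<le> 8 * ennreal (2304 * L2 * n * (\<sigma>\<^sup>2 * V\<^sup>2)) + 2 * ennreal (2304 * (4 * \<Phi>)\<^sup>2 * L2 * n * V\<^sup>2)"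
    using \<psi>1_int \<psi>2_int by (intro add_mono mult_left_mono) auto
  also have "\<dots> = ennreal (8 * (2304 * L2 * n * (\<sigma>\<^sup>2 * V\<^sup>2)) + 2 * (2304 * (4 * \<Phi>)\<^sup>2 * L2 * n * V\<^sup>2))"
    using L2 by (intro lin) auto
  also have "ennreal (1 / t) * \<dots> =
      ennreal (1 / t * (8 * (2304 * L2 * n * (\<sigma>\<^sup>2 * V\<^sup>2)) + 2 * (2304 * (4 * \<Phi>)\<^sup>2 * L2 * n * V\<^sup>2)))"
    using t by (intro ennreal_mult'[symmetric]) simp
  also have "1 / t * (8 * (2304 * L2 * n * (\<sigma>\<^sup>2 * V\<^sup>2)) + 2 * (2304 * (4 * \<Phi>)\<^sup>2 * L2 * n * V\<^sup>2)) =
      36864 * (8 * \<sigma>\<^sup>2 + 32 * \<Phi>\<^sup>2) * L2 * V\<^sup>2 / (n * \<delta> ^ 4)"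
    using n \<delta> by (simp add: t_def field_simps power2_eq_square power4_eq_xxxx)
  finally have meas: "emeasure M Ev \<le> ennreal (36864 * (8 * \<sigma>\<^sup>2 + 32 * \<Phi>\<^sup>2) * L2 * V\<^sup>2 / (n * \<delta> ^ 4))"
    by (simp add: mult_left_mono)
  have "\<omega> \<in> Ev" if \<omega>: "\<omega> \<in> space M" and ls: "least_squares_estimate F n (\<lambda>i. Xs i \<omega>) (\<lambda>i. Ys i \<omega>) f"
    and lo: "\<delta> / 2 \<le> l2_norm P (\<lambda>x. f x - f0 x)" and hi: "l2_norm P (\<lambda>x. f x - f0 x) \<le> \<delta>" for \<omega> f
  proof -
    have "f \<in> F" using ls by (simp add: least_squares_estimate_def is_arg_min_def)
    define g where "g = (\<lambda>x. f x - f0 x)"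
    have g: "g \<in> G" using \<open>f \<in> F\<close> hi by (auto simp: G_def local_class_def centered_class_def g_def)
    have Zs: "Z \<omega> \<in> space ?PN" using measurable_space[OF Z \<omega>] .
    define a where "a = (\<Sum>i<n. (Ys i \<omega> - f0 (Xs i \<omega>)) * g (Xs i \<omega>))"
    define b where "b = (\<Sum>i<n. (g (Xs i \<omega>))\<^sup>2 - (l2_norm P g)\<^sup>2)"
    have a: "ennreal (a\<^sup>2) \<le> \<psi>1 (Z \<omega>)"
      using \<psi>1_ge[OF Zs g] by (simp add: a_def Z_def)
    have b: "ennreal (b\<^sup>2) \<le> \<psi>2 (Z \<omega>)"
      using \<psi>2_ge[OF Zs g] by (simp add: b_def Z_def)
    have "(\<Sum>i<n. (g (Xs i \<omega>))\<^sup>2) \<le> 2 * a"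
      using least_squares_basic_inequality[OF ls f0F] by (simp add: a_def g_def)
    moreover have "b = (\<Sum>i<n. (g (Xs i \<omega>))\<^sup>2) - n * (l2_norm P g)\<^sup>2"
      by (simp add: b_def sum_subtractf)
    moreover have "n * (\<delta> / 2)\<^sup>2 \<le> n * (l2_norm P g)\<^sup>2"
      using lo \<delta> by (intro mult_left_mono power_mono) (auto simp: g_def)
    ultimately have "n * \<delta>\<^sup>2 / 4 \<le> 2 * a + - b" by (simp add: power_divide)
    then have "t \<le> (2 * a + - b)\<^sup>2" unfolding t_def by (intro power_mono) auto
    also have "\<dots> \<le> 2 * (2 * a)\<^sup>2 + 2 * (- b)\<^sup>2" by (rule square_sum_le)
    also have "\<dots> = 8 * a\<^sup>2 + 2 * b\<^sup>2" by (simp add: power_mult_distrib)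
    finally have "1 \<le> 1 / t * (8 * a\<^sup>2 + 2 * b\<^sup>2)" using t by (simp add: field_simps)
    then have "1 \<le> ennreal (1 / t * (8 * a\<^sup>2 + 2 * b\<^sup>2))" by simp
    also have "\<dots> = ennreal (1 / t) * (8 * ennreal (a\<^sup>2) + 2 * ennreal (b\<^sup>2))"
      using t by (subst ennreal_mult') (simp_all add: lin)
    also have "\<dots> \<le> ennreal (1 / t) * (8 * \<psi>1 (Z \<omega>) + 2 * \<psi>2 (Z \<omega>))"
      using a b by (intro mult_left_mono add_mono) auto
    finally show "\<omega> \<in> Ev" using \<omega> by (simp add: Ev_def)
  qed
  then show ?thesis using Ev meas unfolding L2_def by blast
qed

subsection \<open>Peeling\<close>

text \<open>Since V is at most of order \<open>\<delta> powr s\<close>, the left side scales like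
  \<open>\<delta> powr (2 * s - 4)\<close>. Substituting \<delta> splits this into powers of 2, D
  and r, and \<open>rate\<close> absorbs the power of r together with L / n.\<close>

lemma shell_bound:
  fixes n j :: nat and c L r s K0 D V c1 \<delta> :: real
  assumes c: "c \<ge> 0" and L: "L \<ge> 0" and n: "n \<ge> 1" and rate: "r powr (2 * (2 - s)) * L \<le> K0 * n"
    and r: "r > 0" and D: "D > 0" and s: "s \<le> 1"
    and V: "0 \<le> V" "V \<le> c1 * \<delta> powr s" and \<delta>: "\<delta> = 2 ^ Suc j * (D / r)"
  shows "c * L * V\<^sup>2 / (n * \<delta> ^ 4) \<le> c * c1\<^sup>2 * K0 * D powr (2 * s - 4) * (1/2) ^ Suc j"
proof -
  have \<delta>0: "\<delta> > 0" unfolding \<delta> using r D by (intro mult_pos_pos divide_pos_pos) auto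
  have K0: "K0 \<ge> 0"
  proof -
    have "0 \<le> K0 * n" using rate L by (meson mult_nonneg_nonneg order_trans powr_ge_zero)
    then show ?thesis using n by (simp add: zero_le_mult_iff)
  qed
  have "V\<^sup>2 \<le> (c1 * \<delta> powr s)\<^sup>2" using V(2,1) by (rule power_mono)
  also have "(c1 * \<delta> powr s)\<^sup>2 = c1\<^sup>2 * (\<delta> powr (2 * s - 4) * \<delta> ^ 4)"
  proof -
    have "\<delta> powr (2 * s - 4) * \<delta> ^ 4 = \<delta> powr (2 * s - 4) * \<delta> powr 4"
      using \<delta>0 by simp
    also have "\<dots> = \<delta> powr (2 * s)" by (simp only: flip: powr_add) simp
    also have "\<dots> = (\<delta> powr s)\<^sup>2" by (simp add: power2_eq_square flip: powr_add)
    finally show ?thesis by (simp add: power_mult_distrib)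
  qed
  finally have V2: "V\<^sup>2 / \<delta> ^ 4 \<le> c1\<^sup>2 * \<delta> powr (2 * s - 4)"
    using \<delta>0 by (simp add: divide_le_eq mult.assoc)
  \<comment> \<open>As s \<le> 1 the exponent is at most -2; the weaker -1 already gives a series
    over the shells with sum 1.\<close>
  have "(2 ^ Suc j :: real) powr (2 * s - 4) \<le> (2 ^ Suc j) powr (- 1)"
    using s by (intro powr_mono one_le_power) auto
  also have "\<dots> = (1/2) ^ Suc j"
    by (simp add: powr_minus power_one_over inverse_eq_divide del: power_Suc)
  finally have two: "(2 ^ Suc j :: real) powr (2 * s - 4) \<le> (1/2) ^ Suc j" .
  have "\<delta> powr (2 * s - 4) = (2 ^ Suc j) powr (2 * s - 4) * (D powr (2 * s - 4) / r powr (2 * s - 4))"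
    using r D by (simp add: \<delta> powr_mult powr_divide del: power_Suc)
  also have "1 / r powr (2 * s - 4) = r powr (2 * (2 - s))"
    using powr_minus_divide[of r "2 * s - 4"] by (simp add: algebra_simps)
  then have "D powr (2 * s - 4) / r powr (2 * s - 4) = D powr (2 * s - 4) * r powr (2 * (2 - s))"
    by (metis times_divide_eq_right mult_1_right)
  also have "(2 ^ Suc j) powr (2 * s - 4) * (D powr (2 * s - 4) * r powr (2 * (2 - s)))
      \<le> (1/2) ^ Suc j * (D powr (2 * s - 4) * r powr (2 * (2 - s)))"
    using two by (intro mult_right_mono) auto
  finally have d: "\<delta> powr (2 * s - 4) \<le> (1/2) ^ Suc j * (D powr (2 * s - 4) * r powr (2 * (2 - s)))" .
  have "c * L * V\<^sup>2 / (n * \<delta> ^ 4) = c * L / n * (V\<^sup>2 / \<delta> ^ 4)" by simp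
  also have "\<dots> \<le> c * L / n * (c1\<^sup>2 * ((1/2) ^ Suc j * (D powr (2 * s - 4) * r powr (2 * (2 - s)))))"
    using c L V2 d by (intro mult_left_mono order_trans[OF V2]) auto
  also have "\<dots> = c * c1\<^sup>2 * (r powr (2 * (2 - s)) * L / n) * D powr (2 * s - 4) * (1/2) ^ Suc j"
    by simp
  also have "\<dots> \<le> c * c1\<^sup>2 * K0 * D powr (2 * s - 4) * (1/2) ^ Suc j"
    using c rate n by (intro mult_right_mono mult_left_mono) (auto simp: divide_le_eq)
  finally show ?thesis .
qed

lemma dyadic_shell:
  fixes x :: real
  assumes "x \<ge> 1"
  obtains j where "2 ^ j \<le> x" "x \<le> 2 ^ Suc j"
proof -
  obtain m where "x < 2 ^ m" using real_arch_pow[of 2 x] by auto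
  moreover have "(2::real) ^ m \<le> 2 ^ Suc m" by simp
  ultimately have ex: "\<exists>j. x < 2 ^ Suc j" by (intro exI[of _ m]) linarith
  define j where "j = (LEAST j. x < 2 ^ Suc j)"
  have j: "x < 2 ^ Suc j" unfolding j_def by (rule LeastI_ex[OF ex])
  have "2 ^ j \<le> x"
  proof (cases j)
    case 0
    then show ?thesis using assms by simp
  next
    case (Suc i)
    then have "\<not> x < 2 ^ Suc i" using not_less_Least[of i "\<lambda>j. x < 2 ^ Suc j"] by (simp add: j_def)
    then show ?thesis using Suc by simp
  qed
  then show ?thesis using j that by simp
qed

lemma (in prob_space) outer_measure_le_one: "outer_measure_of M {\<omega> \<in> space M. Q \<omega>} \<le> 1"
proof -
  have "outer_measure_of M {\<omega> \<in> space M. Q \<omega>} \<le> outer_measure_of M (space M)"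
    by (rule outer_measure_of_mono) auto
  then show ?thesis by (simp add: emeasure_space_1)
qed

text \<open>Countable subadditivity for a set that may fail to be measurable; the weights
  \<open>(1/2) ^ Suc j\<close> add up to 1.\<close>

lemma (in prob_space) outer_measure_geometric_cover:
  assumes Ev: "\<And>j. Ev j \<in> events" and le: "\<And>j. emeasure M (Ev j) \<le> ennreal (c * (1/2) ^ Suc j)"
    and c: "c \<ge> 0" and cov: "A \<subseteq> (\<Union>j. Ev j)"
  shows "outer_measure_of M A \<le> ennreal c"
proof -
  have "outer_measure_of M A \<le> outer_measure_of M (\<Union>j. Ev j)" by (rule outer_measure_of_mono[OF cov])
  also have "\<dots> = emeasure M (\<Union>j. Ev j)" using Ev by (intro outer_measure_of_eq) auto
  also have "\<dots> \<le> (\<Sum>j. emeasure M (Ev j))"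
    using Ev by (intro emeasure_subadditive_countably) auto
  also have "\<dots> \<le> (\<Sum>j. ennreal (c * (1/2) ^ Suc j))" by (intro suminf_le le) auto
  also have "\<dots> = ennreal c"
  proof (rule suminf_ennreal_eq)
    show "(\<lambda>j. c * (1/2) ^ Suc j) sums c" using sums_mult[OF power_half_series, of c] by simp
  qed (use c in auto)
  finally show ?thesis .
qed

theorem theorem5p1:
  fixes \<sigma> \<Phi> A \<alpha> C\<^sub>0 :: real
  assumes "\<sigma> > 0" and "A > 0" and "\<alpha> \<ge> 0" and "C\<^sub>0 > 0"
  shows "\<exists>C>0. \<forall>(\<beta>::real) (s::real) (n::nat) (D::real)
      (M :: 'w measure) (X :: 'w \<Rightarrow> 'a::metric_space) (Y :: 'w \<Rightarrow> real)
      (Xs :: nat \<Rightarrow> 'w \<Rightarrow> 'a) (Ys :: nat \<Rightarrow> 'w \<Rightarrow> real)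
      (F :: ('a \<Rightarrow> real) set) (f0 :: 'a \<Rightarrow> real) (fhat :: 'w \<Rightarrow> 'a \<Rightarrow> real).
    prob_space M \<longrightarrow>
    X \<in> borel_measurable M \<longrightarrow>
    Y \<in> borel_measurable M \<longrightarrow>
    iid_copies M X Y n Xs Ys \<longrightarrow>
    F \<subseteq> borel_measurable borel \<longrightarrow>
    (SUP f\<in>F. sup_norm f) = ereal \<Phi> \<longrightarrow>
    f0 \<in> F \<longrightarrow>
    regression_function M X Y f0 \<longrightarrow>
    conditional_variance_bound M X Y f0 \<sigma> \<longrightarrow>
    (\<forall>\<delta>>0. P_measurable_class (distr M borel X) (local_class (distr M borel X) F f0 \<delta>) \<and>
       P_measurable_class (distr M borel X)
         ((\<lambda>g x. (g x)\<^sup>2) ` local_class (distr M borel X) F f0 \<delta>)) \<longrightarrow>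
    \<beta> \<ge> 0 \<longrightarrow>
    (\<forall>\<zeta>\<in>{0<..<1}. uniform_entropy \<zeta> (centered_class F f0)
       \<le> ereal (A / \<zeta> powr \<alpha> * ln (1 / \<zeta>) powr \<beta>)) \<longrightarrow>
    \<alpha> < 2 \<or> \<beta> = 0 \<longrightarrow>
    s \<in> {0..1} \<longrightarrow>
    (\<forall>\<delta>>0. l2_norm (distr M borel X) (local_envelope (distr M borel X) F f0 \<delta>)
       \<le> C\<^sub>0 * \<Phi> powr (1 - s) * \<delta> powr s) \<longrightarrow>
    (\<forall>\<omega>\<in>space M. least_squares_estimate F n (\<lambda>i. Xs i \<omega>) (\<lambda>i. Ys i \<omega>) (fhat \<omega>)) \<longrightarrow>
    n \<ge> 1 \<longrightarrow>
    D > 0 \<longrightarrow>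
    outer_measure_of M
        {\<omega> \<in> space M. lse_rate \<alpha> s n * l2_norm (distr M borel X) (\<lambda>x. fhat \<omega> x - f0 x) \<ge> D}
      \<le> ennreal (C * D powr (- (4 * (2 - s) / 3)))"
proof -
  \<comment> \<open>B, A' and K0 are obtained before \<beta>, s, n and the model are introduced,
    which is why they have to be uniform in these.\<close>
  obtain B :: real where B0: "B \<ge> 0" and B: "\<And>(G :: ('a \<Rightarrow> real) set) \<beta> g y. (\<lambda>_. 0) \<in> G \<Longrightarrow> g \<in> G \<Longrightarrow> g y \<noteq> 0 \<Longrightarrow>
     (\<forall>\<zeta>\<in>{0<..<1}. uniform_entropy \<zeta> G \<le> ereal (A / \<zeta> powr \<alpha> * ln (1 / \<zeta>) powr \<beta>)) \<Longrightarrow> \<beta> \<le> B"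
    by (rule entropy_exponent_bounded[OF \<open>A > 0\<close>, of \<alpha>]) blast
  obtain A' where A'0: "A' \<ge> 0" and A': "\<And>\<beta> \<zeta>. 0 \<le> \<beta> \<Longrightarrow> \<beta> \<le> B \<Longrightarrow> \<alpha> < 2 \<or> \<beta> = 0 \<Longrightarrow> 0 < \<zeta> \<Longrightarrow> \<zeta> < 1 \<Longrightarrow>
     A / \<zeta> powr \<alpha> * ln (1 / \<zeta>) powr \<beta> \<le> A' * (1 / \<zeta>) powr entropy_index \<alpha>"
    by (rule log_factor_absorbed[OF \<open>A > 0\<close> \<open>\<alpha> \<ge> 0\<close> B0]) blast
  define H where "H k = A' * (2 ^ k) powr entropy_index \<alpha>" for k :: nat
  obtain K0 where K0: "K0 \<ge> 0" and rate: "\<And>s n. s \<le> 1 \<Longrightarrow> n \<ge> 1 \<Longrightarrow> \<exists>K. lse_rate \<alpha> s n powr (2 * (2 - s)) *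
     ((chaining_sum H K)\<^sup>2 + n * (1/4) ^ K) \<le> K0 * n"
    using rate_chaining_bound[OF A'0 \<open>\<alpha> \<ge> 0\<close>] unfolding H_def by blast
  define c where "c = 36864 * (8 * \<sigma>\<^sup>2 + 32 * \<Phi>\<^sup>2)"
  \<comment> \<open>\<open>max 1 \<Phi>\<close> dominates \<open>\<Phi> powr (1 - s)\<close> for all
    s in [0, 1].\<close>
  define c1 where "c1 = C\<^sub>0 * max 1 \<Phi>"
  have c: "c \<ge> 0" by (simp add: c_def)
  \<comment> \<open>The summand 1 makes C \<ge> 1, so for D < 1 the claimed bound is at least 1 and
    holds trivially.\<close>
  define C where "C = 1 + c * c1\<^sup>2 * K0"
  have C: "C \<ge> 1" using c K0 by (simp add: C_def)
  have H0: "H k \<ge> 0" for k using A'0 by (simp add: H_def)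
  have Hmono: "H k \<le> H (Suc k)" for k
    unfolding H_def using A'0 \<open>\<alpha> \<ge> 0\<close>
    by (intro mult_left_mono powr_mono2 power_increasing) (auto simp: entropy_index_def)
  show ?thesis
  proof (intro exI[of _ C] conjI allI impI)
    show "C > 0" using C by simp
  next
    fix \<beta> s :: real and n :: nat and D :: real and M :: "'w measure" and X :: "'w \<Rightarrow> 'a" and Y :: "'w \<Rightarrow> real"
      and Xs :: "nat \<Rightarrow> 'w \<Rightarrow> 'a" and Ys :: "nat \<Rightarrow> 'w \<Rightarrow> real" and F :: "('a \<Rightarrow> real) set"
      and f0 :: "'a \<Rightarrow> real" and fhat :: "'w \<Rightarrow> 'a \<Rightarrow> real"
    let ?P = "distr M borel X"
    assume M: "prob_space M" and X: "X \<in> borel_measurable M" and Y: "Y \<in> borel_measurable M"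
      and iid: "iid_copies M X Y n Xs Ys" and F: "F \<subseteq> borel_measurable borel"
      and sup: "(SUP f\<in>F. sup_norm f) = ereal \<Phi>" and f0: "f0 \<in> F"
      and reg: "regression_function M X Y f0" and cv: "conditional_variance_bound M X Y f0 \<sigma>"
      and pm: "\<forall>\<delta>>0. P_measurable_class ?P (local_class ?P F f0 \<delta>) \<and>
         P_measurable_class ?P ((\<lambda>g x. (g x)\<^sup>2) ` local_class ?P F f0 \<delta>)"
      and \<beta>: "\<beta> \<ge> 0"
      and ent: "\<forall>\<zeta>\<in>{0<..<1}. uniform_entropy \<zeta> (centered_class F f0) \<le> ereal (A / \<zeta> powr \<alpha> * ln (1 / \<zeta>) powr \<beta>)"
      and \<alpha>\<beta>: "\<alpha> < 2 \<or> \<beta> = 0" and s: "s \<in> {0..1}"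
      and env: "\<forall>\<delta>>0. l2_norm ?P (local_envelope ?P F f0 \<delta>) \<le> C\<^sub>0 * \<Phi> powr (1 - s) * \<delta> powr s"
      and ls: "\<forall>\<omega>\<in>space M. least_squares_estimate F n (\<lambda>i. Xs i \<omega>) (\<lambda>i. Ys i \<omega>) (fhat \<omega>)"
      and n: "n \<ge> 1" and D: "D > 0"
    interpret prob_space M by (rule M)
    define r where "r = lse_rate \<alpha> s n"
    define nrm where "nrm \<omega> = l2_norm ?P (\<lambda>x. fhat \<omega> x - f0 x)" for \<omega>
    define Q where "Q = {\<omega> \<in> space M. r * nrm \<omega> \<ge> D}"
    have r0: "r \<ge> 0" by (simp add: r_def lse_rate_def)
    have \<Phi>: "\<bar>f x\<bar> \<le> \<Phi>" if "f \<in> F" for f x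
    proof -
      have "ereal \<bar>f x\<bar> \<le> sup_norm f" unfolding sup_norm_def by (rule SUP_upper) simp
      also have "\<dots> \<le> ereal \<Phi>" unfolding sup[symmetric] using that by (rule SUP_upper)
      finally show ?thesis by simp
    qed
    have \<Phi>0: "\<Phi> \<ge> 0" using \<Phi>[OF f0, of undefined] by linarith
    have zero: "(\<lambda>_. 0) \<in> centered_class F f0"
      using f0 by (auto simp: centered_class_def image_iff intro!: bexI[of _ f0])
    have "outer_measure_of M Q \<le> ennreal (C * D powr (- (4 * (2 - s) / 3)))"
    proof (cases "D < 1")
      case True
      have "D powr (4 * (2 - s) / 3) \<le> 1" using True D s by (intro powr_le1) auto
      then have "1 \<le> D powr (- (4 * (2 - s) / 3))" using D by (simp add: powr_minus one_le_inverse_iff)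
      then have "1 \<le> C * D powr (- (4 * (2 - s) / 3))"
        using mult_mono[OF C, of 1] C by simp
      then have "1 \<le> ennreal (C * D powr (- (4 * (2 - s) / 3)))" by simp
      with outer_measure_le_one show ?thesis unfolding Q_def by (rule order_trans)
    next
      case D1: False
      show ?thesis
      \<comment> \<open>The shells require r > 0, and the bound on \<beta> requires a nonzero
        function in the centred class. If either fails, the scaled error is 0 and, as D > 0, the
        event is empty.\<close>
      proof (cases "r > 0 \<and> (\<exists>g\<in>centered_class F f0. \<exists>y. g y \<noteq> 0)")
        case False
        have "Q = {}"
        proof -
          have z: "r * nrm \<omega> = 0" if "\<omega> \<in> space M" for \<omega>
          proof (cases "r > 0")
            case True
            have "fhat \<omega> \<in> F" using ls that by (auto simp: least_squares_estimate_def is_arg_min_def)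
            then have "(\<lambda>x. fhat \<omega> x - f0 x) \<in> centered_class F f0" by (auto simp: centered_class_def)
            then have "(\<lambda>x. fhat \<omega> x - f0 x) = (\<lambda>_. 0)" using False True by fastforce
            then have "nrm \<omega> = l2_norm ?P (\<lambda>_. 0)" unfolding nrm_def by simp
            then show ?thesis by (simp add: l2_norm_def)
          qed (use r0 in auto)
          show ?thesis
          proof (rule equals0I)
            fix \<omega> assume "\<omega> \<in> Q"
            then have "\<omega> \<in> space M" "D \<le> r * nrm \<omega>" by (auto simp: Q_def)
            with z[of \<omega>] D show False by linarith
          qed
        qed
        then show ?thesis by (simp add: outer_measure_of_eq)
      next
        case True
        then have r: "r > 0" by simp
        obtain g y where "g \<in> centered_class F f0" "g y \<noteq> 0" using True by blast
        then have \<beta>B: "\<beta> \<le> B" using B[OF zero _ _ ent] by blast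
        have Hent: "uniform_entropy ((1/2) ^ k) (centered_class F f0) \<le> ereal (H k)" if "k \<ge> 1" for k
        proof -
          have \<zeta>: "0 < (1/2::real) ^ k" "(1/2::real) ^ k < 1"
            using that by (auto intro: power_Suc_less_one simp: power_less_one_iff)
          then have "uniform_entropy ((1/2) ^ k) (centered_class F f0) \<le>
             ereal (A / ((1/2) ^ k) powr \<alpha> * ln (1 / (1/2) ^ k) powr \<beta>)"
            using ent by (auto simp del: ereal_less_eq)
          also have "\<dots> \<le> ereal (A' * (1 / (1/2) ^ k) powr entropy_index \<alpha>)"
            using A'[OF \<beta> \<beta>B \<alpha>\<beta> \<zeta>] by simp
          also have "1 / (1/2::real) ^ k = 2 ^ k" by (simp add: power_divide)
          finally show ?thesis by (simp add: H_def)
        qed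
        obtain K where K: "r powr (2 * (2 - s)) * ((chaining_sum H K)\<^sup>2 + n * (1/4) ^ K) \<le> K0 * n"
          using rate[of s n] s n unfolding r_def by auto
        define L where "L = (chaining_sum H K)\<^sup>2 + n * (1/4) ^ K"
        have L: "L \<ge> 0" by (simp add: L_def)
        \<comment> \<open>Outer radius of the j-th shell, which starts at
          \<open>2 ^ j * (D / r)\<close>.\<close>
        define \<delta> where "\<delta> j = 2 ^ Suc j * (D / r)" for j
        have \<delta>: "\<delta> j > 0" for j using r D by (simp add: \<delta>_def)
        define V where "V j = C\<^sub>0 * \<Phi> powr (1 - s) * \<delta> j powr s" for j
        have "\<exists>Ev\<in>sets M. emeasure M Ev \<le> ennreal (36864 * (8 * \<sigma>\<^sup>2 + 32 * \<Phi>\<^sup>2) *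
              ((chaining_sum H K)\<^sup>2 + n * (1/4) ^ K) * (V j)\<^sup>2 / (n * \<delta> j ^ 4)) \<and>
          (\<forall>\<omega>\<in>space M. \<forall>f. least_squares_estimate F n (\<lambda>i. Xs i \<omega>) (\<lambda>i. Ys i \<omega>) f \<longrightarrow>
            \<delta> j / 2 \<le> l2_norm ?P (\<lambda>x. f x - f0 x) \<longrightarrow> l2_norm ?P (\<lambda>x. f x - f0 x) \<le> \<delta> j \<longrightarrow> \<omega> \<in> Ev)" for j
        proof (rule shell_probability[OF M X Y iid F])
          show "\<bar>f x\<bar> \<le> \<Phi>" if "f \<in> F" for f x using that by (rule \<Phi>)
          show "l2_norm ?P (local_envelope ?P F f0 (\<delta> j)) \<le> V j"
            using env \<delta>[of j] by (simp add: V_def)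
        qed (use f0 reg cv pm Hent H0 Hmono n \<delta>[of j] in simp_all)
        then have "\<forall>j. \<exists>Ev. Ev \<in> sets M \<and> emeasure M Ev \<le> ennreal (c * L * (V j)\<^sup>2 / (n * \<delta> j ^ 4)) \<and>
          (\<forall>\<omega>\<in>space M. \<forall>f. least_squares_estimate F n (\<lambda>i. Xs i \<omega>) (\<lambda>i. Ys i \<omega>) f \<longrightarrow>
            \<delta> j / 2 \<le> l2_norm ?P (\<lambda>x. f x - f0 x) \<longrightarrow> l2_norm ?P (\<lambda>x. f x - f0 x) \<le> \<delta> j \<longrightarrow> \<omega> \<in> Ev)"
          unfolding L_def c_def by (simp only: Bex_def simp_thms)
        from choice[OF this] obtain Ev where Ev: "\<And>j. Ev j \<in> sets M"
          and Ev_le: "\<And>j. emeasure M (Ev j) \<le> ennreal (c * L * (V j)\<^sup>2 / (n * \<delta> j ^ 4))"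
          and Ev_in: "\<And>j. \<forall>\<omega>\<in>space M. \<forall>f. least_squares_estimate F n (\<lambda>i. Xs i \<omega>) (\<lambda>i. Ys i \<omega>) f \<longrightarrow>
            \<delta> j / 2 \<le> l2_norm ?P (\<lambda>x. f x - f0 x) \<longrightarrow> l2_norm ?P (\<lambda>x. f x - f0 x) \<le> \<delta> j \<longrightarrow> \<omega> \<in> Ev j"
          by blast
        define d where "d = c * c1\<^sup>2 * K0 * D powr (2 * s - 4)"
        have d: "d \<ge> 0" using c K0 by (simp add: d_def)
        have \<Phi>s: "\<Phi> powr (1 - s) \<le> max 1 \<Phi>"
        proof (cases "\<Phi> \<le> 1")
          case True
          then have "\<Phi> powr (1 - s) \<le> 1" using \<Phi>0 s by (intro powr_le1) auto
          then show ?thesis by simp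
        next
          case False
          then have "\<Phi> powr (1 - s) \<le> \<Phi> powr 1" using s by (intro powr_mono) auto
          then show ?thesis using False by simp
        qed
        have "c * L * (V j)\<^sup>2 / (n * \<delta> j ^ 4) \<le> d * (1/2) ^ Suc j" for j
          unfolding d_def
        proof (rule shell_bound[where r = r, OF c L n _ r D _ _ _ \<delta>_def])
          show "r powr (2 * (2 - s)) * L \<le> K0 * n" using K by (simp add: L_def)
          show "V j \<le> c1 * \<delta> j powr s"
            unfolding V_def c1_def using \<open>C\<^sub>0 > 0\<close> \<Phi>s by (intro mult_right_mono mult_left_mono) auto
        qed (use s \<open>C\<^sub>0 > 0\<close> in \<open>auto simp: V_def\<close>)
        then have le: "emeasure M (Ev j) \<le> ennreal (d * (1/2) ^ Suc j)" for j
          by (intro order_trans[OF Ev_le ennreal_leI])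
        have cov: "Q \<subseteq> (\<Union>j. Ev j)"
        proof
          fix \<omega> assume "\<omega> \<in> Q"
          then have \<omega>: "\<omega> \<in> space M" "D \<le> r * nrm \<omega>" by (auto simp: Q_def)
          then have "1 \<le> nrm \<omega> / (D / r)" using r D by (simp add: field_simps)
          then obtain j where "2 ^ j \<le> nrm \<omega> / (D / r)" "nrm \<omega> / (D / r) \<le> 2 ^ Suc j"
            by (rule dyadic_shell)
          then have "\<delta> j / 2 \<le> nrm \<omega>" "nrm \<omega> \<le> \<delta> j"
            using r D by (auto simp: \<delta>_def field_simps)
          then show "\<omega> \<in> (\<Union>j. Ev j)" using Ev_in[of j] ls \<omega> unfolding nrm_def by blast
        qed
        have "outer_measure_of M Q \<le> ennreal d"
          by (rule outer_measure_geometric_cover[OF Ev le d cov])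
        also have "d \<le> C * D powr (- (4 * (2 - s) / 3))"
        proof -
          \<comment> \<open>Here D \<ge> 1, so the exponent may be raised from -2 (2 - s) to -4 (2 -
            s) / 3.\<close>
          have "D powr (2 * s - 4) \<le> D powr (- (4 * (2 - s) / 3))"
            using D1 s by (intro powr_mono) (auto simp: field_simps)
          moreover have "c * c1\<^sup>2 * K0 \<le> C" by (simp add: C_def)
          ultimately show ?thesis unfolding d_def using C by (intro mult_mono) auto
        qed
        then have "ennreal d \<le> ennreal (C * D powr (- (4 * (2 - s) / 3)))" by (rule ennreal_leI)
        finally show ?thesis .
      qed
    qed
    then show "outer_measure_of M {\<omega> \<in> space M. D \<le> lse_rate \<alpha> s n * l2_norm ?P (\<lambda>x. fhat \<omega> x - f0 x)}
       \<le> ennreal (C * D powr (- (4 * (2 - s) / 3)))"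
      by (simp only: Q_def r_def nrm_def)
  qed
qed

end
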